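(* Every BPW complete local operator algebra of functions on a set $X$ is a dual operator algebra.
   Context: An (abstract, unital) operator algebra is a unital algebra with a norm on each matrix level satisfying the Blecher–Ruan–Sinclair (BRS) axioms: $\|LGM\|\le\|L\|\|G\|\|M\|$ for scalar matrices $L,M$; $\|G\oplus H\|=\max\{\|G\|,\|H\|\}$; $\|GH\|\le\|G\|\|H\|$; $\|1\|=1$. A dual operator algebra is an operator algebra that is, as an operator space, the dual of an operator space; equivalently, it is completely isometrically isomorphic, as an algebra, to a weak*-closed subalgebra of some $B(\mathcal K)$. An operator algebra of functions on $X$ is a subalgebra $\mathcal A$ of the algebra of all complex-valued functions on $X$ which separates the points of $X$ and contains the constants, is equipped with norms on all $M_n(\mathcal A)$ satisfying the BRS axioms, and has every evaluation functional $f\mapsto f(x)$, $x\in X$, bounded. For finite $F\subseteq X$ let $I_F=\{f\in\mathcal A:f|_F=0\}$ and give $M_n(\mathcal A/I_F)=M_n(\mathcal A)/M_n(I_F)$ the quotient norm. $\mathcal A$ is local if $\|(f_{ij})\|=\sup_F\|(f_{ij}+I_F)\|$ for all $n$ and $(f_{ij})\in M_n(\mathcal A)$, the supremum being over finite $F\subseteq X$. $\mathcal A$ is BPW complete if it contains every function $f:X\to\mathbb C$ that is the pointwise limit on $X$ of a norm-bounded net in $\mathcal A$. *)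

theory Defs
  imports
    "HOL-Analysis.L2_Norm"
    "HOL-Library.Function_Algebras"
    "Jordan_Normal_Form.Matrix"
begin

text \<open>
  Spaces live on a carrier inside an ambient type, with an explicit complex scalar
  multiplication \<open>s\<close>. Matrices over a space are matrices of type \<^typ>\<open>'v mat\<close> with entries
  in the carrier, and a family of matrix norms is a function \<open>N\<close>, where \<open>N n\<close> is
  only relevant on \<open>n \<times> n\<close> matrices over the carrier, for \<open>n > 0\<close>.
  The theory Function_Algebras supplies the pointwise operations on functions, and hence
  the matrix product over an algebra of functions.
\<close>

definition mats :: "nat \<Rightarrow> 'v set \<Rightarrow> 'v mat set" where
  "mats n V = {G \<in> carrier_mat n n. elements_mat G \<subseteq> V}"

definition opnorm :: "complex mat \<Rightarrow> real" where
  "opnorm L = (SUP v \<in> {v \<in> carrier_vec (dim_col L). L2_set (\<lambda>i. cmod (v $ i)) {..<dim_col L} \<le> 1}.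
     L2_set (\<lambda>i. cmod ((L *\<^sub>v v) $ i)) {..<dim_row L})"

text \<open>The product \<open>L G M\<close> with scalar matrices \<open>L\<close>, \<open>M\<close>.\<close>

definition scalar_mult3 ::
  "(complex \<Rightarrow> 'v \<Rightarrow> 'v) \<Rightarrow> complex mat \<Rightarrow> 'v::ab_group_add mat \<Rightarrow> complex mat \<Rightarrow> 'v mat" where
  "scalar_mult3 s L G M = mat (dim_row L) (dim_col M)
     (\<lambda>(i, j). \<Sum>k<dim_row G. \<Sum>l<dim_col G. s (L $$ (i, k) * M $$ (l, j)) (G $$ (k, l)))"

definition dsum_mat :: "'v::zero mat \<Rightarrow> 'v mat \<Rightarrow> 'v mat" where
  "dsum_mat G H = four_block_mat G (0\<^sub>m (dim_row G) (dim_col H)) (0\<^sub>m (dim_row H) (dim_col G)) H"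

text \<open>Abstract operator spaces (Ruan's axioms); completeness is not part of the definition.\<close>

locale operator_space = vector_space s
  for s :: "complex \<Rightarrow> 'v::ab_group_add \<Rightarrow> 'v" +
  fixes V :: "'v set" and N :: "nat \<Rightarrow> 'v mat \<Rightarrow> real"
  assumes carrier_subspace: "subspace V"
    and norm_nonneg: "\<And>n G. 0 < n \<Longrightarrow> G \<in> mats n V \<Longrightarrow> 0 \<le> N n G"
    and norm_eq_0: "\<And>n G. 0 < n \<Longrightarrow> G \<in> mats n V \<Longrightarrow> N n G = 0 \<longleftrightarrow> G = 0\<^sub>m n n"
    and norm_triangle: "\<And>n G H. 0 < n \<Longrightarrow> G \<in> mats n V \<Longrightarrow> H \<in> mats n V \<Longrightarrow>
          N n (G + H) \<le> N n G + N n H"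
    and norm_scale: "\<And>n c G. 0 < n \<Longrightarrow> G \<in> mats n V \<Longrightarrow> N n (map_mat (s c) G) = cmod c * N n G"
    and norm_scalar_mult3: "\<And>m n L G M. 0 < m \<Longrightarrow> 0 < n \<Longrightarrow> L \<in> carrier_mat m n \<Longrightarrow>
          G \<in> mats n V \<Longrightarrow> M \<in> carrier_mat n m \<Longrightarrow>
          N m (scalar_mult3 s L G M) \<le> opnorm L * N n G * opnorm M"
    and norm_dsum: "\<And>m n G H. 0 < m \<Longrightarrow> 0 < n \<Longrightarrow> G \<in> mats m V \<Longrightarrow> H \<in> mats n V \<Longrightarrow>
          N (m + n) (dsum_mat G H) = max (N m G) (N n H)"

text \<open>Abstract unital operator algebras (Blecher--Ruan--Sinclair axioms).\<close>

locale operator_algebra = operator_space s A N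
  for s :: "complex \<Rightarrow> 'a::ring_1 \<Rightarrow> 'a" and A :: "'a set" and N :: "nat \<Rightarrow> 'a mat \<Rightarrow> real" +
  assumes one_closed: "1 \<in> A"
    and mult_closed: "\<And>a b. a \<in> A \<Longrightarrow> b \<in> A \<Longrightarrow> a * b \<in> A"
    and scale_mult_left: "\<And>c a b. a \<in> A \<Longrightarrow> b \<in> A \<Longrightarrow> s c a * b = s c (a * b)"
    and scale_mult_right: "\<And>c a b. a \<in> A \<Longrightarrow> b \<in> A \<Longrightarrow> a * s c b = s c (a * b)"
    and norm_mult: "\<And>n G H. 0 < n \<Longrightarrow> G \<in> mats n A \<Longrightarrow> H \<in> mats n A \<Longrightarrow>
          N n (G * H) \<le> N n G * N n H"
    and norm_one: "N 1 (1\<^sub>m 1) = 1"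

definition norm1 :: "(nat \<Rightarrow> 'v mat \<Rightarrow> real) \<Rightarrow> 'v \<Rightarrow> real" where
  "norm1 N v = N 1 (mat 1 1 (\<lambda>_. v))"

definition fscale :: "complex \<Rightarrow> ('x \<Rightarrow> complex) \<Rightarrow> 'x \<Rightarrow> complex" where
  "fscale c f = (\<lambda>x. c * f x)"

text \<open>
  The dual of an operator space. Functionals are extended by \<open>0\<close> outside the carrier, so that
  each one has a unique representative. The norm on \<open>M\<^sub>n(V\<^sup>*)\<close> is that of \<open>CB(V, M\<^sub>n)\<close>:
  a matrix \<open>P\<close> of functionals is viewed as the map \<open>v \<mapsto> (P\<^sub>i\<^sub>j v)\<close>, and
  \<open>amplify P w\<close> is its \<open>m\<close>-th amplification at \<open>w \<in> M\<^sub>m(V)\<close>, an \<open>m \<times> m\<close> matrix of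
  \<open>n \<times> n\<close> blocks. The supremum is finite since bounded functionals are completely bounded.
\<close>

definition dual_space ::
  "(complex \<Rightarrow> 'v::ab_group_add \<Rightarrow> 'v) \<Rightarrow> 'v set \<Rightarrow> (nat \<Rightarrow> 'v mat \<Rightarrow> real) \<Rightarrow> ('v \<Rightarrow> complex) set" where
  "dual_space s V N = {p.
     (\<forall>v\<in>V. \<forall>w\<in>V. p (v + w) = p v + p w) \<and>
     (\<forall>c. \<forall>v\<in>V. p (s c v) = c * p v) \<and>
     (\<exists>C. \<forall>v\<in>V. cmod (p v) \<le> C * norm1 N v) \<and>
     (\<forall>v. v \<notin> V \<longrightarrow> p v = 0)}"

definition amplify :: "('v \<Rightarrow> complex) mat \<Rightarrow> 'v mat \<Rightarrow> complex mat" where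
  "amplify P w = (let n = dim_row P; m = dim_row w in
     mat (m * n) (m * n)
       (\<lambda>(p, q). (P $$ (p mod n, q mod n)) (w $$ (p div n, q div n))))"

definition dual_norm ::
  "'v set \<Rightarrow> (nat \<Rightarrow> 'v mat \<Rightarrow> real) \<Rightarrow> nat \<Rightarrow> ('v \<Rightarrow> complex) mat \<Rightarrow> real" where
  "dual_norm V N n P = Sup {opnorm (amplify P w) | m w. 0 < m \<and> w \<in> mats m V \<and> N m w \<le> 1}"

definition complete_isometric_iso ::
  "(complex \<Rightarrow> 'v::ab_group_add \<Rightarrow> 'v) \<Rightarrow> 'v set \<Rightarrow> (nat \<Rightarrow> 'v mat \<Rightarrow> real) \<Rightarrow>
   (complex \<Rightarrow> 'w::ab_group_add \<Rightarrow> 'w) \<Rightarrow> 'w set \<Rightarrow> (nat \<Rightarrow> 'w mat \<Rightarrow> real) \<Rightarrow> ('v \<Rightarrow> 'w) \<Rightarrow> bool" where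
  "complete_isometric_iso s V N t W M T \<longleftrightarrow>
     bij_betw T V W \<and>
     (\<forall>v\<in>V. \<forall>w\<in>V. T (v + w) = T v + T w) \<and>
     (\<forall>c. \<forall>v\<in>V. T (s c v) = t c (T v)) \<and>
     (\<forall>n>0. \<forall>G\<in>mats n V. M n (map_mat T G) = N n G)"

text \<open>
  The predual is sought among the spaces of complex functions on the ambient type of \<open>A\<close>.
  This loses nothing: any predual \<open>V\<close> embeds completely isometrically into its bidual,
  that is, into \<open>A\<^sup>*\<close>.
\<close>

definition dual_operator_algebra ::
  "(complex \<Rightarrow> 'a::ring_1 \<Rightarrow> 'a) \<Rightarrow> 'a set \<Rightarrow> (nat \<Rightarrow> 'a mat \<Rightarrow> real) \<Rightarrow> bool" where
  "dual_operator_algebra s A N \<longleftrightarrow> operator_algebra s A N \<and>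
     (\<exists>(V :: ('a \<Rightarrow> complex) set) NV T. operator_space fscale V NV \<and>
        complete_isometric_iso s A N fscale (dual_space fscale V NV) (dual_norm V NV) T)"

locale function_operator_algebra = operator_algebra fscale A N
  for A :: "('x \<Rightarrow> complex) set" and N :: "nat \<Rightarrow> ('x \<Rightarrow> complex) mat \<Rightarrow> real" +
  assumes constants: "\<And>c. (\<lambda>_. c) \<in> A"
    and separates: "\<And>x y. x \<noteq> y \<Longrightarrow> \<exists>f\<in>A. f x \<noteq> f y"
    and eval_bounded: "\<And>x. \<exists>C. \<forall>f\<in>A. cmod (f x) \<le> C * norm1 N f"

definition vanishing_ideal :: "('x \<Rightarrow> complex) set \<Rightarrow> 'x set \<Rightarrow> ('x \<Rightarrow> complex) set" where
  "vanishing_ideal A F = {f \<in> A. \<forall>x\<in>F. f x = 0}"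

definition quotient_norm ::
  "('x \<Rightarrow> complex) set \<Rightarrow> (nat \<Rightarrow> ('x \<Rightarrow> complex) mat \<Rightarrow> real) \<Rightarrow> 'x set \<Rightarrow>
   nat \<Rightarrow> ('x \<Rightarrow> complex) mat \<Rightarrow> real" where
  "quotient_norm A N F n G = (INF K \<in> mats n (vanishing_ideal A F). N n (G + K))"

definition local_algebra ::
  "('x \<Rightarrow> complex) set \<Rightarrow> (nat \<Rightarrow> ('x \<Rightarrow> complex) mat \<Rightarrow> real) \<Rightarrow> bool" where
  "local_algebra A N \<longleftrightarrow>
     (\<forall>n>0. \<forall>G\<in>mats n A. N n G = (SUP F \<in> {F. finite F}. quotient_norm A N F n G))"

text \<open>
  Nets are expressed by proper filters on the function space. The lemmas below show that
  this is the same as using nets indexed by directed sets of arbitrary type: such nets are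
  covered, and nets indexed by one sufficiently large type already suffice.
\<close>

definition BPW_complete ::
  "('x \<Rightarrow> complex) set \<Rightarrow> (nat \<Rightarrow> ('x \<Rightarrow> complex) mat \<Rightarrow> real) \<Rightarrow> bool" where
  "BPW_complete A N \<longleftrightarrow> (\<forall>f.
     (\<exists>\<Phi> C. \<Phi> \<noteq> bot \<and> (\<forall>\<^sub>F g in \<Phi>. g \<in> A \<and> norm1 N g \<le> C) \<and>
        (\<forall>x. ((\<lambda>g. g x) \<longlongrightarrow> f x) \<Phi>)) \<longrightarrow> f \<in> A)"

definition directed_by :: "'i set \<Rightarrow> ('i \<Rightarrow> 'i \<Rightarrow> bool) \<Rightarrow> bool" where
  "directed_by D r \<longleftrightarrow> D \<noteq> {} \<and> (\<forall>i\<in>D. r i i) \<and>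
     (\<forall>i\<in>D. \<forall>j\<in>D. \<forall>k\<in>D. r i j \<longrightarrow> r j k \<longrightarrow> r i k) \<and>
     (\<forall>i\<in>D. \<forall>j\<in>D. \<exists>k\<in>D. r i k \<and> r j k)"

definition bounded_pointwise_net_limit ::
  "('x \<Rightarrow> complex) set \<Rightarrow> (nat \<Rightarrow> ('x \<Rightarrow> complex) mat \<Rightarrow> real) \<Rightarrow>
   'i set \<Rightarrow> ('i \<Rightarrow> 'i \<Rightarrow> bool) \<Rightarrow> ('i \<Rightarrow> 'x \<Rightarrow> complex) \<Rightarrow> ('x \<Rightarrow> complex) \<Rightarrow> bool" where
  "bounded_pointwise_net_limit A N D r g f \<longleftrightarrow> directed_by D r \<and>
     (\<exists>C. \<forall>i\<in>D. g i \<in> A \<and> norm1 N (g i) \<le> C) \<and>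
     (\<forall>x. \<forall>e>0. \<exists>i\<in>D. \<forall>j\<in>D. r i j \<longrightarrow> dist (g j x) (f x) < e)"

lemma BPW_complete_net:
  assumes "BPW_complete A N" and net: "bounded_pointwise_net_limit A N D r g f"
  shows "f \<in> A"
proof -
  define P where "P i = principal (g ` {j \<in> D. r i j})" for i
  have dir: "directed_by D r" using net by (simp add: bounded_pointwise_net_limit_def)
  then have ne: "D \<noteq> {}" by (simp add: directed_by_def)
  have refl: "r i i" if "i \<in> D" for i using dir that by (simp add: directed_by_def)
  have trans: "r i k" if "i \<in> D" "j \<in> D" "k \<in> D" "r i j" "r j k" for i j k
    using dir that(1-3) that(4,5) unfolding directed_by_def by metis
  have ub: "\<forall>i\<in>D. \<forall>j\<in>D. \<exists>k\<in>D. r i k \<and> r j k"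
    using dir unfolding directed_by_def by (elim conjE)
  have base: "\<exists>k\<in>D. P k \<le> inf (P i) (P j)" if "i \<in> D" "j \<in> D" for i j
  proof -
    obtain k where k: "k \<in> D" "r i k" "r j k"
      using ub \<open>i \<in> D\<close> \<open>j \<in> D\<close> by blast
    have "{l \<in> D. r k l} \<subseteq> {l \<in> D. r i l} \<inter> {l \<in> D. r j l}"
    proof
      fix l assume "l \<in> {l \<in> D. r k l}"
      then show "l \<in> {l \<in> D. r i l} \<inter> {l \<in> D. r j l}"
        using trans[OF that(1) k(1) _ k(2)] trans[OF that(2) k(1) _ k(3)] by simp
    qed
    then show ?thesis using k(1) by (auto simp: P_def intro!: bexI[of _ k])
  qed
  define \<Phi> where "\<Phi> = (INF i\<in>D. P i)"
  have ev: "eventually Q \<Phi> \<longleftrightarrow> (\<exists>i\<in>D. \<forall>j\<in>D. r i j \<longrightarrow> Q (g j))" for Q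
    unfolding \<Phi>_def using eventually_INF_base[OF ne base, of Q]
    by (auto simp: P_def eventually_principal)
  have "\<Phi> \<noteq> bot"
    using refl by (auto simp: trivial_limit_def ev)
  moreover obtain C where "\<forall>i\<in>D. g i \<in> A \<and> norm1 N (g i) \<le> C"
    using net unfolding bounded_pointwise_net_limit_def by blast
  then have "\<forall>\<^sub>F h in \<Phi>. h \<in> A \<and> norm1 N h \<le> C"
    unfolding ev using ne by blast
  moreover have "((\<lambda>h. h x) \<longlongrightarrow> f x) \<Phi>" for x
    using net by (simp add: tendsto_iff ev bounded_pointwise_net_limit_def)
  ultimately show ?thesis using assms(1) unfolding BPW_complete_def by blast
qed

lemma BPW_completeI_net:
  fixes A :: "('x \<Rightarrow> complex) set"
  assumes "\<And>(D :: (('x \<Rightarrow> complex) \<times> ('x \<Rightarrow> complex) set) set) r g f.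
    bounded_pointwise_net_limit A N D r g f \<Longrightarrow> f \<in> A"
  shows "BPW_complete A N"
  unfolding BPW_complete_def
proof (intro allI impI, elim exE conjE)
  fix f \<Phi> C
  assume nb: "\<Phi> \<noteq> bot" and bd: "\<forall>\<^sub>F g in \<Phi>. g \<in> A \<and> norm1 N g \<le> C"
    and lim: "\<forall>x. ((\<lambda>g. g x) \<longlongrightarrow> f x) \<Phi>"
  define B where "B = {g \<in> A. norm1 N g \<le> C}"
  define D where "D = {(g, S). g \<in> S \<and> S \<subseteq> B \<and> (\<forall>\<^sub>F h in \<Phi>. h \<in> S)}"
  define r where "r i j \<longleftrightarrow> snd j \<subseteq> snd i" for i j :: "('x \<Rightarrow> complex) \<times> ('x \<Rightarrow> complex) set"
  have B: "\<forall>\<^sub>F h in \<Phi>. h \<in> B" using bd by (simp add: B_def)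
  have pick: "\<exists>g. (g, S) \<in> D" if S: "S \<subseteq> B" "\<forall>\<^sub>F h in \<Phi>. h \<in> S" for S
    using eventually_happens[OF S(2)] nb S by (auto simp: D_def)
  have "directed_by D r"
    unfolding directed_by_def
  proof (intro conjI ballI)
    show "D \<noteq> {}" using pick[OF _ B] by blast
    fix i j assume "i \<in> D" "j \<in> D"
    then have "snd i \<inter> snd j \<subseteq> B" "\<forall>\<^sub>F h in \<Phi>. h \<in> snd i \<inter> snd j"
      by (auto simp: D_def intro: eventually_conj)
    from pick[OF this] obtain g where "(g, snd i \<inter> snd j) \<in> D" by blast
    then show "\<exists>k\<in>D. r i k \<and> r j k" by (rule bexI[rotated]) (simp add: r_def)
  qed (auto simp: r_def)
  moreover have "\<forall>i\<in>D. fst i \<in> A \<and> norm1 N (fst i) \<le> C" by (auto simp: D_def B_def)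
  moreover have "\<exists>i\<in>D. \<forall>j\<in>D. r i j \<longrightarrow> dist (fst j x) (f x) < e" if "e > 0" for x e
  proof -
    define S where "S = {h \<in> B. dist (h x) (f x) < e}"
    have "\<forall>\<^sub>F h in \<Phi>. dist (h x) (f x) < e" using lim that by (auto simp: tendsto_iff)
    then have "\<forall>\<^sub>F h in \<Phi>. h \<in> S" unfolding S_def using B by (simp add: eventually_conj_iff)
    then obtain g where "(g, S) \<in> D" using pick[of S] by (auto simp: S_def)
    then show ?thesis by (intro bexI[of _ "(g, S)"]) (auto simp: D_def r_def S_def)
  qed
  ultimately have "bounded_pointwise_net_limit A N D r fst f"
    unfolding bounded_pointwise_net_limit_def by blast
  then show "f \<in> A" by (rule assms)
qed

end

theory Submission imports Defs begin

text \<open>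
  The predual is the span \<open>V\<close> of the evaluations at points of \<open>X\<close>, inside \<open>A\<^sup>*\<close>. A bounded functional
  \<open>p\<close> on \<open>V\<close> is recovered from the function \<open>x \<mapsto> p (ev\<^sub>x)\<close>. What has to be shown is that a matrix \<open>P\<close> of such
  functionals with dual norm at most \<open>D\<close> is interpolated on every finite set \<open>F\<close> by matrices over
  \<open>A\<close> of norm arbitrarily close to \<open>D\<close>: BPW completeness then puts the function into \<open>A\<close>, and
  locality gives the norm estimate.

  The interpolation is a finite form of Ruan's theorem. If it fails, separate the cone of all triples
  \<open>(a, b, h)\<close> with \<open>\<alpha> \<alpha>\<^sup>* \<le> a\<close>, \<open>\<beta>\<^sup>* \<beta> \<le> b\<close> and \<open>h = \<alpha> K \<beta>\<close> on \<open>F\<close>, where \<open>\<parallel>K\<parallel> \<le> 1\<close>, from the triple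
  \<open>(t, t, P)\<close>. The separating functional consists of two positive forms and a matrix
  \<open>W\<close> over \<open>V\<close>. Making the forms definite by a small perturbation and factoring them
  turns \<open>W\<close> into an element of the unit ball of \<open>M\<^sub>n(V)\<close> at which \<open>P\<close> is too large.
\<close>

section \<open>Separation from a cone with order unit\<close>

text \<open>Separating P from the unit ball of M_n(A) by a plain functional would only bound the
  pairing of W with M_n(A), whereas a matrix over V is measured by its completely bounded norm,
  which involves every M_k(A). The cone repairs this. The size k of K is free, so a single positive
  functional controls W against all M_k(A) at once, the scalar factors \<alpha> and \<beta> carrying
  the vectors at which an amplification is tested. A free k is also what makes the cone convex: two
  factorizations add up through the direct sum of their K.

  The forms a and b keep account of the lengths of these vectors. The separating functional is at
  most 1 on (1, 1, 0), so in coordinates adapted to the two forms the vectors that recover the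
  pairing of W with P have squared lengths of sum at most 1, up to the perturbation. The cone is not
  known to be closed and no compactness is at hand; therefore the argument runs through lower bounds
  t0 for the norms of interpolants, and the perturbation tends to 0 at the end.\<close>

definition sublinear :: "(real \<Rightarrow> 'e \<Rightarrow> 'e::ab_group_add) \<Rightarrow> ('e \<Rightarrow> real) \<Rightarrow> bool" where
  "sublinear s p \<longleftrightarrow> (\<forall>x y. p (x + y) \<le> p x + p y) \<and> (\<forall>r>0. \<forall>x. p (s r x) \<le> r * p x)"

section \<open>Hahn-Banach by minimal sublinear functionals\<close>

context
  fixes s :: "real \<Rightarrow> 'e \<Rightarrow> 'e::ab_group_add"
  assumes vs: "vector_space s"
begin

interpretation vector_space s by (rule vs)

lemma sublinear_scale:
  assumes "sublinear s p" and "r > 0"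
  shows "p (s r x) = r * p x"
proof (rule antisym)
  show "p (s r x) \<le> r * p x" using assms by (auto simp: sublinear_def)
  have "p (s (1/r) (s r x)) \<le> (1/r) * p (s r x)"
    using assms unfolding sublinear_def by (meson zero_less_divide_1_iff)
  then show "r * p x \<le> p (s r x)" using assms by (simp add: field_simps)
qed

lemma sublinear_zero:
  assumes "sublinear s p"
  shows "p 0 = 0"
  using sublinear_scale[OF assms, of 2 0] by simp

lemma sublinear_minus:
  assumes "sublinear s p"
  shows "- p (- x) \<le> p x"
proof -
  have "p (x + - x) \<le> p x + p (- x)" using assms unfolding sublinear_def by blast
  then show ?thesis using sublinear_zero[OF assms] by simp
qed

text \<open>The largest sublinear q below p with \<open>q (- y) \<le> - p y\<close>: subadditivity
  gives \<open>q x \<le> q (x + s t y) + t * q (- y)\<close>, and the infimum over t of the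
  resulting bounds is taken as the definition.\<close>

definition shear :: "('e \<Rightarrow> real) \<Rightarrow> 'e \<Rightarrow> 'e \<Rightarrow> real" where
  "shear p y x = (INF t\<in>{0..}. p (x + s t y) - t * p y)"

lemma shear_bdd:
  assumes "sublinear s p"
  shows "bdd_below ((\<lambda>t. p (x + s t y) - t * p y) ` {0..})"
proof (rule bdd_belowI2[of _ "- p (- x)"])
  fix t :: real assume "t \<in> {0..}"
  then have "p (s t y) = t * p y"
    using sublinear_scale[OF assms, of t y] sublinear_zero[OF assms] by (cases "t = 0") auto
  moreover have "p ((x + s t y) + - x) \<le> p (x + s t y) + p (- x)"
    using assms unfolding sublinear_def by blast
  ultimately show "- p (- x) \<le> p (x + s t y) - t * p y" by simp
qed

lemma shear_le:
  assumes "sublinear s p" "t \<ge> 0"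
  shows "shear p y x \<le> p (x + s t y) - t * p y"
  unfolding shear_def using assms by (intro cINF_lower shear_bdd) auto

lemma shear_greatest:
  assumes "\<And>t. t \<ge> 0 \<Longrightarrow> c \<le> p (x + s t y) - t * p y"
  shows "c \<le> shear p y x"
  unfolding shear_def using assms by (intro cINF_greatest) auto

lemma sublinear_shear:
  assumes p: "sublinear s p"
  shows "sublinear s (shear p y)"
  unfolding sublinear_def
proof (intro conjI allI impI)
  fix x x'
  have 1: "shear p y (x + x') \<le> (p (x + s t y) - t * p y) + (p (x' + s t' y) - t' * p y)"
    if "t \<ge> 0" "t' \<ge> 0" for t t'
  proof -
    have "shear p y (x + x') \<le> p ((x + x') + s (t + t') y) - (t + t') * p y"
      using that by (intro shear_le p) auto
    also have "(x + x') + s (t + t') y = (x + s t y) + (x' + s t' y)"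
      by (simp add: scale_left_distrib algebra_simps)
    also have "p \<dots> \<le> p (x + s t y) + p (x' + s t' y)"
      using p unfolding sublinear_def by blast
    finally show ?thesis by (simp add: algebra_simps)
  qed
  \<comment> \<open>The two infima are taken one at a time, the other parameter being held
    fixed.\<close>
  have "shear p y (x + x') - (p (x + s t y) - t * p y) \<le> shear p y x'" if "t \<ge> 0" for t
    using 1[OF that] by (intro shear_greatest) (simp add: algebra_simps)
  then have "shear p y (x + x') - shear p y x' \<le> shear p y x"
    by (intro shear_greatest) (simp add: algebra_simps)
  then show "shear p y (x + x') \<le> shear p y x + shear p y x'" by simp
next
  fix r :: real and x assume r: "r > 0"
  have "shear p y (s r x) / r \<le> p (x + s t y) - t * p y" if "t \<ge> 0" for t
  proof -
    have "shear p y (s r x) \<le> p (s r x + s (r * t) y) - (r * t) * p y"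
      using r that by (intro shear_le p) auto
    also have "s r x + s (r * t) y = s r (x + s t y)" by (simp add: scale_right_distrib)
    also have "p \<dots> = r * p (x + s t y)" using sublinear_scale[OF p r] .
    finally show ?thesis using r by (simp add: field_simps)
  qed
  then have "shear p y (s r x) / r \<le> shear p y x" by (rule shear_greatest)
  then show "shear p y (s r x) \<le> r * shear p y x" using r by (simp add: field_simps)
qed

text \<open>A minimal sublinear functional coincides with all its shears, which forces it to be additive.\<close>

lemma minimal_sublinear_linear:
  assumes m: "sublinear s m" and min: "\<And>q. sublinear s q \<Longrightarrow> q \<le> m \<Longrightarrow> q = m"
  shows "m (x + y) = m x + m y" and "m (s r x) = r * m x"
proof -
  have add: "m (x + y) = m x + m y" for x y
  proof (rule antisym)
    show "m (x + y) \<le> m x + m y" using m unfolding sublinear_def by blast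
    have "shear m y x \<le> m x" for x using shear_le[OF m, of 0 y x] by simp
    then have "shear m y = m" by (intro min sublinear_shear m) (simp add: le_fun_def)
    then show "m x + m y \<le> m (x + y)" using shear_le[OF m, of 1 y x] by simp
  qed
  then show "m (x + y) = m x + m y" .
  have neg: "m (- x) = - m x" for x
    using add[of x "- x"] sublinear_zero[OF m] by simp
  show "m (s r x) = r * m x"
  proof (cases "r > 0")
    case True then show ?thesis by (rule sublinear_scale[OF m])
  next
    case False
    show ?thesis
    proof (cases "r = 0")
      case True then show ?thesis using sublinear_zero[OF m] by simp
    next
      case False
      then have "- r > 0" using \<open>\<not> r > 0\<close> by simp
      from sublinear_scale[OF m this, of x] show ?thesis by (simp add: neg)
    qed
  qed
qed

text \<open>Zorn downwards, with the pointwise infimum as lower bound of a chain. The infimum is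
  finite because every q below p satisfies \<open>- p (- x) \<le> q x\<close>. It is subadditive
  because two members of a chain are comparable, so that the smaller one serves both
  arguments.\<close>

lemma minimal_sublinear_exists:
  assumes p: "sublinear s p"
  obtains m where "sublinear s m" "m \<le> p" "\<And>q. sublinear s q \<Longrightarrow> q \<le> m \<Longrightarrow> q = m"
proof -
  define S where "S = {q. sublinear s q \<and> q \<le> p}"
  have "\<exists>m\<in>S. \<forall>a\<in>S. a \<le> m \<longrightarrow> a = m"
  proof (rule predicate_Zorn)
    show "partial_order_on S (relation_of (\<lambda>a b. b \<le> a) S)"
      by (rule partial_order_on_relation_ofI) auto
    fix C assume C: "C \<in> Chains (relation_of (\<lambda>a b. b \<le> a) S)"
    then have CS: "C \<subseteq> S" and tot: "\<And>a b. a \<in> C \<Longrightarrow> b \<in> C \<Longrightarrow> a \<le> b \<or> b \<le> a"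
      by (auto simp: Chains_def relation_of_def)
    show "\<exists>u\<in>S. \<forall>a\<in>C. u \<le> a"
    proof (cases "C = {}")
      case True then show ?thesis using p by (auto simp: S_def)
    next
      case False
      define u where "u x = (INF q\<in>C. q x)" for x
      have bdd: "bdd_below ((\<lambda>q. q x) ` C)" for x
      proof (rule bdd_belowI2[of _ "- p (- x)"])
        fix q assume "q \<in> C"
        then have "sublinear s q" "q (- x) \<le> p (- x)" using CS by (auto simp: S_def le_fun_def)
        then show "- p (- x) \<le> q x" using sublinear_minus[of q x] by linarith
      qed
      have u_le: "u x \<le> q x" if "q \<in> C" for q x
        unfolding u_def by (rule cINF_lower[OF bdd that])
      have u_ge: "c \<le> u x" if "\<And>q. q \<in> C \<Longrightarrow> c \<le> q x" for c x
        unfolding u_def using False that by (rule cINF_greatest)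
      have "sublinear s u"
        unfolding sublinear_def
      proof (intro conjI allI impI)
        fix x y
        have 1: "u (x + y) \<le> q x + q' y" if "q \<in> C" "q' \<in> C" for q q'
        proof -
          obtain r where r: "r \<in> C" "r \<le> q" "r \<le> q'" using tot[of q q'] \<open>q \<in> C\<close> \<open>q' \<in> C\<close> by blast
          have "u (x + y) \<le> r (x + y)" using r by (intro u_le)
          also have "\<dots> \<le> r x + r y" using r CS by (auto simp: S_def sublinear_def)
          also have "\<dots> \<le> q x + q' y" using r by (intro add_mono) (auto simp: le_fun_def)
          finally show ?thesis .
        qed
        have "u (x + y) - q x \<le> u y" if "q \<in> C" for q
          using 1[OF that] by (intro u_ge) (simp add: algebra_simps)
        then have "u (x + y) - u y \<le> u x" by (intro u_ge) (simp add: algebra_simps)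
        then show "u (x + y) \<le> u x + u y" by simp
      next
        fix r :: real and x assume r: "r > 0"
        have "u (s r x) / r \<le> q x" if "q \<in> C" for q
        proof -
          have "sublinear s q" using that CS by (auto simp: S_def)
          then have "q (s r x) = r * q x" using r by (rule sublinear_scale)
          then show ?thesis using u_le[OF that, of "s r x"] r by (simp add: field_simps)
        qed
        then have "u (s r x) / r \<le> u x" by (rule u_ge)
        then show "u (s r x) \<le> r * u x" using r by (simp add: field_simps)
      qed
      moreover have "u \<le> p"
      proof -
        obtain q where "q \<in> C" using False by blast
        then have "u \<le> q" "q \<le> p" using u_le CS by (auto simp: S_def le_fun_def)
        then show ?thesis by (rule order_trans)
      qed
      ultimately have "u \<in> S" by (simp add: S_def)
      then show ?thesis using u_le by (auto simp: le_fun_def)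
    qed
  qed
  then obtain m where m: "m \<in> S" "\<And>a. a \<in> S \<Longrightarrow> a \<le> m \<Longrightarrow> a = m" by blast
  show thesis
  proof (rule that)
    show "sublinear s m" "m \<le> p" using m(1) by (auto simp: S_def)
    then show "q = m" if "sublinear s q" "q \<le> m" for q
      using that m(2)[of q] by (auto simp: S_def)
  qed
qed

text \<open>A minimal functional is taken below \<open>shear p y\<close> rather than below p. The
  parameter t = 1 then gives \<open>m (- y) \<le> - p y\<close>, so the bound p is attained at
  y.\<close>

lemma hahn_banach_sublinear:
  assumes p: "sublinear s p"
  obtains f where "\<And>x y. f (x + y) = f x + f y" "\<And>r x. f (s r x) = r * f x"
    "\<And>x. f x \<le> p x" "f y = p y"
proof -
  obtain m where m: "sublinear s m" "m \<le> shear p y"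
    and min: "\<And>q. sublinear s q \<Longrightarrow> q \<le> m \<Longrightarrow> q = m"
    using minimal_sublinear_exists[OF sublinear_shear[OF p, of y]] by blast
  note lin = minimal_sublinear_linear[OF m(1) min]
  have "m x \<le> p x" for x
    using m(2) shear_le[OF p, of 0 y x] by (auto simp: le_fun_def intro: order_trans)
  moreover have "m (- y) \<le> - p y"
    using m(2) shear_le[OF p, of 1 y "- y"] sublinear_zero[OF p]
    by (auto simp: le_fun_def intro: order_trans)
  moreover have "m (- y) = - m y"
    using lin(2)[of "-1" y] by simp
  ultimately show thesis using lin by (intro that[of m]) (auto simp: antisym)
qed

text \<open>Dominating p is the order-unit gauge, the infimum of all t with t u - x in C. The order
  unit makes the set of such t nonempty, properness bounds it below. A linear f below p is
  nonnegative on C because p is at most 0 on -C. Since only the infimum at y has to be at least t0,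
  C need not be closed.\<close>

lemma cone_separation:
  assumes add: "\<And>x y. x \<in> C \<Longrightarrow> y \<in> C \<Longrightarrow> x + y \<in> C"
    and scale: "\<And>r x. r > 0 \<Longrightarrow> x \<in> C \<Longrightarrow> s r x \<in> C"
    and zero: "0 \<in> C"
    and order_unit: "\<And>x. \<exists>t. s t u + x \<in> C"
    and proper: "\<And>t. s t u \<in> C \<Longrightarrow> t \<ge> 0"
    and bound: "\<And>t. s t u - y \<in> C \<Longrightarrow> t0 \<le> t"
  obtains f where "\<And>x y. f (x + y) = f x + f y" "\<And>r x. f (s r x) = r * f x"
    "\<And>x. x \<in> C \<Longrightarrow> 0 \<le> f x" "f u \<le> 1" "t0 \<le> f y"
proof -
  define p where "p x = Inf {t. s t u - x \<in> C}" for x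
  have bdd: "bdd_below {t. s t u - x \<in> C}" for x
  proof -
    obtain t1 where t1: "s t1 u + x \<in> C" using order_unit by blast
    show ?thesis
    proof (rule bdd_belowI[of _ "- t1"])
      fix t assume "t \<in> {t. s t u - x \<in> C}"
      then have "(s t u - x) + (s t1 u + x) \<in> C" using t1 add by blast
      then have "s (t + t1) u \<in> C" by (simp add: scale_left_distrib algebra_simps)
      from proper[OF this] show "- t1 \<le> t" by simp
    qed
  qed
  have ne: "{t. s t u - x \<in> C} \<noteq> {}" for x
    using order_unit[of "- x"] by simp
  have p_le: "p x \<le> t" if "s t u - x \<in> C" for t x
    unfolding p_def using that bdd by (intro cInf_lower) auto
  have p_ge: "c \<le> p x" if "\<And>t. s t u - x \<in> C \<Longrightarrow> c \<le> t" for c x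
    unfolding p_def using that ne by (intro cInf_greatest) auto
  have "sublinear s p"
    unfolding sublinear_def
  proof (intro conjI allI impI)
    fix x y
    have 1: "p (x + y) \<le> t + t'" if "s t u - x \<in> C" "s t' u - y \<in> C" for t t'
    proof (rule p_le)
      have "(s t u - x) + (s t' u - y) \<in> C" using that by (rule add)
      then show "s (t + t') u - (x + y) \<in> C" by (simp add: scale_left_distrib algebra_simps)
    qed
    have "p (x + y) - t \<le> p y" if "s t u - x \<in> C" for t
      using 1[OF that] by (intro p_ge) (simp add: algebra_simps)
    then have "p (x + y) - p y \<le> p x" by (intro p_ge) (simp add: algebra_simps)
    then show "p (x + y) \<le> p x + p y" by simp
  next
    fix r :: real and x assume r: "r > 0"
    have "p (s r x) / r \<le> t" if "s t u - x \<in> C" for t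
    proof -
      have "s r (s t u - x) \<in> C" using r that by (rule scale)
      then have "p (s r x) \<le> r * t" by (intro p_le) (simp add: scale_right_diff_distrib)
      then show ?thesis using r by (simp add: field_simps)
    qed
    then have "p (s r x) / r \<le> p x" by (rule p_ge)
    then show "p (s r x) \<le> r * p x" using r by (simp add: field_simps)
  qed
  then obtain f where f: "\<And>x y. f (x + y) = f x + f y" "\<And>r x. f (s r x) = r * f x"
    "\<And>x. f x \<le> p x" "f y = p y" by (rule hahn_banach_sublinear[where y = y]) blast
  show thesis
  proof (rule that[of f])
    show "f (x + y) = f x + f y" "f (s r x) = r * f x" for x y r by (fact f)+
    show "0 \<le> f x" if "x \<in> C" for x
    proof -
      have "p (- x) \<le> 0" using that by (intro p_le) simp
      then have "f (- x) \<le> 0" using f(3)[of "- x"] by linarith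
      moreover have "f (- x) = - f x" using f(2)[of "- 1" x] by simp
      ultimately show ?thesis by simp
    qed
    have "p u \<le> 1" using zero by (intro p_le) simp
    then show "f u \<le> 1" using f(3)[of u] by linarith
    show "t0 \<le> f y" unfolding f(4) by (rule p_ge) (rule bound)
  qed
qed

end

section \<open>Bounds for bilinear forms\<close>

abbreviation l2 :: "('i \<Rightarrow> complex) \<Rightarrow> 'i set \<Rightarrow> real" where
  "l2 x I \<equiv> L2_set (\<lambda>i. cmod (x i)) I"

lemma l2_power2: "(l2 x I)\<^sup>2 = (\<Sum>i\<in>I. (cmod (x i))\<^sup>2)"
  by (simp add: L2_set_def sum_nonneg)

lemma l2_scale: "l2 (\<lambda>i. c * x i) I = cmod c * l2 x I"
  by (simp add: norm_mult L2_set_right_distrib)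

lemma l2_Cauchy_Schwarz: "cmod (\<Sum>i\<in>I. x i * y i) \<le> l2 x I * l2 y I"
proof -
  have "cmod (\<Sum>i\<in>I. x i * y i) \<le> (\<Sum>i\<in>I. \<bar>cmod (x i)\<bar> * \<bar>cmod (y i)\<bar>)"
    by (rule sum_norm_le) (simp add: norm_mult)
  then show ?thesis using L2_set_mult_ineq by (rule order_trans)
qed

text \<open>The operator norm is at most c, with arbitrary index sets so that block matrices can be
  indexed by pairs. No conjugate is put on x: as x ranges over all vectors this does not change the
  bound.\<close>

definition bil_bound :: "'i set \<Rightarrow> 'j set \<Rightarrow> ('i \<Rightarrow> 'j \<Rightarrow> complex) \<Rightarrow> real \<Rightarrow> bool" where
  "bil_bound I J M c \<longleftrightarrow>
    (\<forall>x y. cmod (\<Sum>i\<in>I. \<Sum>j\<in>J. x i * M i j * y j) \<le> c * l2 x I * l2 y J)"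

lemma bil_boundI:
  assumes "\<And>x y. cmod (\<Sum>i\<in>I. \<Sum>j\<in>J. x i * M i j * y j) \<le> c * l2 x I * l2 y J"
  shows "bil_bound I J M c"
  using assms by (simp add: bil_bound_def)

lemma bil_boundD:
  "bil_bound I J M c \<Longrightarrow> cmod (\<Sum>i\<in>I. \<Sum>j\<in>J. x i * M i j * y j) \<le> c * l2 x I * l2 y J"
  by (simp add: bil_bound_def)

lemma bil_bound_mono: "bil_bound I J M c \<Longrightarrow> c \<le> d \<Longrightarrow> bil_bound I J M d"
  unfolding bil_bound_def by (meson L2_set_nonneg mult_right_mono order_trans)

lemma bil_bound_cong:
  assumes "\<And>i j. i \<in> I \<Longrightarrow> j \<in> J \<Longrightarrow> M i j = M' i j"
  shows "bil_bound I J M c \<longleftrightarrow> bil_bound I J M' c"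
  unfolding bil_bound_def using assms by simp

lemma bil_bound_transpose:
  assumes "bil_bound I J M c"
  shows "bil_bound J I (\<lambda>j i. M i j) c"
proof (rule bil_boundI)
  fix x y
  have "(\<Sum>j\<in>J. \<Sum>i\<in>I. x j * M i j * y i) = (\<Sum>i\<in>I. \<Sum>j\<in>J. y i * M i j * x j)"
    by (subst sum.swap) (simp add: mult_ac)
  then show "cmod (\<Sum>j\<in>J. \<Sum>i\<in>I. x j * M i j * y i) \<le> c * l2 x J * l2 y I"
    using bil_boundD[OF assms, of y x] by (simp add: mult_ac)
qed

lemma bil_bound_add:
  assumes "bil_bound I J M c" "bil_bound I J M' d"
  shows "bil_bound I J (\<lambda>i j. M i j + M' i j) (c + d)"
proof (rule bil_boundI)
  fix x y
  have "(\<Sum>i\<in>I. \<Sum>j\<in>J. x i * (M i j + M' i j) * y j) =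
    (\<Sum>i\<in>I. \<Sum>j\<in>J. x i * M i j * y j) + (\<Sum>i\<in>I. \<Sum>j\<in>J. x i * M' i j * y j)"
    by (simp add: algebra_simps sum.distrib)
  also have "cmod \<dots> \<le> c * l2 x I * l2 y J + d * l2 x I * l2 y J"
    using norm_triangle_ineq bil_boundD[OF assms(1)] bil_boundD[OF assms(2)]
    by (meson add_mono order_trans)
  finally show "cmod (\<Sum>i\<in>I. \<Sum>j\<in>J. x i * (M i j + M' i j) * y j) \<le> (c + d) * l2 x I * l2 y J"
    by (simp add: algebra_simps)
qed

lemma bil_bound_scale:
  assumes "bil_bound I J M c"
  shows "bil_bound I J (\<lambda>i j. k * M i j) (cmod k * c)"
proof (rule bil_boundI)
  fix x y
  have "(\<Sum>i\<in>I. \<Sum>j\<in>J. x i * (k * M i j) * y j) = k * (\<Sum>i\<in>I. \<Sum>j\<in>J. x i * M i j * y j)"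
    by (simp add: sum_distrib_left mult_ac)
  then show "cmod (\<Sum>i\<in>I. \<Sum>j\<in>J. x i * (k * M i j) * y j) \<le> cmod k * c * l2 x I * l2 y J"
    using mult_left_mono[OF bil_boundD[OF assms, of x y] norm_ge_zero[of k]]
    by (simp add: norm_mult mult_ac)
qed

lemma bil_bound_exists:
  assumes "finite I" "finite J"
  shows "bil_bound I J M (\<Sum>i\<in>I. \<Sum>j\<in>J. cmod (M i j))"
proof (rule bil_boundI)
  fix x y
  have "cmod (\<Sum>i\<in>I. \<Sum>j\<in>J. x i * M i j * y j) \<le> (\<Sum>i\<in>I. \<Sum>j\<in>J. cmod (M i j) * (l2 x I * l2 y J))"
  proof (intro sum_norm_le)
    fix i j assume "i \<in> I" "j \<in> J"
    then have "cmod (x i) * cmod (y j) \<le> l2 x I * l2 y J"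
      using assms member_le_L2_set[of I i "\<lambda>i. cmod (x i)"] member_le_L2_set[of J j "\<lambda>i. cmod (y i)"]
      by (intro mult_mono) auto
    then have "cmod (M i j) * (cmod (x i) * cmod (y j)) \<le> cmod (M i j) * (l2 x I * l2 y J)"
      by (rule mult_left_mono) simp
    then show "cmod (x i * M i j * y j) \<le> cmod (M i j) * (l2 x I * l2 y J)"
      by (simp add: norm_mult mult_ac)
  qed
  then show "cmod (\<Sum>i\<in>I. \<Sum>j\<in>J. x i * M i j * y j)
      \<le> (\<Sum>i\<in>I. \<Sum>j\<in>J. cmod (M i j)) * l2 x I * l2 y J"
    by (simp add: sum_distrib_right mult.assoc)
qed

text \<open>Testing the form at the conjugate of the image vector produces the square of its
  length.\<close>

lemma bil_bound_vec:
  assumes c: "0 \<le> c" and "bil_bound I J M c"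
  shows "l2 (\<lambda>i. \<Sum>j\<in>J. M i j * y j) I \<le> c * l2 y J"
proof -
  define z where "z i = (\<Sum>j\<in>J. M i j * y j)" for i
  have "(\<Sum>i\<in>I. \<Sum>j\<in>J. cnj (z i) * M i j * y j) = (\<Sum>i\<in>I. cnj (z i) * z i)"
    unfolding z_def by (simp add: sum_distrib_left mult.assoc)
  also have "\<dots> = of_real ((l2 z I)\<^sup>2)"
    by (simp add: l2_power2 complex_norm_square mult.commute del: of_real_power)
  finally have "(l2 z I)\<^sup>2 \<le> c * l2 (\<lambda>i. cnj (z i)) I * l2 y J"
    using bil_boundD[OF assms(2), of "\<lambda>i. cnj (z i)" y]
    by (metis norm_of_real abs_of_nonneg zero_le_power2)
  then have *: "l2 z I * l2 z I \<le> l2 z I * (c * l2 y J)"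
    by (simp add: power2_eq_square mult_ac)
  have "l2 z I \<le> c * l2 y J"
  proof (cases "l2 z I = 0")
    case True then show ?thesis using c by simp
  next
    case False
    then have "l2 z I > 0" by (simp add: order_less_le)
    then show ?thesis using * by simp
  qed
  then show ?thesis by (simp add: z_def)
qed

lemma bil_bound_vecI:
  assumes "\<And>y. l2 (\<lambda>i. \<Sum>j\<in>J. M i j * y j) I \<le> c * l2 y J"
  shows "bil_bound I J M c"
proof (rule bil_boundI)
  fix x y
  have "(\<Sum>i\<in>I. \<Sum>j\<in>J. x i * M i j * y j) = (\<Sum>i\<in>I. x i * (\<Sum>j\<in>J. M i j * y j))"
    by (simp add: sum_distrib_left mult_ac)
  also have "cmod \<dots> \<le> l2 x I * l2 (\<lambda>i. \<Sum>j\<in>J. M i j * y j) I" by (rule l2_Cauchy_Schwarz)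
  also have "\<dots> \<le> l2 x I * (c * l2 y J)" by (intro mult_left_mono assms) simp
  finally show "cmod (\<Sum>i\<in>I. \<Sum>j\<in>J. x i * M i j * y j) \<le> c * l2 x I * l2 y J"
    by (simp add: mult_ac)
qed

text \<open>The converse of the inequality between geometric and arithmetic mean: after scaling x
  and y to length one, the right side is 2 c. This additive form is the one that suits direct sums
  and the output of the separation.\<close>

lemma bil_bound_squares:
  assumes fin: "finite I" "finite J" and c: "0 \<le> c"
    and *: "\<And>x y. 2 * Re (\<Sum>i\<in>I. \<Sum>j\<in>J. x i * M i j * y j) \<le> c * ((l2 x I)\<^sup>2 + (l2 y J)\<^sup>2)"
  shows "bil_bound I J M c"
proof (rule bil_boundI)
  fix x y
  define z where "z = (\<Sum>i\<in>I. \<Sum>j\<in>J. x i * M i j * y j)"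
  have "cmod z \<le> c * l2 x I * l2 y J"
  proof (cases "l2 x I = 0 \<or> l2 y J = 0")
    case True
    then have "(\<forall>i\<in>I. x i = 0) \<or> (\<forall>j\<in>J. y j = 0)"
      using fin by (simp add: L2_set_eq_0_iff)
    then have "z = 0" by (auto simp: z_def)
    then show ?thesis using c by simp
  next
    case False
    then have pos: "l2 x I > 0" "l2 y J > 0" by (auto simp: order_less_le)
    \<comment> \<open>Besides normalizing x, the factor u removes the phase of z, so that the real
      part of the form becomes its modulus.\<close>
    define u where "u = cnj (sgn z) / of_real (l2 x I)"
    define v where "v = (1 / of_real (l2 y J) :: complex)"
    have "(\<Sum>i\<in>I. \<Sum>j\<in>J. (u * x i) * M i j * (v * y j)) = u * v * z"
      by (simp add: z_def sum_distrib_left mult_ac)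
    also have "\<dots> = of_real (cmod z / (l2 x I * l2 y J))"
    proof -
      have "cnj (sgn z) * z = of_real (cmod z)"
        using complex_norm_square[of z]
      by (cases "z = 0") (simp_all add: sgn_eq power2_eq_square field_simps)
      then show ?thesis by (simp add: u_def v_def)
    qed
    finally have eq: "(\<Sum>i\<in>I. \<Sum>j\<in>J. (u * x i) * M i j * (v * y j)) = of_real (cmod z / (l2 x I * l2 y J))" .
    have n1: "l2 (\<lambda>i. u * x i) I \<le> 1" "l2 (\<lambda>j. v * y j) J \<le> 1"
      using pos unfolding l2_scale by (auto simp: u_def v_def norm_divide norm_sgn)
    have "2 * (cmod z / (l2 x I * l2 y J)) \<le> c * ((l2 (\<lambda>i. u * x i) I)\<^sup>2 + (l2 (\<lambda>j. v * y j) J)\<^sup>2)"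
      using *[of "\<lambda>i. u * x i" "\<lambda>j. v * y j"] unfolding eq by simp
    also have "\<dots> \<le> c * (1 + 1)"
      using n1 c by (intro mult_left_mono add_mono) (auto simp: power_le_one)
    finally show ?thesis using pos by (simp add: field_simps)
  qed
  then show "cmod (\<Sum>i\<in>I. \<Sum>j\<in>J. x i * M i j * y j) \<le> c * l2 x I * l2 y J" by (simp add: z_def)
qed

lemma bil_bound_reindex:
  fixes f :: "'a \<Rightarrow> 'b" and g :: "'c \<Rightarrow> 'd"
  assumes f: "bij_betw f I' I" and g: "bij_betw g J' J"
  shows "bil_bound I' J' (\<lambda>i j. M (f i) (g j)) c \<longleftrightarrow> bil_bound I J M c"
proof -
  have l2f: "l2 (\<lambda>i. x (f i)) I' = l2 x I" for x
    unfolding L2_set_def by (simp add: sum.reindex_bij_betw[OF f, of "\<lambda>i. (cmod (x i))\<^sup>2"])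
  have l2g: "l2 (\<lambda>i. x (g i)) J' = l2 x J" for x
    unfolding L2_set_def by (simp add: sum.reindex_bij_betw[OF g, of "\<lambda>i. (cmod (x i))\<^sup>2"])
  have s: "(\<Sum>i\<in>I'. \<Sum>j\<in>J'. x (f i) * M (f i) (g j) * y (g j)) = (\<Sum>i\<in>I. \<Sum>j\<in>J. x i * M i j * y j)" for x y
  proof -
    have "(\<Sum>j\<in>J'. x i * M i (g j) * y (g j)) = (\<Sum>j\<in>J. x i * M i j * y j)" for i
      by (rule sum.reindex_bij_betw[OF g])
    then show ?thesis
      using sum.reindex_bij_betw[OF f, of "\<lambda>i. \<Sum>j\<in>J. x i * M i j * y j"] by simp
  qed
  show ?thesis
  proof
    assume b: "bil_bound I' J' (\<lambda>i j. M (f i) (g j)) c"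
    show "bil_bound I J M c"
      by (rule bil_boundI) (use bil_boundD[OF b, of "\<lambda>i. _ (f i)" "\<lambda>j. _ (g j)"] in \<open>simp add: s l2f l2g\<close>)
  next
    assume b: "bil_bound I J M c"
    show "bil_bound I' J' (\<lambda>i j. M (f i) (g j)) c"
    proof (rule bil_boundI)
      fix x :: "'a \<Rightarrow> complex" and y :: "'c \<Rightarrow> complex"
      define x' where "x' i = x (inv_into I' f i)" for i
      define y' where "y' j = y (inv_into J' g j)" for j
      have x': "x' (f i) = x i" if "i \<in> I'" for i
        using that f by (simp add: x'_def bij_betw_inv_into_left)
      have y': "y' (g j) = y j" if "j \<in> J'" for j
        using that g by (simp add: y'_def bij_betw_inv_into_left)
      have "l2 x' I = l2 x I'" using l2f[of x'] x' by (simp cong: L2_set_cong)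
      moreover have "l2 y' J = l2 y J'" using l2g[of y'] y' by (simp cong: L2_set_cong)
      moreover have "(\<Sum>i\<in>I. \<Sum>j\<in>J. x' i * M i j * y' j) = (\<Sum>i\<in>I'. \<Sum>j\<in>J'. x i * M (f i) (g j) * y j)"
        using s[of x' y'] x' y' by simp
      ultimately show "cmod (\<Sum>i\<in>I'. \<Sum>j\<in>J'. x i * M (f i) (g j) * y j) \<le> c * l2 x I' * l2 y J'"
        using bil_boundD[OF b, of x' y'] by simp
    qed
  qed
qed

section \<open>The operator norm of a scalar matrix as a bilinear bound\<close>

lemma mult_mat_vec_sum:
  assumes "v \<in> carrier_vec (dim_col L)" "i < dim_row L"
  shows "(L *\<^sub>v v) $ i = (\<Sum>j<dim_col L. L $$ (i, j) * v $ j)"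
  using assms by (auto simp: scalar_prod_def lessThan_atLeast0 intro!: sum.cong)

lemma opnorm_vec_bound:
  assumes "v \<in> carrier_vec (dim_col L)"
    and "bil_bound {..<dim_row L} {..<dim_col L} (\<lambda>i j. L $$ (i, j)) c" "c \<ge> 0"
  shows "l2 (\<lambda>i. (L *\<^sub>v v) $ i) {..<dim_row L} \<le> c * l2 (\<lambda>i. v $ i) {..<dim_col L}"
proof -
  have "l2 (\<lambda>i. (L *\<^sub>v v) $ i) {..<dim_row L} =
    l2 (\<lambda>i. \<Sum>j<dim_col L. L $$ (i, j) * v $ j) {..<dim_row L}"
    using mult_mat_vec_sum[OF assms(1)] by (intro L2_set_cong) (simp_all del: index_mult_mat_vec)
  then show ?thesis using bil_bound_vec[OF assms(3,2), of "\<lambda>j. v $ j"] by simp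
qed

lemma opnorm_le_iff:
  assumes c: "c \<ge> 0"
  shows "opnorm L \<le> c \<longleftrightarrow> bil_bound {..<dim_row L} {..<dim_col L} (\<lambda>i j. L $$ (i, j)) c"
proof
  define U where "U = {v \<in> carrier_vec (dim_col L). l2 (\<lambda>i. v $ i) {..<dim_col L} \<le> 1}"
  have op: "opnorm L = (SUP v\<in>U. l2 (\<lambda>i. (L *\<^sub>v v) $ i) {..<dim_row L})"
    by (simp add: opnorm_def U_def)
  let ?B = "bil_bound {..<dim_row L} {..<dim_col L} (\<lambda>i j. L $$ (i, j))"
  have bound: "l2 (\<lambda>i. (L *\<^sub>v v) $ i) {..<dim_row L} \<le> d" if "v \<in> U" "d \<ge> 0" "?B d" for d v
    using opnorm_vec_bound[of v L d] that mult_left_mono[of "l2 (\<lambda>i. v $ i) {..<dim_col L}" 1 d]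
    by (auto simp: U_def)
  {
    assume B: "?B c"
    have "0\<^sub>v (dim_col L) \<in> U" by (simp add: U_def L2_set_0')
    then show "opnorm L \<le> c"
      unfolding op using bound[OF _ c B] by (intro cSUP_least) auto
  next
    assume le: "opnorm L \<le> c"
    \<comment> \<open>The sum of the moduli of the entries is a crude bound that makes the set under
      the supremum bounded; only then does the supremum dominate its members.\<close>
    define d where "d = (\<Sum>i<dim_row L. \<Sum>j<dim_col L. cmod (L $$ (i, j)))"
    have "?B d" unfolding d_def by (rule bil_bound_exists) auto
    then have bdd: "bdd_above ((\<lambda>v. l2 (\<lambda>i. (L *\<^sub>v v) $ i) {..<dim_row L}) ` U)"
      using bound[of _ d] by (intro bdd_aboveI2[of _ _ d]) (auto simp: d_def sum_nonneg)
    have U_le: "l2 (\<lambda>i. (L *\<^sub>v v) $ i) {..<dim_row L} \<le> c" if "v \<in> U" for v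
      using cSUP_upper[OF that bdd] le by (simp add: op)
    show "?B c"
    proof (rule bil_bound_vecI)
      fix y
      show "l2 (\<lambda>i. \<Sum>j<dim_col L. L $$ (i, j) * y j) {..<dim_row L} \<le> c * l2 y {..<dim_col L}"
      proof (cases "l2 y {..<dim_col L} = 0")
        case True
        then have "\<forall>j<dim_col L. y j = 0" by (simp add: L2_set_eq_0_iff)
        then show ?thesis by (simp add: L2_set_0')
      next
        case False
        then have pos: "l2 y {..<dim_col L} > 0" by (simp add: order_less_le)
        define k where "k = (1 / of_real (l2 y {..<dim_col L}) :: complex)"
        define v where "v = vec (dim_col L) (\<lambda>j. k * y j)"
        have "l2 (\<lambda>i. v $ i) {..<dim_col L} = l2 (\<lambda>j. k * y j) {..<dim_col L}"
          by (intro L2_set_cong) (auto simp: v_def)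
        also have "\<dots> = 1" using pos unfolding l2_scale by (simp add: k_def norm_divide)
        finally have "v \<in> U" by (simp add: U_def v_def)
        then have "l2 (\<lambda>i. (L *\<^sub>v v) $ i) {..<dim_row L} \<le> c" by (rule U_le)
        also have "l2 (\<lambda>i. (L *\<^sub>v v) $ i) {..<dim_row L} =
            l2 (\<lambda>i. k * (\<Sum>j<dim_col L. L $$ (i, j) * y j)) {..<dim_row L}"
          by (intro L2_set_cong)
            (simp_all add: v_def mult_mat_vec_sum sum_distrib_left mult_ac del: index_mult_mat_vec)
        finally show ?thesis
          using pos unfolding l2_scale by (simp add: k_def norm_divide field_simps)
      qed
    qed
  }
qed

lemma opnorm_nonneg: "0 \<le> opnorm L"
proof -
  define d where "d = (\<Sum>i<dim_row L. \<Sum>j<dim_col L. cmod (L $$ (i, j)))"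
  have B: "bil_bound {..<dim_row L} {..<dim_col L} (\<lambda>i j. L $$ (i, j)) d"
    unfolding d_def by (rule bil_bound_exists) auto
  have d: "d \<ge> 0" by (simp add: d_def sum_nonneg)
  have *: "l2 (\<lambda>i. (L *\<^sub>v v) $ i) {..<dim_row L} \<le> d"
    if "v \<in> carrier_vec (dim_col L)" "l2 (\<lambda>i. v $ i) {..<dim_col L} \<le> 1" for v
    using opnorm_vec_bound[OF that(1) B d] mult_left_mono[OF that(2) d] by simp
  have z: "0\<^sub>v (dim_col L) \<in> {v \<in> carrier_vec (dim_col L). l2 (\<lambda>i. v $ i) {..<dim_col L} \<le> 1}"
    by (simp add: L2_set_0')
  have "0 \<le> l2 (\<lambda>i. (L *\<^sub>v 0\<^sub>v (dim_col L)) $ i) {..<dim_row L}" by simp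
  also have "\<dots> \<le> opnorm L"
    unfolding opnorm_def using * by (intro cSUP_upper[OF z] bdd_aboveI2[of _ _ d]) auto
  finally show ?thesis .
qed

lemma opnorm_bil_bound:
  "bil_bound {..<dim_row L} {..<dim_col L} (\<lambda>i j. L $$ (i, j)) (opnorm L)"
  using opnorm_le_iff[OF opnorm_nonneg, of L L] by simp

section \<open>Amplifications and block forms\<close>

lemma bij_betw_mod_div:
  assumes "0 < (n::nat)"
  shows "bij_betw (\<lambda>p. (p mod n, p div n)) {..<m * n} ({..<n} \<times> {..<m})"
proof (rule bij_betw_byWitness[where f' = "\<lambda>(l, a). a * n + l"])
  show "(\<lambda>p. (p mod n, p div n)) ` {..<m * n} \<subseteq> {..<n} \<times> {..<m}"
    using assms by (auto simp: less_mult_imp_div_less)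
  show "(\<lambda>(l, a). a * n + l) ` ({..<n} \<times> {..<m}) \<subseteq> {..<m * n}"
  proof clarsimp
    fix a l assume "a < m" "l < n"
    then have "a * n + l < Suc a * n" by simp
    also have "\<dots> \<le> m * n" using \<open>a < m\<close> by (intro mult_le_mono1) simp
    finally show "a * n + l < m * n" .
  qed
qed (use assms in auto)

text \<open>
  Index pairs list the functional index first; in \<open>amplify\<close> these are \<open>p mod n\<close> and \<open>p div n\<close>.
\<close>

definition amp_bound :: "nat \<Rightarrow> nat \<Rightarrow> ('v \<Rightarrow> complex) mat \<Rightarrow> 'v mat \<Rightarrow> real \<Rightarrow> bool" where
  "amp_bound n m P w = bil_bound ({..<n} \<times> {..<m}) ({..<n} \<times> {..<m})
      (\<lambda>p q. (P $$ (fst p, fst q)) (w $$ (snd p, snd q)))"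

lemma opnorm_amplify_le_iff:
  assumes "P \<in> carrier_mat n n" "w \<in> carrier_mat m m" "0 < n" "0 \<le> c"
  shows "opnorm (amplify P w) \<le> c \<longleftrightarrow> amp_bound n m P w c"
proof -
  have dims: "dim_row (amplify P w) = m * n" "dim_col (amplify P w) = m * n"
    using assms by (auto simp: amplify_def Let_def)
  have "opnorm (amplify P w) \<le> c \<longleftrightarrow> bil_bound {..<m * n} {..<m * n} (\<lambda>i j. amplify P w $$ (i, j)) c"
    using opnorm_le_iff[OF assms(4), of "amplify P w"] unfolding dims .
  also have "\<dots> \<longleftrightarrow> bil_bound {..<m * n} {..<m * n}
     (\<lambda>i j. (P $$ (fst (i mod n, i div n), fst (j mod n, j div n)))
        (w $$ (snd (i mod n, i div n), snd (j mod n, j div n)))) c"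
    using assms by (intro bil_bound_cong) (auto simp: amplify_def Let_def)
  also have "\<dots> \<longleftrightarrow> amp_bound n m P w c"
    unfolding amp_bound_def
    by (rule bil_bound_reindex[OF bij_betw_mod_div[OF assms(3)] bij_betw_mod_div[OF assms(3)]])
  finally show ?thesis .
qed

text \<open>M tensored with the identity on S acts on each slice separately, and the squares of the
  lengths add up over the slices.\<close>

lemma l2_tensor:
  assumes "bil_bound I J M c" "c \<ge> 0"
  shows "l2 (\<lambda>p. \<Sum>j\<in>J. M (fst p) j * y (j, snd p)) (I \<times> S) \<le> c * l2 y (J \<times> S)"
proof -
  have "(l2 (\<lambda>p. \<Sum>j\<in>J. M (fst p) j * y (j, snd p)) (I \<times> S))\<^sup>2 =
      (\<Sum>s\<in>S. (l2 (\<lambda>i. \<Sum>j\<in>J. M i j * y (j, s)) I)\<^sup>2)"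
    unfolding l2_power2 by (subst sum.swap) (simp add: sum.cartesian_product case_prod_beta)
  also have "\<dots> \<le> (\<Sum>s\<in>S. (c * l2 (\<lambda>j. y (j, s)) J)\<^sup>2)"
    using bil_bound_vec[OF assms(2,1)] by (intro sum_mono power_mono) auto
  also have "\<dots> = c\<^sup>2 * (l2 y (J \<times> S))\<^sup>2"
    unfolding power_mult_distrib l2_power2
    by (subst sum_distrib_left[symmetric], subst sum.swap)
      (simp add: sum.cartesian_product case_prod_beta)
  finally show ?thesis
    using assms(2) by (simp add: power_mult_distrib[symmetric] power2_le_iff_abs_le)
qed


lemma bil_bound_entry:
  assumes "bil_bound I J M c" "finite I" "finite J" "i \<in> I" "j \<in> J"
  shows "cmod (M i j) \<le> c"
proof -
  let ?x = "\<lambda>k. if k = i then 1 else 0 :: complex" and ?y = "\<lambda>k. if k = j then 1 else 0 :: complex"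
  have "(\<Sum>k\<in>I. \<Sum>l\<in>J. ?x k * M k l * ?y l) = (\<Sum>k\<in>I. if k = i then \<Sum>l\<in>J. if l = j then M k l else 0 else 0)"
    by (intro sum.cong refl) (auto intro!: sum.cong)
  also have "\<dots> = M i j" using assms(2-5) by simp
  finally have "cmod (M i j) \<le> c * l2 ?x I * l2 ?y J"
    using bil_boundD[OF assms(1), of ?x ?y] by simp
  moreover have "l2 (\<lambda>k. if k = i then 1 else 0 :: complex) I = 1"
    using assms(2,4) by (simp add: L2_set_def if_distrib[where f = cmod] if_distrib[where f = "\<lambda>x. x\<^sup>2"] cong: if_cong)
  moreover have "l2 (\<lambda>k. if k = j then 1 else 0 :: complex) J = 1"
    using assms(3,5) by (simp add: L2_set_def if_distrib[where f = cmod] if_distrib[where f = "\<lambda>x. x\<^sup>2"] cong: if_cong)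
  ultimately show ?thesis by simp
qed

lemma bil_bound_zero: "0 \<le> c \<Longrightarrow> bil_bound I J (\<lambda>i j. 0) c"
  by (simp add: bil_bound_def)

lemma l2_restrict:
  assumes "K' \<subseteq> K" "finite K"
  shows "l2 (\<lambda>i. if i \<in> K' then z i else 0) K = l2 z K'"
proof -
  have "(\<Sum>i\<in>K. (cmod (if i \<in> K' then z i else 0))\<^sup>2) = (\<Sum>i\<in>K'. (cmod (z i))\<^sup>2)"
    using assms by (intro sum.mono_neutral_cong_right) auto
  then show ?thesis by (simp add: L2_set_def)
qed

lemma bil_bound_subset:
  fixes M :: "'i \<Rightarrow> 'j \<Rightarrow> complex"
  assumes b: "bil_bound I J M c" and "I' \<subseteq> I" "J' \<subseteq> J" and fin: "finite I" "finite J"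
  shows "bil_bound I' J' M c"
proof (rule bil_boundI)
  fix x :: "'i \<Rightarrow> complex" and y :: "'j \<Rightarrow> complex"
  let ?x = "\<lambda>i. if i \<in> I' then x i else 0" and ?y = "\<lambda>j. if j \<in> J' then y j else 0"
  have "(\<Sum>i\<in>I. \<Sum>j\<in>J. ?x i * M i j * ?y j) = (\<Sum>i\<in>I'. \<Sum>j\<in>J. x i * M i j * ?y j)"
    using assms by (intro sum.mono_neutral_cong_right) auto
  also have "\<dots> = (\<Sum>i\<in>I'. \<Sum>j\<in>J'. x i * M i j * y j)"
    using assms by (intro sum.cong refl sum.mono_neutral_cong_right) auto
  finally show "cmod (\<Sum>i\<in>I'. \<Sum>j\<in>J'. x i * M i j * y j) \<le> c * l2 x I' * l2 y J'"
    using bil_boundD[OF b, of ?x ?y] l2_restrict[of I' I x] l2_restrict[of J' J y] assms by simp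
qed

text \<open>The reverse direction goes through \<open>bil_bound_squares\<close>: the form and the
  squared lengths are both additive over the two blocks, while the product of lengths is
  not.\<close>

lemma bil_bound_disjoint_sum:
  assumes fin: "finite I" "finite I'" and disj: "I \<inter> I' = {}" and c: "0 \<le> c"
    and off: "\<And>i j. i \<in> I \<Longrightarrow> j \<in> I' \<Longrightarrow> M i j = 0 \<and> M j i = 0"
  shows "bil_bound (I \<union> I') (I \<union> I') M c \<longleftrightarrow> bil_bound I I M c \<and> bil_bound I' I' M c"
proof
  assume "bil_bound (I \<union> I') (I \<union> I') M c"
  then show "bil_bound I I M c \<and> bil_bound I' I' M c"
    using fin by (auto intro: bil_bound_subset)
next
  assume b: "bil_bound I I M c \<and> bil_bound I' I' M c"
  show "bil_bound (I \<union> I') (I \<union> I') M c"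
  proof (rule bil_bound_squares)
    fix x y :: "'a \<Rightarrow> complex"
    have sq: "2 * Re (\<Sum>i\<in>K. \<Sum>j\<in>K. x i * M i j * y j) \<le> c * ((l2 x K)\<^sup>2 + (l2 y K)\<^sup>2)"
      if "bil_bound K K M c" for K
    proof -
      have "Re (\<Sum>i\<in>K. \<Sum>j\<in>K. x i * M i j * y j) \<le> c * (l2 x K * l2 y K)"
        using bil_boundD[OF that, of x y] complex_Re_le_cmod order_trans by (fastforce simp: mult.assoc)
      moreover have "c * (2 * (l2 x K * l2 y K)) \<le> c * ((l2 x K)\<^sup>2 + (l2 y K)\<^sup>2)"
        using c sum_squares_bound[of "l2 x K" "l2 y K"] by (intro mult_left_mono) auto
      ultimately show ?thesis by simp
    qed
    have "(\<Sum>i\<in>I \<union> I'. \<Sum>j\<in>I \<union> I'. x i * M i j * y j) =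
        (\<Sum>i\<in>I. \<Sum>j\<in>I. x i * M i j * y j) + (\<Sum>i\<in>I'. \<Sum>j\<in>I'. x i * M i j * y j)"
      using fin disj off by (simp add: sum.union_disjoint sum.distrib)
    moreover have "(l2 z (I \<union> I'))\<^sup>2 = (l2 z I)\<^sup>2 + (l2 z I')\<^sup>2" for z :: "'a \<Rightarrow> complex"
      unfolding l2_power2 using fin disj by (rule sum.union_disjoint)
    ultimately show "2 * Re (\<Sum>i\<in>I \<union> I'. \<Sum>j\<in>I \<union> I'. x i * M i j * y j) \<le>
        c * ((l2 x (I \<union> I'))\<^sup>2 + (l2 y (I \<union> I'))\<^sup>2)"
      using sq[of I] sq[of I'] b by (simp add: algebra_simps)
  qed (use fin c in auto)
qed

section \<open>Factorization of positive forms\<close>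

lemma gram_form:
  fixes v :: "'i \<Rightarrow> complex"
  shows "(\<Sum>i\<in>I. \<Sum>j\<in>I. v i * cnj (v j) * (\<Sum>l\<in>L. s l i * cnj (s l j))) =
    of_real (\<Sum>l\<in>L. (cmod (\<Sum>i\<in>I. v i * s l i))\<^sup>2)"
proof -
  have "of_real (\<Sum>l\<in>L. (cmod (\<Sum>i\<in>I. v i * s l i))\<^sup>2) =
      (\<Sum>l\<in>L. (\<Sum>i\<in>I. v i * s l i) * (\<Sum>j\<in>I. cnj (v j) * cnj (s l j)))"
    by (simp add: complex_norm_square del: of_real_power)
  also have "\<dots> = (\<Sum>l\<in>L. \<Sum>i\<in>I. \<Sum>j\<in>I. v i * cnj (v j) * (s l i * cnj (s l j)))"
    by (simp add: sum_product mult_ac)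
  also have "\<dots> = (\<Sum>i\<in>I. \<Sum>j\<in>I. \<Sum>l\<in>L. v i * cnj (v j) * (s l i * cnj (s l j)))"
    by (subst sum.swap, rule sum.cong[OF refl], rule sum.swap)
  finally show ?thesis by (simp add: sum_distrib_left)
qed

lemma sum_exchange:
  fixes a :: "'i \<Rightarrow> 'c::comm_semiring_0"
  shows "(\<Sum>l\<in>L. a l * (\<Sum>k\<in>K. b k l * c k)) = (\<Sum>k\<in>K. c k * (\<Sum>l\<in>L. b k l * a l))"
  unfolding sum_distrib_left by (subst sum.swap) (simp add: mult_ac)

lemma sum_mult_delta:
  fixes c :: "'i \<Rightarrow> 'c::semiring_1"
  assumes "finite I" "i \<in> I" and d: "\<And>k. k \<in> I \<Longrightarrow> d k = (if k = i then 1 else 0)"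
  shows "(\<Sum>k\<in>I. c k * d k) = c i"
proof -
  have "(\<Sum>k\<in>I. c k * d k) = (\<Sum>k\<in>I. if k = i then c k else 0)"
    by (rule sum.cong) (simp_all add: d)
  then show ?thesis using assms by simp
qed

text \<open>Cholesky factorization with an upper triangular s, built by bordering. The inverse r is
  carried through the induction: it solves for the new column, and it is needed later to change
  coordinates.\<close>

lemma cholesky:
  fixes P :: "nat \<Rightarrow> nat \<Rightarrow> complex"
  assumes "\<And>i j. i < n \<Longrightarrow> j < n \<Longrightarrow> P j i = cnj (P i j)"
    and "\<And>v. \<exists>i<n. v i \<noteq> 0 \<Longrightarrow> 0 < Re (\<Sum>i<n. \<Sum>j<n. v i * cnj (v j) * P i j)"
  shows "\<exists>s r. (\<forall>i<n. \<forall>j<n. P i j = (\<Sum>l<n. s l i * cnj (s l j))) \<and>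
    (\<forall>i<n. \<forall>j<n. (\<Sum>l<n. s i l * r l j) = (if i = j then 1 else 0)) \<and>
    (\<forall>i<n. \<forall>j<n. (\<Sum>l<n. r i l * s l j) = (if i = j then 1 else 0))"
    (is "?E n")
  using assms
proof (induction n)
  case 0
  show ?case by simp
next
  case (Suc n)
  have pos: "0 < Re (\<Sum>i<n. \<Sum>j<n. v i * cnj (v j) * P i j)" if "\<exists>i<n. v i \<noteq> 0" for v
  proof -
    let ?v = "\<lambda>i. if i < n then v i else 0"
    have "\<exists>i<Suc n. ?v i \<noteq> 0" using that by (metis less_SucI)
    from Suc.prems(2)[OF this] show ?thesis by simp
  qed
  have herm: "P j i = cnj (P i j)" if "i < n" "j < n" for i j
    using that by (intro Suc.prems(1)) auto
  have "?E n" by (rule Suc.IH) (fact herm, fact pos)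
  then obtain s r
    where "\<forall>i<n. \<forall>j<n. P i j = (\<Sum>l<n. s l i * cnj (s l j))"
      and "\<forall>i<n. \<forall>j<n. (\<Sum>l<n. s i l * r l j) = (if i = j then 1 else 0)"
      and "\<forall>i<n. \<forall>j<n. (\<Sum>l<n. r i l * s l j) = (if i = j then 1 else 0)"
    by (elim exE conjE)
  then have P: "\<And>i j. i < n \<Longrightarrow> j < n \<Longrightarrow> P i j = (\<Sum>l<n. s l i * cnj (s l j))"
    and sr: "\<And>i j. i < n \<Longrightarrow> j < n \<Longrightarrow> (\<Sum>l<n. s i l * r l j) = (if i = j then 1 else 0)"
    and rs: "\<And>i j. i < n \<Longrightarrow> j < n \<Longrightarrow> (\<Sum>l<n. r i l * s l j) = (if i = j then 1 else 0)"
    by simp_all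
  \<comment> \<open>The new column of s, forced by the entries \<open>P i n\<close>.\<close>
  define y where "y l = cnj (\<Sum>k<n. r k l * P k n)" for l
  have y: "(\<Sum>l<n. s l i * cnj (y l)) = P i n" if "i < n" for i
  proof -
    have "(\<Sum>l<n. s l i * cnj (y l)) = (\<Sum>k<n. P k n * (\<Sum>l<n. r k l * s l i))"
      unfolding y_def complex_cnj_cnj by (rule sum_exchange)
    also have "\<dots> = P i n"
      by (rule sum_mult_delta) (use that rs[OF _ that] in simp_all)
    finally show ?thesis .
  qed
  \<comment> \<open>The vector (z, 1) is annihilated by the first n rows of the enlarged factor. The
    form takes there the value of the Schur complement \<open>P n n - Y\<close>, which is therefore
    positive.\<close>
  define z where "z i = - (\<Sum>l<n. r i l * y l)" for i
  have z: "(\<Sum>i<n. z i * s l i) = - y l" if "l < n" for l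
  proof -
    have "(\<Sum>i<n. z i * s l i) = (\<Sum>i<n. s l i * z i)" by (simp add: mult.commute)
    also have "\<dots> = - (\<Sum>k<n. y k * (\<Sum>i<n. r i k * s l i))"
      unfolding z_def mult_minus_right sum_negf
      by (rule arg_cong[where f = uminus, OF sum_exchange])
    also have "(\<Sum>k<n. y k * (\<Sum>i<n. r i k * s l i)) = y l"
      by (rule sum_mult_delta) (use that sr[OF that] in \<open>auto simp: mult.commute\<close>)
    finally show ?thesis .
  qed
  define Y where "Y = (\<Sum>l<n. (cmod (y l))\<^sup>2)"
  have Y: "(\<Sum>l<n. y l * cnj (y l)) = of_real Y"
    by (simp add: Y_def complex_norm_square del: of_real_power)
  have diag: "P n n = of_real (Re (P n n))"
    using Suc.prems(1)[of n n] by (simp add: complex_eq_iff)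
  let ?v = "\<lambda>i. if i < n then z i else 1"
  have "(\<Sum>i<Suc n. \<Sum>j<Suc n. ?v i * cnj (?v j) * P i j) =
      (\<Sum>i<n. \<Sum>j<n. z i * cnj (z j) * P i j) + (\<Sum>i<n. z i * P i n) + (\<Sum>j<n. cnj (z j) * P n j) + P n n"
    by (simp add: sum.distrib)
  also have "(\<Sum>i<n. \<Sum>j<n. z i * cnj (z j) * P i j) = of_real Y"
  proof -
    have "(\<Sum>i<n. \<Sum>j<n. z i * cnj (z j) * P i j) =
        (\<Sum>i<n. \<Sum>j<n. z i * cnj (z j) * (\<Sum>l<n. s l i * cnj (s l j)))" by (simp add: P)
    also have "\<dots> = of_real (\<Sum>l<n. (cmod (\<Sum>i<n. z i * s l i))\<^sup>2)" by (rule gram_form)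
    also have "\<dots> = of_real Y" using z by (simp add: Y_def)
    finally show ?thesis .
  qed
  also have cross: "(\<Sum>i<n. z i * P i n) = - of_real Y"
  proof -
    have "(\<Sum>i<n. z i * P i n) = (\<Sum>i<n. z i * (\<Sum>l<n. s l i * cnj (y l)))" by (simp add: y)
    also have "\<dots> = (\<Sum>l<n. cnj (y l) * (\<Sum>i<n. z i * s l i))"
      by (subst sum_exchange) (simp only: mult.commute)
    also have "\<dots> = - (\<Sum>l<n. y l * cnj (y l))" by (simp add: z sum_negf mult.commute)
    finally show ?thesis by (simp add: Y)
  qed
  also have "(\<Sum>j<n. cnj (z j) * P n j) = cnj (\<Sum>i<n. z i * P i n)"
    using Suc.prems(1)[of _ n] by simp
  also have "\<dots> = - of_real Y" by (simp add: cross)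
  finally have total: "(\<Sum>i<Suc n. \<Sum>j<Suc n. ?v i * cnj (?v j) * P i j) =
      of_real Y + - of_real Y + - of_real Y + P n n" .
  have "Re (\<Sum>i<Suc n. \<Sum>j<Suc n. ?v i * cnj (?v j) * P i j) = Re (P n n) - Y"
    unfolding total by simp
  moreover have "0 < Re (\<Sum>i<Suc n. \<Sum>j<Suc n. ?v i * cnj (?v j) * P i j)"
    by (rule Suc.prems(2)) (auto intro!: exI[of _ n])
  ultimately have gap: "0 < Re (P n n) - Y" by linarith
  \<comment> \<open>The new corner entry, a square root of the Schur complement.\<close>
  define \<rho> where "\<rho> = (of_real (sqrt (Re (P n n) - Y)) :: complex)"
  have \<rho>0: "\<rho> \<noteq> 0" using gap by (simp add: \<rho>_def)
  have "\<rho> * cnj \<rho> = of_real (Re (P n n) - Y)"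
    using gap unfolding \<rho>_def complex_cnj_complex_of_real of_real_mult[symmetric] by simp
  then have \<rho>2: "\<rho> * cnj \<rho> = P n n - of_real Y"
    using diag by (metis of_real_diff)
  define s' where "s' l i = (if l < n then if i < n then s l i else y l else if i < n then 0 else \<rho>)" for l i
  define r' where "r' l i = (if l < n then if i < n then r l i else z l / \<rho> else if i < n then 0 else 1 / \<rho>)" for l i
  have "P i j = (\<Sum>l<Suc n. s' l i * cnj (s' l j))" if ij: "i < Suc n" "j < Suc n" for i j
  proof -
    consider "i < n" "j < n" | "i < n" "j = n" | "i = n" "j < n" | "i = n" "j = n"
      using ij by linarith
    then show ?thesis
    proof cases
      case 3
      have "P n j = cnj (P j n)" using 3 by (intro Suc.prems(1)) auto
      also have "\<dots> = (\<Sum>l<n. y l * cnj (s l j))" using y[of j] 3 by (simp flip: y add: mult.commute)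
      finally show ?thesis using 3 by (simp add: s'_def)
    qed (simp_all add: s'_def P y Y \<rho>2)
  qed
  moreover have "(\<Sum>l<Suc n. s' i l * r' l j) = (if i = j then 1 else 0)" if "i < Suc n" "j < Suc n" for i j
  proof -
    have "(\<Sum>l<n. s i l * (z l / \<rho>)) = - y i / \<rho>" if "i < n"
      using z[OF that] by (simp add: mult.commute flip: sum_divide_distrib)
    then show ?thesis using that \<rho>0 by (auto simp: s'_def r'_def sr less_Suc_eq)
  qed
  moreover have "(\<Sum>l<Suc n. r' i l * s' l j) = (if i = j then 1 else 0)" if "i < Suc n" "j < Suc n" for i j
    using that \<rho>0 by (auto simp: s'_def r'_def rs z_def less_Suc_eq)
  ultimately show ?case by blast
qed

section \<open>Subspaces of the dual of an operator space\<close>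

lemma mats_iff: "G \<in> mats n V \<longleftrightarrow> G \<in> carrier_mat n n \<and> (\<forall>i<n. \<forall>j<n. G $$ (i, j) \<in> V)"
  unfolding mats_def by (auto intro!: elements_matI[of G n n] dest!: elements_matD)

lemma matsI:
  assumes "G \<in> carrier_mat n n" "\<And>i j. i < n \<Longrightarrow> j < n \<Longrightarrow> G $$ (i, j) \<in> V"
  shows "G \<in> mats n V"
  using assms by (simp add: mats_iff)

lemma matsD:
  assumes "G \<in> mats n V"
  shows "G \<in> carrier_mat n n" "\<And>i j. i < n \<Longrightarrow> j < n \<Longrightarrow> G $$ (i, j) \<in> V"
  using assms by (auto simp: mats_iff)

lemma matsD_dim [simp]:
  assumes "G \<in> mats n V"
  shows "dim_row G = n" "dim_col G = n"
  using matsD(1)[OF assms] by auto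

lemma sum_fun_apply: "(\<Sum>i\<in>I. f i) x = (\<Sum>i\<in>I. f i x)" for f :: "'i \<Rightarrow> 'x \<Rightarrow> complex"
  by (induction I rule: infinite_finite_induct) auto

lemma index_scalar_mult3:
  assumes "G \<in> carrier_mat n n" "i < dim_row L" "j < dim_col M"
  shows "scalar_mult3 s L G M $$ (i, j) = (\<Sum>k<n. \<Sum>l<n. s (L $$ (i, k) * M $$ (l, j)) (G $$ (k, l)))"
  using assms by (simp add: scalar_mult3_def)

lemma dim_scalar_mult3 [simp]:
  "dim_row (scalar_mult3 s L G M) = dim_row L" "dim_col (scalar_mult3 s L G M) = dim_col M"
  by (simp_all add: scalar_mult3_def)

lemma index_dsum_mat:
  assumes "G \<in> carrier_mat m m" "H \<in> carrier_mat n n" "i < m + n" "j < m + n"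
  shows "dsum_mat G H $$ (i, j) = (if i < m then if j < m then G $$ (i, j) else 0
    else if j < m then 0 else H $$ (i - m, j - m))"
  using assms by (auto simp: dsum_mat_def)

lemma vector_space_fscale: "vector_space (fscale :: complex \<Rightarrow> ('y \<Rightarrow> complex) \<Rightarrow> 'y \<Rightarrow> complex)"
  by unfold_locales (auto simp: fscale_def fun_eq_iff algebra_simps)

lemma fscale_apply [simp]: "fscale c f x = c * f x"
  by (simp add: fscale_def)

lemma sum_pairs: "(\<Sum>p\<in>I \<times> J. g p) = (\<Sum>i\<in>I. \<Sum>j\<in>J. g (i, j))"
  by (simp add: sum.cartesian_product case_prod_beta)

lemma l2_slice:
  assumes "finite I" "finite J" "i \<in> I"
  shows "l2 (\<lambda>a. z (i, a)) J \<le> l2 z (I \<times> J)"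
proof -
  have "(\<Sum>a\<in>J. (cmod (z (i, a)))\<^sup>2) = (\<Sum>p\<in>Pair i ` J. (cmod (z p))\<^sup>2)"
    by (simp add: sum.reindex inj_on_def)
  also have "\<dots> \<le> (\<Sum>p\<in>I \<times> J. (cmod (z p))\<^sup>2)"
    using assms by (intro sum_mono2) auto
  finally show ?thesis by (simp add: L2_set_def)
qed

text \<open>Multiplication by L tensored with the identity composes the two bounds. It acts on the
  row index only; columns are reached by transposing.\<close>

lemma bil_bound_tensor:
  assumes L: "bil_bound I' I L d" "0 \<le> d" and M: "bil_bound (I \<times> S) J M c" "0 \<le> c"
  shows "bil_bound (I' \<times> S) J (\<lambda>p q. \<Sum>i\<in>I. L (fst p) i * M (i, snd p) q) (d * c)"
proof (rule bil_bound_vecI)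
  fix y
  define z where "z p = (\<Sum>q\<in>J. M p q * y q)" for p
  have "(\<Sum>q\<in>J. (\<Sum>i\<in>I. L (fst p) i * M (i, snd p) q) * y q) = (\<Sum>i\<in>I. L (fst p) i * z (i, snd p))" for p
    unfolding z_def sum_distrib_left sum_distrib_right by (subst sum.swap) (simp add: mult.assoc)
  moreover have "l2 (\<lambda>p. \<Sum>i\<in>I. L (fst p) i * z (i, snd p)) (I' \<times> S) \<le> d * l2 z (I \<times> S)"
    using L by (rule l2_tensor)
  moreover have "d * l2 z (I \<times> S) \<le> d * (c * l2 y J)"
    unfolding z_def using L(2) bil_bound_vec[OF M(2,1)] by (intro mult_left_mono) auto
  ultimately show "l2 (\<lambda>p. \<Sum>q\<in>J. (\<Sum>i\<in>I. L (fst p) i * M (i, snd p) q) * y q) (I' \<times> S) \<le> d * c * l2 y J"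
    by (simp add: mult.assoc)
qed

lemma opnorm_row_le:
  "opnorm (mat 1 m (\<lambda>(i, k). x k)) \<le> l2 x {..<m}"
proof -
  have "bil_bound {..<1::nat} {..<m} (\<lambda>i k. x k) (l2 x {..<m})"
  proof (rule bil_bound_vecI)
    fix y
    show "l2 (\<lambda>i. \<Sum>j<m. x j * y j) {..<1 :: nat} \<le> l2 x {..<m} * l2 y {..<m}"
      using l2_Cauchy_Schwarz[of x y "{..<m}"] by (simp add: lessThan_Suc)
  qed
  then have "bil_bound {..<1} {..<m} (\<lambda>i k. mat 1 m (\<lambda>(i, k). x k) $$ (i, k)) (l2 x {..<m})"
    by (subst bil_bound_cong[where M' = "\<lambda>i k. x k"]) auto
  then show ?thesis by (subst opnorm_le_iff) auto
qed

lemma opnorm_col_le: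
  "opnorm (mat m 1 (\<lambda>(k, i). x k)) \<le> l2 x {..<m}"
proof -
  have "bil_bound {..<m} {..<1::nat} (\<lambda>k i. x k) (l2 x {..<m})"
  proof (rule bil_bound_vecI)
    fix y :: "nat \<Rightarrow> complex"
    have "l2 (\<lambda>k. \<Sum>i<1. x k * y i) {..<m} = l2 (\<lambda>k. y 0 * x k) {..<m}"
      by (simp add: lessThan_Suc mult.commute)
    also have "\<dots> = l2 x {..<m} * l2 y {..<1}"
      unfolding l2_scale by (simp add: lessThan_Suc mult.commute)
    finally show "l2 (\<lambda>k. \<Sum>i<1. x k * y i) {..<m} \<le> l2 x {..<m} * l2 y {..<1}" by simp
  qed
  then have "bil_bound {..<m} {..<1} (\<lambda>k i. mat m 1 (\<lambda>(k, i). x k) $$ (k, i)) (l2 x {..<m})"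
    by (subst bil_bound_cong[where M' = "\<lambda>k i. x k"]) auto
  then show ?thesis by (subst opnorm_le_iff) auto
qed

lemma dual_spaceD:
  assumes "p \<in> dual_space s V N"
  shows "\<And>v w. v \<in> V \<Longrightarrow> w \<in> V \<Longrightarrow> p (v + w) = p v + p w"
    and "\<And>c v. v \<in> V \<Longrightarrow> p (s c v) = c * p v"
    and "\<exists>C. \<forall>v\<in>V. cmod (p v) \<le> C * norm1 N v"
    and "\<And>v. v \<notin> V \<Longrightarrow> p v = 0"
  using assms by (auto simp: dual_space_def)

section \<open>Completely bounded norms on the dual\<close>

context operator_space
begin

lemma zero_mats: "0\<^sub>m n n \<in> mats n V"
  using subspace_0[OF carrier_subspace] by (intro matsI) auto

lemma scale_mats: "G \<in> mats n V \<Longrightarrow> map_mat (s c) G \<in> mats n V"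
  using subspace_scale[OF carrier_subspace] by (auto simp: mats_iff)

lemma add_mats: "G \<in> mats n V \<Longrightarrow> H \<in> mats n V \<Longrightarrow> G + H \<in> mats n V"
  using subspace_add[OF carrier_subspace] by (auto simp: mats_iff)

lemma scalar_mult3_mats:
  assumes "L \<in> carrier_mat m n" "G \<in> mats n V" "M \<in> carrier_mat n m"
  shows "scalar_mult3 s L G M \<in> mats m V"
  using assms matsD[OF assms(2)]
  by (intro matsI carrier_matI)
    (auto simp: index_scalar_mult3[of G n] intro!: subspace_sum[OF carrier_subspace] subspace_scale[OF carrier_subspace])

lemma dsum_mats:
  assumes "G \<in> mats m V" "H \<in> mats n V"
  shows "dsum_mat G H \<in> mats (m + n) V"
  using matsD[OF assms(1)] matsD[OF assms(2)] subspace_0[OF carrier_subspace]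
  by (intro matsI) (auto simp: index_dsum_mat[of G m H n], auto simp: dsum_mat_def)

lemma norm_zero: "0 < n \<Longrightarrow> N n (0\<^sub>m n n) = 0"
  using norm_eq_0[OF _ zero_mats] by simp

lemma singleton_mats: "v \<in> V \<Longrightarrow> mat 1 1 (\<lambda>_. v) \<in> mats 1 V"
  by (intro matsI) auto

lemma norm1_nonneg: "v \<in> V \<Longrightarrow> 0 \<le> norm1 N v"
  unfolding norm1_def by (intro norm_nonneg singleton_mats) auto

lemma dual_space_zero: "p \<in> dual_space s V N \<Longrightarrow> p 0 = 0"
  using dual_spaceD(2)[of p s V N 0 0] subspace_0[OF carrier_subspace] by simp

lemma dual_space_sum:
  assumes "p \<in> dual_space s V N" "\<And>i. i \<in> I \<Longrightarrow> f i \<in> V"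
  shows "p (\<Sum>i\<in>I. f i) = (\<Sum>i\<in>I. p (f i))"
  using assms(2)
proof (induction I rule: infinite_finite_induct)
  case (insert i I)
  have "(\<Sum>i\<in>I. f i) \<in> V" using insert.prems by (intro subspace_sum[OF carrier_subspace]) auto
  then show ?case using insert dual_spaceD(1)[OF assms(1)] by simp
qed (use dual_space_zero[OF assms(1)] in auto)

lemma dual_space_bound_nonneg:
  assumes "p \<in> dual_space s V N"
  obtains C where "0 \<le> C" "\<And>v. v \<in> V \<Longrightarrow> cmod (p v) \<le> C * norm1 N v"
proof -
  obtain C where C: "\<forall>v\<in>V. cmod (p v) \<le> C * norm1 N v" using dual_spaceD(3)[OF assms] by blast
  show thesis
  proof (rule that[of "\<bar>C\<bar>"])
    fix v assume v: "v \<in> V"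
    have "C * norm1 N v \<le> \<bar>C\<bar> * norm1 N v" using norm1_nonneg[OF v] by (intro mult_right_mono) auto
    then show "cmod (p v) \<le> \<bar>C\<bar> * norm1 N v" using C v by (auto intro: order_trans)
  qed simp
qed

text \<open>Compressing w by the row x and the column y gives a single vector v of V, whose norm the
  axiom \<open>norm_scalar_mult3\<close> bounds; p at v is exactly the bilinear form of the matrix
  of the \<open>p (w $$ (a, b))\<close>. Hence the constant of p works at every level.\<close>

lemma functional_completely_bounded:
  assumes p: "p \<in> dual_space s V N" and C: "0 \<le> C" "\<And>v. v \<in> V \<Longrightarrow> cmod (p v) \<le> C * norm1 N v"
    and m: "0 < m" and w: "w \<in> mats m V"
  shows "bil_bound {..<m} {..<m} (\<lambda>a b. p (w $$ (a, b))) (C * N m w)"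
proof (rule bil_boundI)
  fix x y :: "nat \<Rightarrow> complex"
  define L where "L = mat 1 m (\<lambda>(i :: nat, k). x k)"
  define M where "M = mat m 1 (\<lambda>(k, i :: nat). y k)"
  have LM: "L \<in> carrier_mat 1 m" "M \<in> carrier_mat m 1" by (simp_all add: L_def M_def)
  define v where "v = scalar_mult3 s L w M $$ (0, 0)"
  have v: "v = (\<Sum>k<m. \<Sum>l<m. s (x k * y l) (w $$ (k, l)))"
    using matsD[OF w] by (simp add: v_def index_scalar_mult3[of w m] L_def M_def)
  have "p v = (\<Sum>k<m. p (\<Sum>l<m. s (x k * y l) (w $$ (k, l))))"
    unfolding v using matsD[OF w]
    by (intro dual_space_sum[OF p] subspace_sum[OF carrier_subspace] subspace_scale[OF carrier_subspace]) auto
  also have "\<dots> = (\<Sum>k<m. \<Sum>l<m. p (s (x k * y l) (w $$ (k, l))))"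
    using matsD[OF w]
    by (intro sum.cong refl dual_space_sum[OF p] subspace_scale[OF carrier_subspace]) auto
  also have "\<dots> = (\<Sum>k<m. \<Sum>l<m. x k * p (w $$ (k, l)) * y l)"
    using matsD[OF w] dual_spaceD(2)[OF p] by (intro sum.cong refl) (auto simp: mult_ac)
  finally have pv: "p v = (\<Sum>k<m. \<Sum>l<m. x k * p (w $$ (k, l)) * y l)" .
  have sm: "scalar_mult3 s L w M \<in> mats 1 V" using LM(1) w LM(2) by (rule scalar_mult3_mats)
  have "mat 1 1 (\<lambda>_. v) = scalar_mult3 s L w M"
    using LM by (intro eq_matI) (auto simp: v_def)
  then have "norm1 N v = N 1 (scalar_mult3 s L w M)" by (simp add: norm1_def)
  also have "\<dots> \<le> opnorm L * N m w * opnorm M"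
    using m w LM by (intro norm_scalar_mult3) auto
  also have "\<dots> \<le> l2 x {..<m} * N m w * l2 y {..<m}"
    unfolding L_def M_def using norm_nonneg[OF m w]
    by (intro mult_mono opnorm_row_le opnorm_col_le opnorm_nonneg mult_nonneg_nonneg order_refl) auto
  finally have "norm1 N v \<le> l2 x {..<m} * N m w * l2 y {..<m}" .
  moreover have "v \<in> V" using matsD(2)[OF sm] by (simp add: v_def)
  ultimately have "cmod (p v) \<le> C * (l2 x {..<m} * N m w * l2 y {..<m})"
    using C(2)[of v] mult_left_mono[OF _ C(1)] order_trans by blast
  then show "cmod (\<Sum>k<m. \<Sum>l<m. x k * p (w $$ (k, l)) * y l) \<le> C * N m w * l2 x {..<m} * l2 y {..<m}"
    by (simp add: pv mult_ac)
qed

text \<open>The entries are completely bounded, and their constants are added up. The size of c is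
  irrelevant: it only shows that the supremum in \<open>dual_norm\<close> is taken over a bounded
  set.\<close>

lemma dual_norm_bounded:
  assumes P: "P \<in> mats n (dual_space s V N)" and n: "0 < n"
  obtains c where "0 \<le> c" "\<And>m w. 0 < m \<Longrightarrow> w \<in> mats m V \<Longrightarrow> N m w \<le> 1 \<Longrightarrow> amp_bound n m P w c"
proof -
  have "\<exists>C. 0 \<le> C \<and> (\<forall>v\<in>V. cmod (p v) \<le> C * norm1 N v)" if "p \<in> dual_space s V N" for p
    using dual_space_bound_nonneg[OF that] by metis
  then obtain C where C: "\<And>p. p \<in> dual_space s V N \<Longrightarrow> 0 \<le> C p"
    "\<And>p v. p \<in> dual_space s V N \<Longrightarrow> v \<in> V \<Longrightarrow> cmod (p v) \<le> C p * norm1 N v" by metis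
  have CP: "0 \<le> C (P $$ (i, j))" if "i < n" "j < n" for i j
    using C(1) matsD(2)[OF P] that by blast
  define c where "c = (\<Sum>i<n. \<Sum>j<n. C (P $$ (i, j)))"
  show thesis
  proof (rule that[of c])
    show "0 \<le> c" unfolding c_def using CP by (intro sum_nonneg) auto
    fix m w assume m: "0 < m" and w: "w \<in> mats m V" and le: "N m w \<le> 1"
    have "cmod (\<Sum>p\<in>{..<n} \<times> {..<m}. \<Sum>q\<in>{..<n} \<times> {..<m}.
        x p * (P $$ (fst p, fst q)) (w $$ (snd p, snd q)) * y q)
      \<le> c * l2 x ({..<n} \<times> {..<m}) * l2 y ({..<n} \<times> {..<m})"
      (is "cmod ?S \<le> c * ?x * ?y") for x y
    proof -
      have slice: "l2 (\<lambda>a. z (i, a)) {..<m} \<le> l2 z ({..<n} \<times> {..<m})"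
        if "i < n" for z :: "nat \<times> nat \<Rightarrow> complex" and i
        using that by (intro l2_slice) auto
      have "?S = (\<Sum>i<n. \<Sum>a<m. \<Sum>j<n. \<Sum>b<m. x (i, a) * (P $$ (i, j)) (w $$ (a, b)) * y (j, b))"
        by (simp add: sum_pairs)
      also have "\<dots> = (\<Sum>i<n. \<Sum>j<n. \<Sum>a<m. \<Sum>b<m. x (i, a) * (P $$ (i, j)) (w $$ (a, b)) * y (j, b))"
        by (intro sum.cong refl sum.swap)
      also have "cmod \<dots> \<le> (\<Sum>i<n. \<Sum>j<n. C (P $$ (i, j)) * (?x * ?y))"
      proof (intro sum_norm_le)
        fix i j assume ij: "i \<in> {..<n}" "j \<in> {..<n}"
        let ?p = "P $$ (i, j)"
        have p: "?p \<in> dual_space s V N" using ij matsD(2)[OF P] by simp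
        have "cmod (\<Sum>a<m. \<Sum>b<m. x (i, a) * ?p (w $$ (a, b)) * y (j, b))
            \<le> (C ?p * N m w) * l2 (\<lambda>a. x (i, a)) {..<m} * l2 (\<lambda>b. y (j, b)) {..<m}"
          by (rule bil_boundD[OF functional_completely_bounded[OF p C(1)[OF p] C(2)[OF p] m w]])
        also have "\<dots> \<le> (C ?p * 1) * ?x * ?y"
          using ij le C(1)[OF p] norm_nonneg[OF m w]
          by (intro mult_mono slice mult_nonneg_nonneg) auto
        finally show "cmod (\<Sum>a<m. \<Sum>b<m. x (i, a) * ?p (w $$ (a, b)) * y (j, b)) \<le> C ?p * (?x * ?y)"
          by (simp add: mult_ac)
      qed
      also have "\<dots> = c * ?x * ?y" by (simp add: c_def sum_distrib_right mult.assoc)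
      finally show ?thesis .
    qed
    then show "amp_bound n m P w c" unfolding amp_bound_def by (rule bil_boundI)
  qed
qed

lemma dual_norm_le_iff:
  assumes n: "0 < n" and P: "P \<in> mats n (dual_space s V N)" and c: "0 \<le> c"
  shows "dual_norm V N n P \<le> c \<longleftrightarrow>
    (\<forall>m w. 0 < m \<longrightarrow> w \<in> mats m V \<longrightarrow> N m w \<le> 1 \<longrightarrow> amp_bound n m P w c)"
proof -
  define S where "S = {opnorm (amplify P w) | m w. 0 < m \<and> w \<in> mats m V \<and> N m w \<le> 1}"
  have iff: "opnorm (amplify P w) \<le> d \<longleftrightarrow> amp_bound n m P w d" if "w \<in> mats m V" "0 \<le> d" for m w d
    using matsD(1)[OF P] matsD(1)[OF that(1)] n that(2) by (rule opnorm_amplify_le_iff)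
  obtain d where d: "0 \<le> d" "\<And>m w. 0 < m \<Longrightarrow> w \<in> mats m V \<Longrightarrow> N m w \<le> 1 \<Longrightarrow> amp_bound n m P w d"
    using dual_norm_bounded[OF P n] by blast
  \<comment> \<open>The zero matrix lies in every unit ball, so the supremum is over a nonempty
    set.\<close>
  have "opnorm (amplify P (0\<^sub>m 1 1)) \<in> S"
    using zero_mats[of 1] norm_zero[of 1] unfolding S_def by force
  then have ne: "S \<noteq> {}" by blast
  have bdd: "bdd_above S" using d iff by (auto simp: S_def intro!: bdd_aboveI[of _ d])
  have "dual_norm V N n P \<le> c \<longleftrightarrow> (\<forall>r\<in>S. r \<le> c)"
    unfolding dual_norm_def S_def[symmetric] by (rule cSup_le_iff[OF ne bdd])
  also have "\<dots> \<longleftrightarrow> (\<forall>m w. 0 < m \<longrightarrow> w \<in> mats m V \<longrightarrow> N m w \<le> 1 \<longrightarrow> opnorm (amplify P w) \<le> c)"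
    unfolding S_def by blast
  also have "\<dots> \<longleftrightarrow> (\<forall>m w. 0 < m \<longrightarrow> w \<in> mats m V \<longrightarrow> N m w \<le> 1 \<longrightarrow> amp_bound n m P w c)"
    using iff c by blast
  finally show ?thesis .
qed

lemma dual_norm_nonneg:
  assumes n: "0 < n" and P: "P \<in> mats n (dual_space s V N)"
  shows "0 \<le> dual_norm V N n P"
proof -
  define S where "S = {opnorm (amplify P w) | m w. 0 < m \<and> w \<in> mats m V \<and> N m w \<le> 1}"
  obtain d where d: "0 \<le> d" "\<And>m w. 0 < m \<Longrightarrow> w \<in> mats m V \<Longrightarrow> N m w \<le> 1 \<Longrightarrow> amp_bound n m P w d"
    using dual_norm_bounded[OF P n] by blast
  have bdd: "bdd_above S"
    using d opnorm_amplify_le_iff[OF matsD(1)[OF P] matsD(1) n d(1)]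
    by (auto simp: S_def intro!: bdd_aboveI[of _ d])
  have "opnorm (amplify P (0\<^sub>m 1 1)) \<in> S"
    using zero_mats[of 1] norm_zero[of 1] unfolding S_def by force
  then have "opnorm (amplify P (0\<^sub>m 1 1)) \<le> dual_norm V N n P"
    unfolding dual_norm_def S_def[symmetric] using bdd by (rule cSup_upper)
  then show ?thesis using opnorm_nonneg order_trans by blast
qed

lemma dual_norm_amp_bound:
  assumes n: "0 < n" and P: "P \<in> mats n (dual_space s V N)" and m: "0 < m" and w: "w \<in> mats m V"
  shows "amp_bound n m P w (dual_norm V N n P * N m w)"
proof (cases "N m w = 0")
  case True
  then have "w = 0\<^sub>m m m" using norm_eq_0[OF m w] by simp
  moreover have "(P $$ (i, j)) 0 = 0" if "i < n" "j < n" for i j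
    using matsD(2)[OF P that] by (rule dual_space_zero)
  ultimately show ?thesis using True unfolding amp_bound_def
    by (subst bil_bound_cong[where M' = "\<lambda>_ _. 0"]) (auto simp: bil_bound_zero)
next
  case False
  then have pos: "0 < N m w" using norm_nonneg[OF m w] by simp
  define c where "c = (1 / of_real (N m w) :: complex)"
  have "N m (map_mat (s c) w) = 1" using pos by (simp add: norm_scale[OF m w] c_def norm_divide)
  then have "amp_bound n m P (map_mat (s c) w) (dual_norm V N n P)"
    using dual_norm_le_iff[OF n P dual_norm_nonneg[OF n P]] m scale_mats[OF w] by auto
  then have "bil_bound ({..<n} \<times> {..<m}) ({..<n} \<times> {..<m})
      (\<lambda>p q. c * (P $$ (fst p, fst q)) (w $$ (snd p, snd q))) (dual_norm V N n P)"
    unfolding amp_bound_def using matsD[OF w] dual_spaceD(2)[OF matsD(2)[OF P]]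
    by (subst (asm) bil_bound_cong) auto
  from bil_bound_scale[OF this, of "of_real (N m w)"]
  show ?thesis using pos by (simp add: amp_bound_def c_def mult.commute)
qed


text \<open>Each of Ruan's axioms holds for every fixed test matrix w, and
  \<open>dual_norm_le_iff\<close> passes to the supremum. The scalar matrices and direct sums act on
  the functional index alone, the first component of the index pairs.\<close>

theorem dual_subspace_operator_space:
  assumes U: "module.subspace fscale U" and sub: "U \<subseteq> dual_space s V N"
  shows "operator_space fscale U (dual_norm V N)"
proof -
  interpret fs: vector_space "fscale :: complex \<Rightarrow> ('v \<Rightarrow> complex) \<Rightarrow> 'v \<Rightarrow> complex"
    by (rule vector_space_fscale)
  let ?D = "dual_norm V N"
  have dual: "P \<in> mats n (dual_space s V N)" if "P \<in> mats n U" for n P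
    using that sub by (auto simp: mats_iff)
  note nonneg = dual_norm_nonneg[OF _ dual]
  note leI = dual_norm_le_iff[OF _ dual, THEN iffD2, rule_format]
  have bound: "amp_bound n m P w (?D n P)"
    if "0 < n" "P \<in> mats n U" "0 < m" "w \<in> mats m V" "N m w \<le> 1" for n m P w
    using dual_norm_le_iff[OF that(1) dual[OF that(2)] nonneg[OF that(1,2)]] that by blast
  have scale_U: "map_mat (fscale c) P \<in> mats n U" if "P \<in> mats n U" for c n P
    using that fs.subspace_scale[OF U] by (auto simp: mats_iff)
  have scale_le: "?D n (map_mat (fscale c) P) \<le> cmod c * ?D n P" if n: "0 < n" and P: "P \<in> mats n U" for n c P
  proof (rule leI[OF n scale_U[OF P]])
    show "0 \<le> cmod c * ?D n P" using nonneg[OF n P] by simp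
    fix m w assume m: "0 < m" and w: "w \<in> mats m V" and "N m w \<le> 1"
    from bil_bound_scale[OF bound[OF n P this, unfolded amp_bound_def], of c]
    show "amp_bound n m (map_mat (fscale c) P) w (cmod c * ?D n P)"
      unfolding amp_bound_def using P by (subst bil_bound_cong) auto
  qed
  show ?thesis
  proof unfold_locales
    show "fs.subspace U" by (rule U)
    fix n :: nat and P :: "('v \<Rightarrow> complex) mat"
    assume n: "0 < n" and P: "P \<in> mats n U"
    show "0 \<le> ?D n P" by (rule nonneg[OF n P])
    show "?D n P = 0 \<longleftrightarrow> P = 0\<^sub>m n n"
    proof
      assume D0: "?D n P = 0"
      show "P = 0\<^sub>m n n"
      proof (rule eq_matI)
        fix i j assume "i < dim_row (0\<^sub>m n n :: ('v \<Rightarrow> complex) mat)" "j < dim_col (0\<^sub>m n n :: ('v \<Rightarrow> complex) mat)"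
        then have ij: "i < n" "j < n" by auto
        have p: "P $$ (i, j) \<in> dual_space s V N" using matsD(2)[OF dual[OF P]] ij by blast
        have "(P $$ (i, j)) v = 0" for v
        proof (cases "v \<in> V")
          case True
          have "amp_bound n 1 P (mat 1 1 (\<lambda>_. v)) 0"
            using dual_norm_amp_bound[OF n dual[OF P] _ singleton_mats[OF True]] D0 by simp
          from bil_bound_entry[OF this[unfolded amp_bound_def], of "(i, 0)" "(j, 0)"]
          show ?thesis using ij by simp
        next
          case False then show ?thesis using dual_spaceD(4)[OF p] by simp
        qed
        then show "P $$ (i, j) = 0\<^sub>m n n $$ (i, j)" using ij by (simp add: fun_eq_iff)
      qed (use P in auto)
    next
      assume P0: "P = 0\<^sub>m n n"
      have "?D n P \<le> 0"
        by (rule leI[OF n P])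
          (auto simp: P0 amp_bound_def bil_bound_def sum_pairs)
      then show "?D n P = 0" using nonneg[OF n P] by simp
    qed
    show "?D n (map_mat (fscale c) P) = cmod c * ?D n P" for c
    proof (cases "c = 0")
      case True
      then show ?thesis using scale_le[OF n P, of c] nonneg[OF n scale_U[OF P], of c] by simp
    next
      case False
      have "map_mat (fscale (1 / c)) (map_mat (fscale c) P) = P"
        using False by (intro eq_matI) (auto simp: fun_eq_iff)
      then have "?D n P \<le> ?D n (map_mat (fscale c) P) / cmod c"
        using scale_le[OF n scale_U[OF P, of c], of "1 / c"] by (simp add: norm_divide)
      then have "cmod c * ?D n P \<le> ?D n (map_mat (fscale c) P)"
        using False by (simp add: field_simps)
      then show ?thesis using scale_le[OF n P, of c] by simp
    qed
    show "?D n (P + Q) \<le> ?D n P + ?D n Q" if Q: "Q \<in> mats n U" for Q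
    proof (rule leI[OF n])
      show "P + Q \<in> mats n U" using P Q fs.subspace_add[OF U] by (auto simp: mats_iff)
      show "0 \<le> ?D n P + ?D n Q" using nonneg[OF n P] nonneg[OF n Q] by simp
      fix m w assume w: "0 < m" "w \<in> mats m V" "N m w \<le> 1"
      from bil_bound_add[OF bound[OF n P w, unfolded amp_bound_def] bound[OF n Q w, unfolded amp_bound_def]]
      show "amp_bound n m (P + Q) w (?D n P + ?D n Q)"
        unfolding amp_bound_def using P Q by (subst bil_bound_cong) auto
    qed
    show "?D m (scalar_mult3 fscale L P M) \<le> opnorm L * ?D n P * opnorm M"
      if m: "0 < m" and L: "L \<in> carrier_mat m n" and M: "M \<in> carrier_mat n m" for m L M
    proof (rule leI[OF m])
      show "scalar_mult3 fscale L P M \<in> mats m U"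
        using L M matsD[OF P]
        by (intro matsI carrier_matI)
          (auto simp: index_scalar_mult3[of P n] intro!: fs.subspace_sum[OF U] fs.subspace_scale[OF U])
      show "0 \<le> opnorm L * ?D n P * opnorm M" using nonneg[OF n P] opnorm_nonneg by simp
      fix k w assume w: "0 < k" "w \<in> mats k V" "N k w \<le> 1"
      let ?K = "\<lambda>p q. (P $$ (fst p, fst q)) (w $$ (snd p, snd q))"
      have 1: "bil_bound ({..<m} \<times> {..<k}) ({..<n} \<times> {..<k})
          (\<lambda>p q. \<Sum>i<n. L $$ (fst p, i) * ?K (i, snd p) q) (opnorm L * ?D n P)"
        using opnorm_bil_bound[of L] L nonneg[OF n P] bound[OF n P w]
        by (intro bil_bound_tensor) (auto simp: amp_bound_def opnorm_nonneg)
      \<comment> \<open>Right multiplication by M is left multiplication by its transpose on the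
        transposed form.\<close>
      have 2: "bil_bound ({..<m} \<times> {..<k}) ({..<m} \<times> {..<k})
          (\<lambda>q p. \<Sum>j<n. M $$ (j, fst q) * (\<Sum>i<n. L $$ (fst p, i) * ?K (i, snd p) (j, snd q)))
          (opnorm M * (opnorm L * ?D n P))"
        using bil_bound_transpose[OF opnorm_bil_bound[of M]] M nonneg[OF n P] bil_bound_transpose[OF 1]
        by (intro bil_bound_tensor[where M = "\<lambda>q p. \<Sum>i<n. L $$ (fst p, i) * ?K (i, snd p) q"])
          (auto simp: opnorm_nonneg)
      have "(scalar_mult3 fscale L P M $$ (i, j)) v =
          (\<Sum>l<n. M $$ (l, j) * (\<Sum>k<n. L $$ (i, k) * (P $$ (k, l)) v))" if "i < m" "j < m" for i j v
        using that L M matsD[OF P]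
        by (subst index_scalar_mult3[of P n])
          (auto simp: sum_fun_apply sum_distrib_left mult_ac intro: sum.swap)
      with bil_bound_transpose[OF 2]
      show "amp_bound m k (scalar_mult3 fscale L P M) w (opnorm L * ?D n P * opnorm M)"
        unfolding amp_bound_def by (subst bil_bound_cong) (auto simp: mult_ac)
    qed
  next
    fix m n :: nat and P Q :: "('v \<Rightarrow> complex) mat"
    assume m: "0 < m" and n: "0 < n" and P: "P \<in> mats m U" and Q: "Q \<in> mats n U"
    have PQ: "dsum_mat P Q \<in> mats (m + n) U"
      using matsD[OF P] matsD[OF Q] fs.subspace_0[OF U]
      by (intro matsI) (auto simp: index_dsum_mat[of P m Q n], auto simp: dsum_mat_def)
    have iff: "amp_bound (m + n) k (dsum_mat P Q) w c \<longleftrightarrow> amp_bound m k P w c \<and> amp_bound n k Q w c"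
      if c: "0 \<le> c" for k w c
    proof -
      let ?K = "\<lambda>p q. (dsum_mat P Q $$ (fst p, fst q)) (w $$ (snd p, snd q))"
      let ?I = "{..<m} \<times> {..<k}" and ?J = "{m..<m + n} \<times> {..<k}"
      have idx: "dsum_mat P Q $$ (i, j) = (if i < m then if j < m then P $$ (i, j) else 0
          else if j < m then 0 else Q $$ (i - m, j - m))" if "i < m + n" "j < m + n" for i j
        using matsD(1)[OF P] matsD(1)[OF Q] that by (rule index_dsum_mat)
      have "{..<m + n} \<times> {..<k} = ?I \<union> ?J" by auto
      then have "amp_bound (m + n) k (dsum_mat P Q) w c \<longleftrightarrow> bil_bound (?I \<union> ?J) (?I \<union> ?J) ?K c"
        by (simp add: amp_bound_def)
      also have "\<dots> \<longleftrightarrow> bil_bound ?I ?I ?K c \<and> bil_bound ?J ?J ?K c"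
        using c by (intro bil_bound_disjoint_sum) (auto simp: idx)
      also have "bil_bound ?I ?I ?K c \<longleftrightarrow> amp_bound m k P w c"
        unfolding amp_bound_def by (intro bil_bound_cong) (auto simp: idx)
      also have "bil_bound ?J ?J ?K c \<longleftrightarrow> amp_bound n k Q w c"
      proof -
        let ?f = "\<lambda>p :: nat \<times> nat. (m + fst p, snd p)"
        have bij: "bij_betw ?f ({..<n} \<times> {..<k}) ?J"
          by (rule bij_betw_byWitness[where f' = "\<lambda>p. (fst p - m, snd p)"]) auto
        have "amp_bound n k Q w c \<longleftrightarrow>
            bil_bound ({..<n} \<times> {..<k}) ({..<n} \<times> {..<k}) (\<lambda>p q. ?K (?f p) (?f q)) c"
          unfolding amp_bound_def by (intro bil_bound_cong) (auto simp: idx)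
        also have "\<dots> \<longleftrightarrow> bil_bound ?J ?J ?K c" by (rule bil_bound_reindex[OF bij bij])
        finally show ?thesis by simp
      qed
      finally show ?thesis .
    qed
    have le_iff: "?D (m + n) (dsum_mat P Q) \<le> c \<longleftrightarrow> ?D m P \<le> c \<and> ?D n Q \<le> c" if "0 \<le> c" for c
      using dual_norm_le_iff[OF _ dual[OF PQ] that] dual_norm_le_iff[OF m dual[OF P] that]
        dual_norm_le_iff[OF n dual[OF Q] that] iff[OF that] m by blast
    show "?D (m + n) (dsum_mat P Q) = max (?D m P) (?D n Q)"
    proof (rule antisym)
      show "?D (m + n) (dsum_mat P Q) \<le> max (?D m P) (?D n Q)"
        using nonneg[OF m P] by (subst le_iff) auto
      have "0 \<le> ?D (m + n) (dsum_mat P Q)" using m by (intro nonneg PQ) simp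
      from le_iff[OF this] show "max (?D m P) (?D n Q) \<le> ?D (m + n) (dsum_mat P Q)" by simp
    qed
  qed
qed

end

section \<open>Coefficients of real functionals and factorization of their forms\<close>

definition rscale :: "real \<Rightarrow> ('i \<Rightarrow> complex) \<Rightarrow> 'i \<Rightarrow> complex" where
  "rscale r e = (\<lambda>i. of_real r * e i)"

lemma rscale_apply [simp]: "rscale r e i = of_real r * e i"
  by (simp add: rscale_def)

lemma vector_space_rscale: "vector_space (rscale :: real \<Rightarrow> ('i \<Rightarrow> complex) \<Rightarrow> 'i \<Rightarrow> complex)"
  by unfold_locales (auto simp: fun_eq_iff algebra_simps)

text \<open>The coefficient at i is found from the values of f at 1 and at the imaginary unit in
  that coordinate, as for any real functional on a complex space. The index type may be infinite,
  since coordinates outside I do not affect f.\<close>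

lemma real_functional_coefficients:
  fixes f :: "('i \<Rightarrow> complex) \<Rightarrow> real"
  assumes add: "\<And>x y. f (x + y) = f x + f y" and scale: "\<And>r x. f (rscale r x) = r * f x"
    and I: "finite I" and vanish: "\<And>e. \<forall>i\<in>I. e i = 0 \<Longrightarrow> f e = 0"
  obtains c where "\<And>e. f e = Re (\<Sum>i\<in>I. c i * e i)"
proof -
  define \<delta> where "\<delta> i z = (\<lambda>k. if k = i then z else 0 :: complex)" for i :: 'i and z
  define c where "c i = Complex (f (\<delta> i 1)) (- f (\<delta> i \<i>))" for i
  have single: "f (\<delta> i z) = Re (c i * z)" for i z
  proof -
    have "\<delta> i z = rscale (Re z) (\<delta> i 1) + rscale (Im z) (\<delta> i \<i>)"
      by (auto simp: \<delta>_def fun_eq_iff complex_eq_iff)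
    then have "f (\<delta> i z) = Re z * f (\<delta> i 1) + Im z * f (\<delta> i \<i>)" by (simp add: add scale)
    then show ?thesis by (simp add: c_def mult.commute)
  qed
  have zero: "f (\<lambda>_. 0) = 0" using scale[of 0 "\<lambda>_. 0"] by (simp add: rscale_def)
  have supp: "f e = Re (\<Sum>i\<in>J. c i * e i)" if "finite J" "\<forall>i. i \<notin> J \<longrightarrow> e i = 0" for J e
    using that
  proof (induction J arbitrary: e)
    case empty
    then have "e = (\<lambda>_. 0)" by auto
    then show ?case using zero by simp
  next
    case (insert j J)
    define e' where "e' = e(j := 0)"
    have "e = \<delta> j (e j) + e'" by (auto simp: e'_def \<delta>_def fun_eq_iff)
    then have "f e = Re (c j * e j) + f e'" by (metis add single)
    also have "f e' = Re (\<Sum>i\<in>J. c i * e' i)"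
      using insert by (intro insert.IH) (auto simp: e'_def)
    also have "(\<Sum>i\<in>J. c i * e' i) = (\<Sum>i\<in>J. c i * e i)"
      using insert by (intro sum.cong) (auto simp: e'_def)
    finally show ?case using insert by simp
  qed
  show thesis
  proof (rule that[of c])
    fix e :: "'i \<Rightarrow> complex"
    define e1 where "e1 = (\<lambda>i. if i \<in> I then e i else 0)"
    have "e = e1 + (\<lambda>i. if i \<in> I then 0 else e i)" by (auto simp: e1_def fun_eq_iff)
    then have "f e = f e1 + f (\<lambda>i. if i \<in> I then 0 else e i)" by (metis add)
    also have "f (\<lambda>i. if i \<in> I then 0 else e i) = 0" by (rule vanish) simp
    also have "f e1 = Re (\<Sum>i\<in>I. c i * e1 i)" using I by (intro supp) (auto simp: e1_def)
    also have "(\<Sum>i\<in>I. c i * e1 i) = (\<Sum>i\<in>I. c i * e i)"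
      by (intro sum.cong) (auto simp: e1_def)
    finally show "f e = Re (\<Sum>i\<in>I. c i * e i)" by simp
  qed
qed

text \<open>The matrix p need not be Hermitian: its Hermitian part has the same real form. Adding
  \<epsilon> times the identity makes that form definite, so that the factor s is
  invertible.\<close>

lemma positive_form_factor:
  fixes p :: "nat \<Rightarrow> nat \<Rightarrow> complex"
  assumes nonneg: "\<And>v. 0 \<le> Re (\<Sum>i<n. \<Sum>j<n. p i j * (v i * cnj (v j)))" and \<epsilon>: "0 < \<epsilon>"
  obtains s r where
    "\<And>i j. i < n \<Longrightarrow> j < n \<Longrightarrow> (\<Sum>l<n. s i l * r l j) = (if i = j then 1 else 0)"
    "\<And>i j. i < n \<Longrightarrow> j < n \<Longrightarrow> (\<Sum>l<n. r i l * s l j) = (if i = j then 1 else 0)"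
    "\<And>v. (\<Sum>l<n. (cmod (\<Sum>i<n. v i * s l i))\<^sup>2) =
      Re (\<Sum>i<n. \<Sum>j<n. p i j * (v i * cnj (v j))) + \<epsilon> * (\<Sum>i<n. (cmod (v i))\<^sup>2)"
proof -
  define P where "P i j = (p i j + cnj (p j i)) / 2 + (if i = j then of_real \<epsilon> else 0)" for i j
  have form: "Re (\<Sum>i<n. \<Sum>j<n. v i * cnj (v j) * P i j) =
      Re (\<Sum>i<n. \<Sum>j<n. p i j * (v i * cnj (v j))) + \<epsilon> * (\<Sum>i<n. (cmod (v i))\<^sup>2)" for v
  proof -
    define S where "S = (\<Sum>i<n. \<Sum>j<n. p i j * (v i * cnj (v j)))"
    have "cnj S = (\<Sum>j<n. \<Sum>i<n. cnj (p i j) * (cnj (v i) * v j))"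
      unfolding S_def by (subst sum.swap) simp
    then have S': "cnj S = (\<Sum>i<n. \<Sum>j<n. cnj (p j i) * (v i * cnj (v j)))"
      by (simp add: mult.commute)
    have "(\<Sum>i<n. \<Sum>j<n. v i * cnj (v j) * P i j) =
       (\<Sum>i<n. \<Sum>j<n. (p i j * (v i * cnj (v j)) + cnj (p j i) * (v i * cnj (v j))) / 2
          + (if i = j then of_real \<epsilon> * (v i * cnj (v i)) else 0))"
      by (intro sum.cong refl) (auto simp: P_def algebra_simps add_divide_distrib)
    also have "\<dots> = (S + cnj S) / 2 + of_real \<epsilon> * (\<Sum>i<n. v i * cnj (v i))"
      unfolding S' unfolding S_def by (simp add: sum.distrib sum_divide_distrib[symmetric] sum_distrib_left)
    also have "(\<Sum>i<n. v i * cnj (v i)) = of_real (\<Sum>i<n. (cmod (v i))\<^sup>2)"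
      by (simp add: complex_norm_square del: of_real_power)
    finally have total: "(\<Sum>i<n. \<Sum>j<n. v i * cnj (v j) * P i j) =
        (S + cnj S) / 2 + of_real \<epsilon> * of_real (\<Sum>i<n. (cmod (v i))\<^sup>2)" .
    show ?thesis unfolding total S_def[symmetric] by simp
  qed
  have "\<exists>s r. (\<forall>i<n. \<forall>j<n. P i j = (\<Sum>l<n. s l i * cnj (s l j))) \<and>
    (\<forall>i<n. \<forall>j<n. (\<Sum>l<n. s i l * r l j) = (if i = j then 1 else 0)) \<and>
    (\<forall>i<n. \<forall>j<n. (\<Sum>l<n. r i l * s l j) = (if i = j then 1 else 0))"
  proof (rule cholesky)
    show "P j i = cnj (P i j)" for i j by (auto simp: P_def)
    fix v :: "nat \<Rightarrow> complex" assume "\<exists>i<n. v i \<noteq> 0"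
    then have "0 < (\<Sum>i<n. (cmod (v i))\<^sup>2)"
      by (auto intro!: sum_pos2)
    then show "0 < Re (\<Sum>i<n. \<Sum>j<n. v i * cnj (v j) * P i j)"
      unfolding form using nonneg[of v] \<epsilon> by (intro add_nonneg_pos mult_pos_pos)
  qed
  then obtain s r where P: "\<forall>i<n. \<forall>j<n. P i j = (\<Sum>l<n. s l i * cnj (s l j))"
    and sr: "\<forall>i<n. \<forall>j<n. (\<Sum>l<n. s i l * r l j) = (if i = j then 1 else 0)"
    and rs: "\<forall>i<n. \<forall>j<n. (\<Sum>l<n. r i l * s l j) = (if i = j then 1 else 0)"
    by (elim exE conjE)
  show thesis
  proof (rule that[of s r])
    fix v
    have "(\<Sum>i<n. \<Sum>j<n. v i * cnj (v j) * P i j) =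
      (\<Sum>i<n. \<Sum>j<n. v i * cnj (v j) * (\<Sum>l<n. s l i * cnj (s l j)))" using P by simp
    also have "\<dots> = of_real (\<Sum>l<n. (cmod (\<Sum>i<n. v i * s l i))\<^sup>2)" by (rule gram_form)
    finally have "Re (\<Sum>i<n. \<Sum>j<n. v i * cnj (v j) * P i j) = (\<Sum>l<n. (cmod (\<Sum>i<n. v i * s l i))\<^sup>2)"
      by (simp only: Re_complex_of_real)
    then show "(\<Sum>l<n. (cmod (\<Sum>i<n. v i * s l i))\<^sup>2) =
      Re (\<Sum>i<n. \<Sum>j<n. p i j * (v i * cnj (v j))) + \<epsilon> * (\<Sum>i<n. (cmod (v i))\<^sup>2)"
      unfolding form by (rule sym)
  qed (use sr rs in auto)
qed

lemma sum_lessThan_add: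
  fixes f :: "nat \<Rightarrow> 'c::comm_monoid_add"
  shows "(\<Sum>l<a + b. f l) = (\<Sum>l<a. f l) + (\<Sum>l<b. f (a + l))"
  by (induction b) (simp_all add: ac_simps)

lemma (in operator_space) dual_space_subspace: "module.subspace fscale (dual_space s V N)"
proof -
  interpret fs: vector_space "fscale :: complex \<Rightarrow> ('v \<Rightarrow> complex) \<Rightarrow> 'v \<Rightarrow> complex"
    by (rule vector_space_fscale)
  show ?thesis
  proof (rule fs.subspaceI)
    show "0 \<in> dual_space s V N" by (auto simp: dual_space_def intro!: exI[of _ 0])
    fix p assume p: "p \<in> dual_space s V N"
    obtain C where C: "0 \<le> C" "\<And>v. v \<in> V \<Longrightarrow> cmod (p v) \<le> C * norm1 N v"
      using dual_space_bound_nonneg[OF p] by blast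
    show "fscale c p \<in> dual_space s V N" for c
    proof -
      have "\<forall>v\<in>V. cmod (fscale c p v) \<le> (cmod c * C) * norm1 N v"
        using mult_left_mono[OF C(2) norm_ge_zero[of c]] by (simp add: norm_mult mult.assoc)
      then show ?thesis using dual_spaceD(1,2,4)[OF p] unfolding dual_space_def
        by (intro CollectI conjI exI[of _ "cmod c * C"]) (auto simp: algebra_simps)
    qed
    fix q assume q: "q \<in> dual_space s V N"
    obtain D where D: "0 \<le> D" "\<And>v. v \<in> V \<Longrightarrow> cmod (q v) \<le> D * norm1 N v"
      using dual_space_bound_nonneg[OF q] by blast
    have "\<forall>v\<in>V. cmod ((p + q) v) \<le> (C + D) * norm1 N v"
      using C(2) D(2) by (auto simp: algebra_simps intro: order_trans[OF norm_triangle_ineq] add_mono)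
    then show "p + q \<in> dual_space s V N"
      using dual_spaceD(1,2,4)[OF p] dual_spaceD(1,2,4)[OF q] unfolding dual_space_def
      by (intro CollectI conjI exI[of _ "C + D"]) (auto simp: algebra_simps)
  qed
qed

section \<open>The cone of factorizations\<close>

text \<open>
  A point \<open>e\<close> of the cone below encodes two \<open>n \<times> n\<close> matrices \<open>a\<close>, \<open>b\<close> (the first two summands
  of the index type) and an \<open>n \<times> n\<close> matrix \<open>h\<close> of functions (the third), such that
  \<open>\<alpha> \<alpha>\<^sup>* \<le> a\<close>, \<open>\<beta>\<^sup>* \<beta> \<le> b\<close> and \<open>h = \<alpha> K \<beta>\<close> on \<open>F\<close> for some \<open>K\<close> in the unit ball of \<open>M\<^sub>k(A)\<close>.
\<close>

definition factor_cone ::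
  "('x \<Rightarrow> complex) set \<Rightarrow> (nat \<Rightarrow> ('x \<Rightarrow> complex) mat \<Rightarrow> real) \<Rightarrow> nat \<Rightarrow> 'x set \<Rightarrow>
    ((nat \<times> nat) + (nat \<times> nat) + (nat \<times> nat \<times> 'x) \<Rightarrow> complex) set" where
  "factor_cone A N n F = {e. \<exists>k \<alpha> \<beta> K. 0 < k \<and> K \<in> mats k A \<and> N k K \<le> 1 \<and>
    (\<forall>v. (\<Sum>l<k. (cmod (\<Sum>i<n. v i * \<alpha> i l))\<^sup>2) \<le> Re (\<Sum>i<n. \<Sum>j<n. v i * cnj (v j) * e (Inl (i, j)))) \<and>
    (\<forall>v. (\<Sum>l<k. (cmod (\<Sum>j<n. v j * \<beta> l j))\<^sup>2) \<le> Re (\<Sum>i<n. \<Sum>j<n. v i * cnj (v j) * e (Inr (Inl (i, j))))) \<and>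
    (\<forall>i<n. \<forall>j<n. \<forall>x\<in>F. e (Inr (Inr (i, j, x))) = (\<Sum>l<k. \<Sum>r<k. \<alpha> i l * \<beta> r j * (K $$ (l, r)) x))}"

lemma factor_coneI:
  assumes "0 < k" "K \<in> mats k A" "N k K \<le> 1"
    and "\<And>v. (\<Sum>l<k. (cmod (\<Sum>i<n. v i * \<alpha> i l))\<^sup>2) \<le> Re (\<Sum>i<n. \<Sum>j<n. v i * cnj (v j) * e (Inl (i, j)))"
    and "\<And>v. (\<Sum>l<k. (cmod (\<Sum>j<n. v j * \<beta> l j))\<^sup>2) \<le> Re (\<Sum>i<n. \<Sum>j<n. v i * cnj (v j) * e (Inr (Inl (i, j))))"
    and "\<And>i j x. i < n \<Longrightarrow> j < n \<Longrightarrow> x \<in> F \<Longrightarrow>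
      e (Inr (Inr (i, j, x))) = (\<Sum>l<k. \<Sum>r<k. \<alpha> i l * \<beta> r j * (K $$ (l, r)) x)"
  shows "e \<in> factor_cone A N n F"
  unfolding factor_cone_def using assms
  by (intro CollectI exI[of _ k] exI[of _ \<alpha>] exI[of _ \<beta>] exI[of _ K]) simp

lemma factor_coneE:
  assumes "e \<in> factor_cone A N n F"
  obtains k \<alpha> \<beta> K where "0 < k" "K \<in> mats k A" "N k K \<le> 1"
    and "\<And>v. (\<Sum>l<k. (cmod (\<Sum>i<n. v i * \<alpha> i l))\<^sup>2) \<le> Re (\<Sum>i<n. \<Sum>j<n. v i * cnj (v j) * e (Inl (i, j)))"
    and "\<And>v. (\<Sum>l<k. (cmod (\<Sum>j<n. v j * \<beta> l j))\<^sup>2) \<le> Re (\<Sum>i<n. \<Sum>j<n. v i * cnj (v j) * e (Inr (Inl (i, j))))"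
    and "\<And>i j x. i < n \<Longrightarrow> j < n \<Longrightarrow> x \<in> F \<Longrightarrow>
      e (Inr (Inr (i, j, x))) = (\<Sum>l<k. \<Sum>r<k. \<alpha> i l * \<beta> r j * (K $$ (l, r)) x)"
proof -
  from assms obtain k \<alpha> \<beta> K where "0 < k" "K \<in> mats k A" "N k K \<le> 1"
    and "\<forall>v. (\<Sum>l<k. (cmod (\<Sum>i<n. v i * \<alpha> i l))\<^sup>2) \<le> Re (\<Sum>i<n. \<Sum>j<n. v i * cnj (v j) * e (Inl (i, j)))"
    and "\<forall>v. (\<Sum>l<k. (cmod (\<Sum>j<n. v j * \<beta> l j))\<^sup>2) \<le> Re (\<Sum>i<n. \<Sum>j<n. v i * cnj (v j) * e (Inr (Inl (i, j))))"
    and "\<forall>i<n. \<forall>j<n. \<forall>x\<in>F. e (Inr (Inr (i, j, x))) = (\<Sum>l<k. \<Sum>r<k. \<alpha> i l * \<beta> r j * (K $$ (l, r)) x)"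
    unfolding factor_cone_def mem_Collect_eq by (elim exE conjE)
  then show thesis by (intro that[of k K \<alpha> \<beta>]) blast+
qed

text \<open>The triple (1, 1, 0) in the encoding of \<open>factor_cone\<close>.\<close>

definition order_unit :: "(nat \<times> nat) + (nat \<times> nat) + (nat \<times> nat \<times> 'x) \<Rightarrow> complex" where
  "order_unit = case_sum (\<lambda>(i, j). if i = j then 1 else 0)
     (case_sum (\<lambda>(i, j). if i = j then 1 else 0) (\<lambda>_. 0))"

lemma order_unit_simps [simp]:
  "order_unit (Inl (i, j)) = (if i = j then 1 else 0)"
  "order_unit (Inr (Inl (i, j))) = (if i = j then 1 else 0)"
  "order_unit (Inr (Inr y)) = 0"
  by (simp_all add: order_unit_def)

lemma unit_form:
  fixes v :: "nat \<Rightarrow> complex"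
  shows "(\<Sum>i<n. \<Sum>j<n. v i * cnj (v j) * (of_real t * (if i = j then 1 else 0))) =
    of_real (t * (\<Sum>i<n. (cmod (v i))\<^sup>2))"
proof -
  have "(\<Sum>i<n. \<Sum>j<n. v i * cnj (v j) * (of_real t * (if i = j then 1 else 0))) =
      (\<Sum>i<n. \<Sum>j<n. if i = j then of_real t * (v i * cnj (v i)) else 0)"
    by (intro sum.cong refl) auto
  also have "\<dots> = of_real t * (\<Sum>i<n. v i * cnj (v i))" by (simp add: sum_distrib_left)
  also have "(\<Sum>i<n. v i * cnj (v i)) = of_real (\<Sum>i<n. (cmod (v i))\<^sup>2)"
    by (simp add: complex_norm_square del: of_real_power)
  finally show ?thesis by simp
qed

section \<open>Interpolation in the algebra and the axioms of the cone\<close>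

context function_operator_algebra
begin

text \<open>A Lagrange product: each y in G contributes a separating function, shifted by a constant
  to vanish at y and scaled to be 1 at x.\<close>

lemma interpolation_delta:
  assumes "finite G" "x \<notin> G"
  shows "\<exists>f\<in>A. f x = 1 \<and> (\<forall>y\<in>G. f y = 0)"
  using assms
proof (induction G)
  case empty
  show ?case using constants[of 1] by (intro bexI[of _ "\<lambda>_. 1"]) auto
next
  case (insert y G)
  then obtain f where f: "f \<in> A" "f x = 1" "\<forall>y\<in>G. f y = 0" by auto
  obtain g where g: "g \<in> A" "g x \<noteq> g y" using separates[of x y] insert.prems by auto
  define h where "h = f * fscale (1 / (g x - g y)) (g + (\<lambda>_. - g y))"
  have "h \<in> A"
    unfolding h_def using f g constants
    by (intro mult_closed subspace_scale[OF carrier_subspace] subspace_add[OF carrier_subspace])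
  moreover have "h x = 1" "\<forall>z\<in>insert y G. h z = 0"
    using f g by (auto simp: h_def)
  ultimately show ?case by blast
qed

lemma interpolation:
  assumes F: "finite F"
  shows "\<exists>f\<in>A. \<forall>x\<in>F. f x = c x"
proof -
  have "\<exists>e. \<forall>x\<in>F. e x \<in> A \<and> e x x = 1 \<and> (\<forall>y\<in>F - {x}. e x y = 0)"
  proof (intro bchoice ballI)
    fix x assume "x \<in> F"
    show "\<exists>f. f \<in> A \<and> f x = 1 \<and> (\<forall>y\<in>F - {x}. f y = 0)"
      using interpolation_delta[of "F - {x}" x] F by auto
  qed
  then obtain e where e: "\<And>x. x \<in> F \<Longrightarrow> e x \<in> A" "\<And>x. x \<in> F \<Longrightarrow> e x x = 1"
    "\<And>x y. x \<in> F \<Longrightarrow> y \<in> F \<Longrightarrow> y \<noteq> x \<Longrightarrow> e x y = 0" by blast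
  define f where "f = (\<Sum>x\<in>F. fscale (c x) (e x))"
  have "f \<in> A" unfolding f_def
    using e(1) by (intro subspace_sum[OF carrier_subspace] subspace_scale[OF carrier_subspace])
  moreover have "f y = c y" if "y \<in> F" for y
  proof -
    have "f y = (\<Sum>x\<in>F. if x = y then c y else 0)"
      unfolding f_def sum_fun_apply using e that by (intro sum.cong) auto
    then show ?thesis using F that by simp
  qed
  ultimately show ?thesis by blast
qed

text \<open>The factors are concatenated around the direct sum of K and K', whose norm is the
  maximum of the two and so stays at most 1. The sizes add up.\<close>

lemma factor_cone_add:
  assumes "e \<in> factor_cone A N n F" "e' \<in> factor_cone A N n F"
  shows "e + e' \<in> factor_cone A N n F"
proof -
  obtain k \<alpha> \<beta> K where 1: "0 < k" "K \<in> mats k A" "N k K \<le> 1"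
    "\<And>v. (\<Sum>l<k. (cmod (\<Sum>i<n. v i * \<alpha> i l))\<^sup>2) \<le> Re (\<Sum>i<n. \<Sum>j<n. v i * cnj (v j) * e (Inl (i, j)))"
    "\<And>v. (\<Sum>l<k. (cmod (\<Sum>j<n. v j * \<beta> l j))\<^sup>2) \<le> Re (\<Sum>i<n. \<Sum>j<n. v i * cnj (v j) * e (Inr (Inl (i, j))))"
    "\<And>i j x. i < n \<Longrightarrow> j < n \<Longrightarrow> x \<in> F \<Longrightarrow>
      e (Inr (Inr (i, j, x))) = (\<Sum>l<k. \<Sum>r<k. \<alpha> i l * \<beta> r j * (K $$ (l, r)) x)"
    by (rule factor_coneE[OF assms(1)]) (rule that; assumption)
  obtain k' \<alpha>' \<beta>' K' where 2: "0 < k'" "K' \<in> mats k' A" "N k' K' \<le> 1"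
    "\<And>v. (\<Sum>l<k'. (cmod (\<Sum>i<n. v i * \<alpha>' i l))\<^sup>2) \<le> Re (\<Sum>i<n. \<Sum>j<n. v i * cnj (v j) * e' (Inl (i, j)))"
    "\<And>v. (\<Sum>l<k'. (cmod (\<Sum>j<n. v j * \<beta>' l j))\<^sup>2) \<le> Re (\<Sum>i<n. \<Sum>j<n. v i * cnj (v j) * e' (Inr (Inl (i, j))))"
    "\<And>i j x. i < n \<Longrightarrow> j < n \<Longrightarrow> x \<in> F \<Longrightarrow>
      e' (Inr (Inr (i, j, x))) = (\<Sum>l<k'. \<Sum>r<k'. \<alpha>' i l * \<beta>' r j * (K' $$ (l, r)) x)"
    by (rule factor_coneE[OF assms(2)]) (rule that; assumption)
  define \<alpha>2 where "\<alpha>2 i l = (if l < k then \<alpha> i l else \<alpha>' i (l - k))" for i l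
  define \<beta>2 where "\<beta>2 l j = (if l < k then \<beta> l j else \<beta>' (l - k) j)" for l j
  show ?thesis
  proof (rule factor_coneI[where k = "k + k'" and K = "dsum_mat K K'" and \<alpha> = \<alpha>2 and \<beta> = \<beta>2])
    show "0 < k + k'" using 1(1) by simp
    show "dsum_mat K K' \<in> mats (k + k') A" using 1(2) 2(2) by (rule dsum_mats)
    show "N (k + k') (dsum_mat K K') \<le> 1"
      using norm_dsum[OF 1(1) 2(1) 1(2) 2(2)] 1(3) 2(3) by simp
    show "(\<Sum>l<k + k'. (cmod (\<Sum>i<n. v i * \<alpha>2 i l))\<^sup>2) \<le> Re (\<Sum>i<n. \<Sum>j<n. v i * cnj (v j) * (e + e') (Inl (i, j)))" for v
      using add_mono[OF 1(4)[of v] 2(4)[of v]]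
      by (simp add: sum_lessThan_add \<alpha>2_def distrib_left sum.distrib)
    show "(\<Sum>l<k + k'. (cmod (\<Sum>j<n. v j * \<beta>2 l j))\<^sup>2) \<le> Re (\<Sum>i<n. \<Sum>j<n. v i * cnj (v j) * (e + e') (Inr (Inl (i, j))))" for v
      using add_mono[OF 1(5)[of v] 2(5)[of v]]
      by (simp add: sum_lessThan_add \<beta>2_def distrib_left sum.distrib)
    show "(e + e') (Inr (Inr (i, j, x))) = (\<Sum>l<k + k'. \<Sum>r<k + k'. \<alpha>2 i l * \<beta>2 r j * (dsum_mat K K' $$ (l, r)) x)"
      if "i < n" "j < n" "x \<in> F" for i j x
      using 1(6)[OF that] 2(6)[OF that] matsD(1)[OF 1(2)] matsD(1)[OF 2(2)]
      by (simp add: sum_lessThan_add \<alpha>2_def \<beta>2_def index_dsum_mat[of K k K' k'])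
  qed
qed

text \<open>Both factors absorb the square root of r: the first two components are quadratic in
  \<alpha> and in \<beta>, the third is linear in each of them.\<close>

lemma factor_cone_scale:
  assumes r: "0 < r" and "e \<in> factor_cone A N n F"
  shows "rscale r e \<in> factor_cone A N n F"
proof -
  obtain k \<alpha> \<beta> K where 1: "0 < k" "K \<in> mats k A" "N k K \<le> 1"
    "\<And>v. (\<Sum>l<k. (cmod (\<Sum>i<n. v i * \<alpha> i l))\<^sup>2) \<le> Re (\<Sum>i<n. \<Sum>j<n. v i * cnj (v j) * e (Inl (i, j)))"
    "\<And>v. (\<Sum>l<k. (cmod (\<Sum>j<n. v j * \<beta> l j))\<^sup>2) \<le> Re (\<Sum>i<n. \<Sum>j<n. v i * cnj (v j) * e (Inr (Inl (i, j))))"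
    "\<And>i j x. i < n \<Longrightarrow> j < n \<Longrightarrow> x \<in> F \<Longrightarrow>
      e (Inr (Inr (i, j, x))) = (\<Sum>l<k. \<Sum>r<k. \<alpha> i l * \<beta> r j * (K $$ (l, r)) x)"
    by (rule factor_coneE[OF assms(2)]) (rule that; assumption)
  define \<rho> where "\<rho> = (of_real (sqrt r) :: complex)"
  have \<rho>: "cmod \<rho> ^ 2 = r" "\<rho> * \<rho> = of_real r"
    using r by (simp_all add: \<rho>_def flip: of_real_mult)
  have sq: "(cmod (\<Sum>i<n. v i * (\<rho> * z i)))\<^sup>2 = r * (cmod (\<Sum>i<n. v i * z i))\<^sup>2" for v z :: "nat \<Rightarrow> complex"
  proof -
    have "(\<Sum>i<n. v i * (\<rho> * z i)) = \<rho> * (\<Sum>i<n. v i * z i)"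
      by (simp add: sum_distrib_left mult_ac)
    then have "(cmod (\<Sum>i<n. v i * (\<rho> * z i)))\<^sup>2 = (cmod \<rho>)\<^sup>2 * (cmod (\<Sum>i<n. v i * z i))\<^sup>2"
      by (simp only: Real_Vector_Spaces.norm_mult power_mult_distrib)
    then show ?thesis unfolding \<rho>(1) .
  qed
  have form: "Re (\<Sum>i<n. \<Sum>j<n. v i * cnj (v j) * (of_real r * a i j)) =
      r * Re (\<Sum>i<n. \<Sum>j<n. v i * cnj (v j) * a i j)" for v and a :: "nat \<Rightarrow> nat \<Rightarrow> complex"
  proof -
    have "(\<Sum>i<n. \<Sum>j<n. v i * cnj (v j) * (of_real r * a i j)) =
      of_real r * (\<Sum>i<n. \<Sum>j<n. v i * cnj (v j) * a i j)"
      by (simp add: sum_distrib_left mult_ac)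
    then show ?thesis by simp
  qed
  show ?thesis
  proof (rule factor_coneI[where k = k and K = K and \<alpha> = "\<lambda>i l. \<rho> * \<alpha> i l" and \<beta> = "\<lambda>l j. \<rho> * \<beta> l j"])
    show "(\<Sum>l<k. (cmod (\<Sum>i<n. v i * (\<rho> * \<alpha> i l)))\<^sup>2) \<le> Re (\<Sum>i<n. \<Sum>j<n. v i * cnj (v j) * rscale r e (Inl (i, j)))" for v
      unfolding rscale_apply sq form using mult_left_mono[OF 1(4)[of v], of r] r by (simp add: sum_distrib_left)
    show "(\<Sum>l<k. (cmod (\<Sum>j<n. v j * (\<rho> * \<beta> l j)))\<^sup>2) \<le> Re (\<Sum>i<n. \<Sum>j<n. v i * cnj (v j) * rscale r e (Inr (Inl (i, j))))" for v
      unfolding rscale_apply sq form using mult_left_mono[OF 1(5)[of v], of r] r by (simp add: sum_distrib_left)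
    show "rscale r e (Inr (Inr (i, j, x))) = (\<Sum>l<k. \<Sum>t<k. \<rho> * \<alpha> i l * (\<rho> * \<beta> t j) * (K $$ (l, t)) x)"
      if "i < n" "j < n" "x \<in> F" for i j x
      unfolding rscale_apply 1(6)[OF that] \<rho>(2)[symmetric] by (simp add: sum_distrib_left mult_ac)
  qed (use 1 in auto)
qed

text \<open>Besides 0, the cone contains the whole space of points that vanish on the relevant
  coordinates. This is what confines a functional that is positive on the cone to these finitely
  many coordinates.\<close>

lemma factor_cone_vanishing:
  assumes "\<And>i j. i < n \<Longrightarrow> j < n \<Longrightarrow> e (Inl (i, j)) = 0" "\<And>i j. i < n \<Longrightarrow> j < n \<Longrightarrow> e (Inr (Inl (i, j))) = 0"
    "\<And>i j x. i < n \<Longrightarrow> j < n \<Longrightarrow> x \<in> F \<Longrightarrow> e (Inr (Inr (i, j, x))) = 0"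
  shows "e \<in> factor_cone A N n F"
  by (rule factor_coneI[where k = 1 and K = "0\<^sub>m 1 1" and \<alpha> = "\<lambda>_ _. 0" and \<beta> = "\<lambda>_ _. 0"])
    (use assms norm_zero[of 1] zero_mats[of 1] in auto)

text \<open>The third component of e is interpolated on F by some H over A, which is factored as
  \<gamma> K \<gamma> with \<gamma> a multiple of the identity. This costs M in each form; a and b
  compensate for the first two components of e, which may be arbitrary matrices.\<close>

lemma factor_cone_order_unit:
  assumes F: "finite F" and n: "0 < n"
  shows "\<exists>t. rscale t order_unit + e \<in> factor_cone A N n F"
proof -
  have "\<exists>f. f \<in> A \<and> (\<forall>x\<in>F. f x = e (Inr (Inr (i, j, x))))" for i j
    using interpolation[OF F, of "\<lambda>x. e (Inr (Inr (i, j, x)))"] by blast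
  then obtain h where h: "\<And>i j. h i j \<in> A" "\<And>i j x. x \<in> F \<Longrightarrow> h i j x = e (Inr (Inr (i, j, x)))"
    by metis
  define H where "H = mat n n (\<lambda>(i, j). h i j)"
  have H: "H \<in> mats n A" using h(1) by (intro matsI) (auto simp: H_def)
  \<comment> \<open>Adding 1 allows division by M even if H is zero.\<close>
  define M where "M = N n H + 1"
  have M: "1 \<le> M" using norm_nonneg[OF n H] by (simp add: M_def)
  define K where "K = map_mat (fscale (1 / of_real M)) H"
  have K: "K \<in> mats n A" unfolding K_def using H by (rule scale_mats)
  have "N n K = N n H / M" using M by (simp add: K_def norm_scale[OF n H] norm_divide)
  also have "\<dots> \<le> 1" using M by (simp add: M_def)
  finally have NK: "N n K \<le> 1" .
  define a where "a = (\<Sum>i<n. \<Sum>j<n. cmod (e (Inl (i, j))))"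
  define b where "b = (\<Sum>i<n. \<Sum>j<n. cmod (e (Inr (Inl (i, j)))))"
  define \<rho> where "\<rho> = (of_real (sqrt M) :: complex)"
  define \<gamma> where "\<gamma> i l = (if i = l then \<rho> else 0)" for i l :: nat
  have \<rho>: "cmod \<rho> ^ 2 = M" "\<rho> * \<rho> = of_real M"
    using M by (simp_all add: \<rho>_def flip: of_real_mult)
  have "0 \<le> a" "0 \<le> b" by (simp_all add: a_def b_def sum_nonneg)
  \<comment> \<open>Stated for any z whose entry sum is at most a + b, to serve both forms.\<close>
  have lower: "M * (\<Sum>i<n. (cmod (v i))\<^sup>2) \<le>
      Re (\<Sum>i<n. \<Sum>j<n. v i * cnj (v j) * (of_real (M + a + b) * (if i = j then 1 else 0) + z i j))"
    if z: "(\<Sum>i<n. \<Sum>j<n. cmod (z i j)) \<le> a + b" for v and z :: "nat \<Rightarrow> nat \<Rightarrow> complex"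
  proof -
    have "cmod (\<Sum>i<n. \<Sum>j<n. v i * z i j * cnj (v j)) \<le>
        (\<Sum>i<n. \<Sum>j<n. cmod (z i j)) * l2 v {..<n} * l2 (\<lambda>j. cnj (v j)) {..<n}"
      by (rule bil_boundD[OF bil_bound_exists]) auto
    also have "\<dots> \<le> (a + b) * l2 v {..<n} * l2 (\<lambda>j. cnj (v j)) {..<n}"
      using z by (intro mult_right_mono) auto
    also have "\<dots> = (a + b) * (\<Sum>i<n. (cmod (v i))\<^sup>2)"
      using l2_power2[of v "{..<n}"] by (simp add: power2_eq_square)
    finally have *: "cmod (\<Sum>i<n. \<Sum>j<n. v i * cnj (v j) * z i j) \<le> (a + b) * (\<Sum>i<n. (cmod (v i))\<^sup>2)"
      by (simp add: mult_ac)
    have "Re (\<Sum>i<n. \<Sum>j<n. v i * cnj (v j) * (of_real (M + a + b) * (if i = j then 1 else 0) + z i j)) =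
        (M + a + b) * (\<Sum>i<n. (cmod (v i))\<^sup>2) + Re (\<Sum>i<n. \<Sum>j<n. v i * cnj (v j) * z i j)"
      unfolding distrib_left[of "_ * _"] sum.distrib unit_form by simp
    moreover have "- ((a + b) * (\<Sum>i<n. (cmod (v i))\<^sup>2)) \<le> Re (\<Sum>i<n. \<Sum>j<n. v i * cnj (v j) * z i j)"
      using * abs_Re_le_cmod[of "\<Sum>i<n. \<Sum>j<n. v i * cnj (v j) * z i j"] by linarith
    ultimately show ?thesis by (simp add: algebra_simps)
  qed
  have diag: "(\<Sum>l<n. (cmod (\<Sum>i<n. v i * \<gamma> i l))\<^sup>2) = M * (\<Sum>i<n. (cmod (v i))\<^sup>2)"
    "(\<Sum>l<n. (cmod (\<Sum>i<n. v i * \<gamma> l i))\<^sup>2) = M * (\<Sum>i<n. (cmod (v i))\<^sup>2)" for v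
  proof -
    have "(\<Sum>i<n. v i * \<gamma> i l) = \<rho> * v l" "(\<Sum>i<n. v i * \<gamma> l i) = \<rho> * v l" if "l < n" for l
      using that by (auto simp: \<gamma>_def if_distrib[where f = "(*) _"] cong: if_cong)
    then show "(\<Sum>l<n. (cmod (\<Sum>i<n. v i * \<gamma> i l))\<^sup>2) = M * (\<Sum>i<n. (cmod (v i))\<^sup>2)"
    "(\<Sum>l<n. (cmod (\<Sum>i<n. v i * \<gamma> l i))\<^sup>2) = M * (\<Sum>i<n. (cmod (v i))\<^sup>2)"
      unfolding sum_distrib_left \<rho>(1)[symmetric] by (simp_all add: Real_Vector_Spaces.norm_mult power_mult_distrib)
  qed
  have "rscale (M + a + b) order_unit + e \<in> factor_cone A N n F"
  proof (rule factor_coneI[where k = n and K = K and \<alpha> = \<gamma> and \<beta> = \<gamma>])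
    show "(\<Sum>l<n. (cmod (\<Sum>i<n. v i * \<gamma> i l))\<^sup>2) \<le>
      Re (\<Sum>i<n. \<Sum>j<n. v i * cnj (v j) * (rscale (M + a + b) order_unit + e) (Inl (i, j)))" for v
      unfolding diag plus_fun_apply rscale_apply order_unit_simps using \<open>0 \<le> b\<close>
      by (intro lower) (simp add: a_def)
    show "(\<Sum>l<n. (cmod (\<Sum>j<n. v j * \<gamma> l j))\<^sup>2) \<le>
      Re (\<Sum>i<n. \<Sum>j<n. v i * cnj (v j) * (rscale (M + a + b) order_unit + e) (Inr (Inl (i, j))))" for v
      unfolding diag plus_fun_apply rscale_apply order_unit_simps using \<open>0 \<le> a\<close>
      by (intro lower) (simp add: b_def)
    show "(rscale (M + a + b) order_unit + e) (Inr (Inr (i, j, x))) =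
        (\<Sum>l<n. \<Sum>r<n. \<gamma> i l * \<gamma> r j * (K $$ (l, r)) x)" if "i < n" "j < n" "x \<in> F" for i j x
    proof -
      have "(\<Sum>r<n. \<gamma> i l * \<gamma> r j * (K $$ (l, r)) x) = (if l = i then \<rho> * \<rho> * (K $$ (i, j)) x else 0)" for l
      proof -
        have "(\<Sum>r<n. \<gamma> i l * \<gamma> r j * (K $$ (l, r)) x) =
            (\<Sum>r<n. if r = j then \<gamma> i l * \<rho> * (K $$ (l, r)) x else 0)"
          by (intro sum.cong refl) (simp add: \<gamma>_def)
        then show ?thesis using that by (simp add: \<gamma>_def)
      qed
      then have "(\<Sum>l<n. \<Sum>r<n. \<gamma> i l * \<gamma> r j * (K $$ (l, r)) x) = of_real M * (K $$ (i, j)) x"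
        using that by (simp add: \<rho>(2))
      also have "\<dots> = h i j x" using that M by (simp add: K_def H_def)
      finally show ?thesis using h(2)[OF that(3)] by simp
    qed
  qed (use n K NK in auto)
  then show ?thesis by blast
qed

end

section \<open>From the cone to norms of interpolants\<close>

context function_operator_algebra
begin

text \<open>If both forms are t times the identity, then \<alpha> and \<beta> have operator norm at
  most \<open>sqrt t\<close>, so \<alpha> K \<beta> interpolates with norm at most t. The case h = 0
  makes the cone proper; the case h = g turns a lower bound for the norms of interpolants into one
  for the gauge.\<close>

lemma factor_cone_norm:
  assumes n: "0 < n" and e: "e \<in> factor_cone A N n F"
    and a: "\<And>i j. e (Inl (i, j)) = of_real t * (if i = j then 1 else 0)"
    and b: "\<And>i j. e (Inr (Inl (i, j))) = of_real t * (if i = j then 1 else 0)"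
  obtains H where "H \<in> mats n A" "0 \<le> t" "N n H \<le> t"
    "\<And>i j x. i < n \<Longrightarrow> j < n \<Longrightarrow> x \<in> F \<Longrightarrow> (H $$ (i, j)) x = e (Inr (Inr (i, j, x)))"
proof -
  obtain k \<alpha> \<beta> K where k: "0 < k" and K: "K \<in> mats k A" "N k K \<le> 1"
    and \<alpha>: "\<And>v. (\<Sum>l<k. (cmod (\<Sum>i<n. v i * \<alpha> i l))\<^sup>2) \<le> Re (\<Sum>i<n. \<Sum>j<n. v i * cnj (v j) * e (Inl (i, j)))"
    and \<beta>: "\<And>v. (\<Sum>l<k. (cmod (\<Sum>j<n. v j * \<beta> l j))\<^sup>2) \<le> Re (\<Sum>i<n. \<Sum>j<n. v i * cnj (v j) * e (Inr (Inl (i, j))))"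
    and h: "\<And>i j x. i < n \<Longrightarrow> j < n \<Longrightarrow> x \<in> F \<Longrightarrow>
      e (Inr (Inr (i, j, x))) = (\<Sum>l<k. \<Sum>r<k. \<alpha> i l * \<beta> r j * (K $$ (l, r)) x)"
    by (rule factor_coneE[OF e]) (rule that; assumption)
  have \<alpha>: "(\<Sum>l<k. (cmod (\<Sum>i<n. v i * \<alpha> i l))\<^sup>2) \<le> t * (\<Sum>i<n. (cmod (v i))\<^sup>2)" for v
    using \<alpha>[of v] unfolding a unit_form Re_complex_of_real .
  have \<beta>: "(\<Sum>l<k. (cmod (\<Sum>i<n. v i * \<beta> l i))\<^sup>2) \<le> t * (\<Sum>i<n. (cmod (v i))\<^sup>2)" for v
    using \<beta>[of v] unfolding b unit_form Re_complex_of_real .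
  have t: "0 \<le> t"
  proof -
    let ?v = "\<lambda>i :: nat. 1 :: complex"
    have "0 \<le> (\<Sum>l<k. (cmod (\<Sum>i<n. ?v i * \<alpha> i l))\<^sup>2)" by (simp add: sum_nonneg)
    also have "\<dots> \<le> t * real n" using \<alpha>[of ?v] by simp
    finally show ?thesis using n by (simp add: zero_le_mult_iff)
  qed
  define L where "L = mat n k (\<lambda>(i, l). \<alpha> i l)"
  define M where "M = mat k n (\<lambda>(l, j). \<beta> l j)"
  have LM: "L \<in> carrier_mat n k" "M \<in> carrier_mat k n" by (simp_all add: L_def M_def)
  have vec: "l2 (\<lambda>l. \<Sum>i<n. z l i * v i) {..<k} \<le> sqrt t * l2 v {..<n}"
    if "(\<Sum>l<k. (cmod (\<Sum>i<n. v i * z l i))\<^sup>2) \<le> t * (\<Sum>i<n. (cmod (v i))\<^sup>2)" for z v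
    unfolding L2_set_def real_sqrt_mult[symmetric] using that
    by (intro real_sqrt_le_mono) (simp add: mult.commute)
  have "bil_bound {..<k} {..<n} (\<lambda>l i. \<alpha> i l) (sqrt t)"
    using vec[OF \<alpha>] by (rule bil_bound_vecI)
  from bil_bound_transpose[OF this] have "bil_bound {..<n} {..<k} (\<lambda>i j. L $$ (i, j)) (sqrt t)"
    by (subst bil_bound_cong[where M' = \<alpha>]) (auto simp: L_def)
  then have opL: "opnorm L \<le> sqrt t"
    using t LM by (subst opnorm_le_iff) auto
  have "bil_bound {..<k} {..<n} \<beta> (sqrt t)"
    using vec[OF \<beta>] by (rule bil_bound_vecI)
  then have "bil_bound {..<k} {..<n} (\<lambda>i j. M $$ (i, j)) (sqrt t)"
    by (subst bil_bound_cong[where M' = \<beta>]) (auto simp: M_def)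
  then have opM: "opnorm M \<le> sqrt t"
    using t LM by (subst opnorm_le_iff) auto
  have "opnorm L * N k K * opnorm M \<le> sqrt t * 1 * sqrt t"
    using K t norm_nonneg[OF k K(1)] opL opM
    by (intro mult_mono mult_nonneg_nonneg) (auto simp: opnorm_nonneg)
  also have "\<dots> = t" using t by simp
  finally have le: "opnorm L * N k K * opnorm M \<le> t" .
  show thesis
  proof (rule that[of "scalar_mult3 fscale L K M"])
    show "scalar_mult3 fscale L K M \<in> mats n A" using LM(1) K(1) LM(2) by (rule scalar_mult3_mats)
    show "N n (scalar_mult3 fscale L K M) \<le> t"
      using norm_scalar_mult3[OF n k LM(1) K(1) LM(2)] le by simp
    show "(scalar_mult3 fscale L K M $$ (i, j)) x = e (Inr (Inr (i, j, x)))"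
      if "i < n" "j < n" "x \<in> F" for i j x
      unfolding h[OF that] using that matsD(1)[OF K(1)] LM
      by (subst index_scalar_mult3[of K k]) (auto simp: sum_fun_apply L_def M_def)
  qed (rule t)
qed

text \<open>The separating functional written in coefficients, on the points of the cone with a and
  b equal to their lower bounds \<open>\<alpha> \<alpha>\<^sup>*\<close> and
  \<open>\<beta>\<^sup>* \<beta>\<close>. W carries a minus sign, so that positivity bounds its
  pairing from above. The trace condition is the value on (1, 1, 0).\<close>

lemma separating_functional:
  fixes g :: "nat \<Rightarrow> nat \<Rightarrow> 'x \<Rightarrow> complex"
  assumes F: "finite F" and n: "0 < n"
    and t0: "\<And>H. H \<in> mats n A \<Longrightarrow> (\<And>i j x. i < n \<Longrightarrow> j < n \<Longrightarrow> x \<in> F \<Longrightarrow> (H $$ (i, j)) x = g i j x) \<Longrightarrow> t0 \<le> N n H"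
  obtains p q W where
    "\<And>k \<alpha> \<beta> K. 0 < k \<Longrightarrow> K \<in> mats k A \<Longrightarrow> N k K \<le> 1 \<Longrightarrow>
      Re (\<Sum>i<n. \<Sum>j<n. \<Sum>x\<in>F. W i j x * (\<Sum>l<k. \<Sum>r<k. \<alpha> i l * \<beta> r j * (K $$ (l, r)) x)) \<le>
      Re (\<Sum>i<n. \<Sum>j<n. p i j * (\<Sum>l<k. \<alpha> i l * cnj (\<alpha> j l))) +
      Re (\<Sum>i<n. \<Sum>j<n. q i j * (\<Sum>l<k. \<beta> l i * cnj (\<beta> l j)))"
    "Re (\<Sum>i<n. p i i) + Re (\<Sum>i<n. q i i) \<le> 1"
    "t0 \<le> Re (\<Sum>i<n. \<Sum>j<n. \<Sum>x\<in>F. W i j x * g i j x)"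
proof -
  define C where "C = factor_cone A N n F"
  \<comment> \<open>With this sign, \<open>rscale t order_unit - y\<close> is the triple (t, t,
    g).\<close>
  define y where "y = (case_sum (\<lambda>_. 0) (case_sum (\<lambda>_. 0) (\<lambda>(i, j, x). - g i j x)) ::
    (nat \<times> nat) + (nat \<times> nat) + (nat \<times> nat \<times> 'x) \<Rightarrow> complex)"
  obtain f where f: "\<And>x y. f (x + y) = f x + f y" "\<And>r x. f (rscale r x) = r * f x"
    "\<And>x. x \<in> C \<Longrightarrow> 0 \<le> f x" "f order_unit \<le> 1" "t0 \<le> f y"
  proof (rule cone_separation[OF vector_space_rscale, of C order_unit y t0])
    show "x + y \<in> C" if "x \<in> C" "y \<in> C" for x y
      using that unfolding C_def by (rule factor_cone_add)
    show "rscale r x \<in> C" if "0 < r" "x \<in> C" for r x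
      using that unfolding C_def by (rule factor_cone_scale)
    show "0 \<in> C" unfolding C_def by (rule factor_cone_vanishing) auto
    show "\<exists>t. rscale t order_unit + x \<in> C" for x
      unfolding C_def using F n by (rule factor_cone_order_unit)
    show "0 \<le> t" if "rscale t order_unit \<in> C" for t
      using that unfolding C_def by (rule factor_cone_norm[OF n]) auto
    show "t0 \<le> t" if t: "rscale t order_unit - y \<in> C" for t
    proof -
      obtain H where H: "H \<in> mats n A" "0 \<le> t" "N n H \<le> t"
        "\<And>i j x. i < n \<Longrightarrow> j < n \<Longrightarrow> x \<in> F \<Longrightarrow> (H $$ (i, j)) x = (rscale t order_unit - y) (Inr (Inr (i, j, x)))"
        by (rule factor_cone_norm[OF n t[unfolded C_def], of t]) (auto simp: y_def)
      have "t0 \<le> N n H" using H by (intro t0) (auto simp: y_def)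
      then show ?thesis using H(3) by simp
    qed
  qed (rule that; assumption)
  define S where "S = {..<n} \<times> {..<n}"
  define T where "T = {..<n} \<times> {..<n} \<times> F"
  have fin: "finite S" "finite T" using F by (simp_all add: S_def T_def)
  have vanish: "f e = 0" if "\<forall>i\<in>S <+> (S <+> T). e i = 0" for e
  proof -
    \<comment> \<open>Both e and -e lie in the cone, so f is nonnegative at both.\<close>
    have "e \<in> C" "rscale (-1) e \<in> C"
      unfolding C_def using that
      by (auto intro!: factor_cone_vanishing simp: S_def T_def InlI InrI)
    then have "0 \<le> f e" "0 \<le> f (rscale (-1) e)" using f(3) by blast+
    then show ?thesis by (simp add: f(2))
  qed
  have "finite (S <+> (S <+> T))" using fin by simp
  then obtain c where c: "\<And>e. f e = Re (\<Sum>i\<in>S <+> (S <+> T). c i * e i)"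
    by (rule real_functional_coefficients[OF f(1,2) _ vanish]) (assumption, rule that, assumption)
  define p where "p i j = c (Inl (i, j))" for i j
  define q where "q i j = c (Inr (Inl (i, j)))" for i j
  define W where "W i j x = - c (Inr (Inr (i, j, x)))" for i j x
  have fe: "f e = Re (\<Sum>i<n. \<Sum>j<n. p i j * e (Inl (i, j))) + Re (\<Sum>i<n. \<Sum>j<n. q i j * e (Inr (Inl (i, j))))
      - Re (\<Sum>i<n. \<Sum>j<n. \<Sum>x\<in>F. W i j x * e (Inr (Inr (i, j, x))))" for e
  proof -
    have "(\<Sum>i\<in>S <+> (S <+> T). c i * e i) = (\<Sum>i\<in>S. c (Inl i) * e (Inl i)) +
        ((\<Sum>i\<in>S. c (Inr (Inl i)) * e (Inr (Inl i))) + (\<Sum>i\<in>T. c (Inr (Inr i)) * e (Inr (Inr i))))"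
      using fin by (simp add: sum.Plus)
    also have "\<dots> = (\<Sum>i<n. \<Sum>j<n. p i j * e (Inl (i, j))) + ((\<Sum>i<n. \<Sum>j<n. q i j * e (Inr (Inl (i, j))))
      + - (\<Sum>i<n. \<Sum>j<n. \<Sum>x\<in>F. W i j x * e (Inr (Inr (i, j, x)))))"
      unfolding S_def T_def sum_pairs p_def q_def W_def by (simp add: sum_negf)
    finally show ?thesis unfolding c by (simp only: plus_complex.sel uminus_complex.sel)
  qed
  show thesis
  proof (rule that[where p = p and q = q and W = W])
    fix k :: nat and \<alpha> \<beta> :: "nat \<Rightarrow> nat \<Rightarrow> complex" and K
    assume k: "0 < k" and K: "K \<in> mats k A" "N k K \<le> 1"
    define e where "e = case_sum (\<lambda>(i, j). \<Sum>l<k. \<alpha> i l * cnj (\<alpha> j l))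
      (case_sum (\<lambda>(i, j). \<Sum>l<k. \<beta> l i * cnj (\<beta> l j))
        (\<lambda>(i, j, x). \<Sum>l<k. \<Sum>r<k. \<alpha> i l * \<beta> r j * (K $$ (l, r)) x))"
    have "e \<in> C"
      unfolding C_def
    proof (rule factor_coneI[where k = k and K = K and \<alpha> = \<alpha> and \<beta> = \<beta>])
      show "(\<Sum>l<k. (cmod (\<Sum>i<n. v i * \<alpha> i l))\<^sup>2) \<le> Re (\<Sum>i<n. \<Sum>j<n. v i * cnj (v j) * e (Inl (i, j)))" for v
        using gram_form[where v = v and I = "{..<n}" and s = "\<lambda>l i. \<alpha> i l" and L = "{..<k}"]
        by (simp only: e_def sum.case prod.case Re_complex_of_real order_refl)
      show "(\<Sum>l<k. (cmod (\<Sum>i<n. v i * \<beta> l i))\<^sup>2) \<le> Re (\<Sum>i<n. \<Sum>j<n. v i * cnj (v j) * e (Inr (Inl (i, j))))" for v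
        using gram_form[where v = v and I = "{..<n}" and s = \<beta> and L = "{..<k}"]
        by (simp only: e_def sum.case prod.case Re_complex_of_real order_refl)
    qed (use k K in \<open>auto simp: e_def\<close>)
    from f(3)[OF this] show "Re (\<Sum>i<n. \<Sum>j<n. \<Sum>x\<in>F. W i j x * (\<Sum>l<k. \<Sum>r<k. \<alpha> i l * \<beta> r j * (K $$ (l, r)) x)) \<le>
      Re (\<Sum>i<n. \<Sum>j<n. p i j * (\<Sum>l<k. \<alpha> i l * cnj (\<alpha> j l))) +
      Re (\<Sum>i<n. \<Sum>j<n. q i j * (\<Sum>l<k. \<beta> l i * cnj (\<beta> l j)))"
      unfolding fe by (simp only: e_def sum.case prod.case diff_ge_0_iff_ge)
  next
    have "(\<Sum>i<n. \<Sum>j<n. z i j * (if i = j then 1 else 0)) = (\<Sum>i<n. z i i)" for z :: "nat \<Rightarrow> nat \<Rightarrow> complex"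
    proof (intro sum.cong refl)
      fix i assume "i \<in> {..<n}"
      then show "(\<Sum>j<n. z i j * (if i = j then 1 else 0)) = z i i"
        by (intro sum_mult_delta) auto
    qed
    then show "Re (\<Sum>i<n. p i i) + Re (\<Sum>i<n. q i i) \<le> 1"
      using f(4) unfolding fe order_unit_simps by simp
    show "t0 \<le> Re (\<Sum>i<n. \<Sum>j<n. \<Sum>x\<in>F. W i j x * g i j x)"
      using f(5) unfolding fe by (simp add: y_def sum_negf)
  qed
qed

end

text \<open>Moves r and r' from the matrix w to the vectors \<xi> and \<eta>. It is used once to
  bound the norm of the rescaled W, against K of any size k, and once to evaluate P at it, with k =
  n.\<close>

lemma twisted_form:
  fixes r r' :: "nat \<Rightarrow> nat \<Rightarrow> complex"
  shows "(\<Sum>a<n. \<Sum>l<k. \<Sum>b<n. \<Sum>t<k. \<xi> (a, l) * (\<Sum>i<n. \<Sum>j<n. r i a * r' j b * w i j l t) * \<eta> (b, t)) =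
    (\<Sum>i<n. \<Sum>j<n. \<Sum>l<k. \<Sum>t<k. (\<Sum>a<n. r i a * \<xi> (a, l)) * (\<Sum>b<n. r' j b * \<eta> (b, t)) * w i j l t)"
proof -
  let ?g = "\<lambda>a l b t i j. \<xi> (a, l) * \<eta> (b, t) * (r i a * r' j b * w i j l t)"
  have "(\<Sum>a<n. \<Sum>l<k. \<Sum>b<n. \<Sum>t<k. \<xi> (a, l) * (\<Sum>i<n. \<Sum>j<n. r i a * r' j b * w i j l t) * \<eta> (b, t)) =
      (\<Sum>a<n. \<Sum>l<k. \<Sum>b<n. \<Sum>t<k. \<Sum>i<n. \<Sum>j<n. ?g a l b t i j)"
    by (simp add: sum_distrib_left sum_distrib_right mult_ac)
  \<comment> \<open>Packing the indices into tuples lets a single exchange reorder all six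
    sums.\<close>
  also have "\<dots> = (\<Sum>p\<in>{..<n} \<times> {..<k} \<times> {..<n} \<times> {..<k}. \<Sum>q\<in>{..<n} \<times> {..<n}.
      ?g (fst p) (fst (snd p)) (fst (snd (snd p))) (snd (snd (snd p))) (fst q) (snd q))"
    by (simp add: sum_pairs)
  also have "\<dots> = (\<Sum>q\<in>{..<n} \<times> {..<n}. \<Sum>p\<in>{..<n} \<times> {..<k} \<times> {..<n} \<times> {..<k}.
      ?g (fst p) (fst (snd p)) (fst (snd (snd p))) (snd (snd (snd p))) (fst q) (snd q))"
    by (rule sum.swap)
  also have "\<dots> = (\<Sum>i<n. \<Sum>j<n. \<Sum>a<n. \<Sum>l<k. \<Sum>b<n. \<Sum>t<k. ?g a l b t i j)"
    by (simp add: sum_pairs)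
  also have "\<dots> = (\<Sum>i<n. \<Sum>j<n. \<Sum>l<k. \<Sum>t<k. (\<Sum>a<n. r i a * \<xi> (a, l)) * (\<Sum>b<n. r' j b * \<eta> (b, t)) * w i j l t)"
  proof (intro sum.cong refl)
    fix i j
    have "(\<Sum>a<n. \<Sum>l<k. \<Sum>b<n. \<Sum>t<k. ?g a l b t i j) = (\<Sum>l<k. \<Sum>a<n. \<Sum>b<n. \<Sum>t<k. ?g a l b t i j)"
      by (rule sum.swap)
    also have "\<dots> = (\<Sum>l<k. \<Sum>a<n. \<Sum>t<k. \<Sum>b<n. ?g a l b t i j)"
      by (intro sum.cong refl sum.swap)
    also have "\<dots> = (\<Sum>l<k. \<Sum>t<k. \<Sum>a<n. \<Sum>b<n. ?g a l b t i j)"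
      by (intro sum.cong refl sum.swap)
    also have "\<dots> = (\<Sum>l<k. \<Sum>t<k. (\<Sum>a<n. r i a * \<xi> (a, l)) * (\<Sum>b<n. r' j b * \<eta> (b, t)) * w i j l t)"
    proof (intro sum.cong refl)
      fix l t
      have "(\<Sum>a<n. r i a * \<xi> (a, l)) * (\<Sum>b<n. r' j b * \<eta> (b, t)) * w i j l t =
        (\<Sum>a<n. \<Sum>b<n. (r i a * \<xi> (a, l)) * (r' j b * \<eta> (b, t)) * w i j l t)"
        unfolding sum_product by (simp only: sum_distrib_right)
      then show "(\<Sum>a<n. \<Sum>b<n. ?g a l b t i j) = (\<Sum>a<n. r i a * \<xi> (a, l)) * (\<Sum>b<n. r' j b * \<eta> (b, t)) * w i j l t"
        by (simp add: mult_ac)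
    qed
    finally show "(\<Sum>a<n. \<Sum>l<k. \<Sum>b<n. \<Sum>t<k. ?g a l b t i j) = \<dots>" .
  qed
  finally show ?thesis .
qed

section \<open>The predual\<close>

text \<open>The canonical shuffle: exchanging the two components of the index pairs lets either
  matrix play the role of the functionals.\<close>

lemma amp_bound_swap:
  "amp_bound n m P w c \<longleftrightarrow> bil_bound ({..<m} \<times> {..<n}) ({..<m} \<times> {..<n})
    (\<lambda>p q. (P $$ (snd p, snd q)) (w $$ (fst p, fst q))) c"
proof -
  have bij: "bij_betw prod.swap ({..<m} \<times> {..<n}) ({..<n} \<times> {..<m})"
    by (rule bij_betw_byWitness[where f' = prod.swap]) auto
  show ?thesis
    using bil_bound_reindex[OF bij bij, of "\<lambda>p q. (P $$ (fst p, fst q)) (w $$ (snd p, snd q))" c]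
    by (simp add: amp_bound_def)
qed

lemma Re_double: "Re (2 * z) = 2 * Re z"
  by simp

lemma sum_pull_out:
  fixes p :: "'i \<Rightarrow> 'j \<Rightarrow> 'c::comm_semiring_0"
  shows "(\<Sum>i\<in>I. \<Sum>j\<in>J. p i j * (\<Sum>l\<in>L. z i j l)) = (\<Sum>l\<in>L. \<Sum>i\<in>I. \<Sum>j\<in>J. p i j * z i j l)"
proof -
  have "(\<Sum>i\<in>I. \<Sum>j\<in>J. p i j * (\<Sum>l\<in>L. z i j l)) = (\<Sum>i\<in>I. \<Sum>l\<in>L. \<Sum>j\<in>J. p i j * z i j l)"
    unfolding sum_distrib_left by (intro sum.cong refl sum.swap)
  also have "\<dots> = (\<Sum>l\<in>L. \<Sum>i\<in>I. \<Sum>j\<in>J. p i j * z i j l)" by (rule sum.swap)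
  finally show ?thesis .
qed

lemma sum_inverse_apply:
  fixes s r :: "nat \<Rightarrow> nat \<Rightarrow> complex"
  assumes "\<And>i j. i < n \<Longrightarrow> j < n \<Longrightarrow> (\<Sum>l<n. s i l * r l j) = (if i = j then 1 else 0)" and "a < n"
  shows "(\<Sum>i<n. (\<Sum>b<n. r i b * z b) * s a i) = z a"
proof -
  have "(\<Sum>i<n. (\<Sum>b<n. r i b * z b) * s a i) = (\<Sum>i<n. s a i * (\<Sum>b<n. r i b * z b))"
    by (simp add: mult.commute)
  also have "\<dots> = (\<Sum>b<n. \<Sum>i<n. s a i * (r i b * z b))"
    unfolding sum_distrib_left by (rule sum.swap)
  also have "\<dots> = (\<Sum>b<n. z b * (\<Sum>i<n. s a i * r i b))"
    by (simp add: sum_distrib_left mult_ac)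
  also have "\<dots> = z a"
    using assms by (intro sum_mult_delta) auto
  finally show ?thesis .
qed

context function_operator_algebra
begin

text \<open>Functionals in \<open>dual_space\<close> vanish off the carrier, hence the case distinction.\<close>

definition evaluation :: "'x \<Rightarrow> ('x \<Rightarrow> complex) \<Rightarrow> complex" where
  "evaluation x = (\<lambda>f. if f \<in> A then f x else 0)"

text \<open>The algebraic span suffices, since \<open>operator_space\<close> does not ask for
  completeness; on it, a linear functional is determined by its values at the evaluations.\<close>

definition predual :: "(('x \<Rightarrow> complex) \<Rightarrow> complex) set" where
  "predual = module.span fscale (range evaluation)"

interpretation fun_space: vector_space
  "fscale :: complex \<Rightarrow> (('x \<Rightarrow> complex) \<Rightarrow> complex) \<Rightarrow> ('x \<Rightarrow> complex) \<Rightarrow> complex"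
  by (rule vector_space_fscale)

lemma evaluation_dual: "evaluation x \<in> dual_space fscale A N"
proof -
  obtain C where C: "\<forall>f\<in>A. cmod (f x) \<le> C * norm1 N f" using eval_bounded by blast
  show ?thesis
    unfolding dual_space_def
    by (intro CollectI conjI exI[of _ C])
      (use C subspace_add[OF carrier_subspace] subspace_scale[OF carrier_subspace] in \<open>auto simp: evaluation_def\<close>)
qed

lemma predual_subspace: "fun_space.subspace predual"
  unfolding predual_def by (rule fun_space.subspace_span)

lemma evaluation_predual: "evaluation x \<in> predual"
  unfolding predual_def by (intro fun_space.span_base) auto

lemma predual_dual: "predual \<subseteq> dual_space fscale A N"
  unfolding predual_def using evaluation_dual dual_space_subspace by (intro fun_space.span_minimal) auto

lemma mats_predual_dual: "w \<in> mats n predual \<Longrightarrow> w \<in> mats n (dual_space fscale A N)"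
  using predual_dual by (auto simp: mats_iff)

lemma operator_space_predual: "operator_space fscale predual (dual_norm A N)"
  using predual_subspace predual_dual by (rule dual_subspace_operator_space)

text \<open>Here t0 is any lower bound for the norms of the interpolants of P on F. The separating W
  is an n by n matrix over \<open>predual\<close>, so it is enough to control P at level n.\<close>

lemma interpolation_norm_le:
  assumes F: "finite F" and n: "0 < n" and D: "0 \<le> D"
    and P: "P \<in> mats n (dual_space fscale predual (dual_norm A N))"
    and bound: "\<And>w. w \<in> mats n predual \<Longrightarrow> dual_norm A N n w \<le> 1 \<Longrightarrow> amp_bound n n P w D"
    and t0: "\<And>H. H \<in> mats n A \<Longrightarrow>
      (\<And>i j x. i < n \<Longrightarrow> j < n \<Longrightarrow> x \<in> F \<Longrightarrow> (H $$ (i, j)) x = (P $$ (i, j)) (evaluation x)) \<Longrightarrow> t0 \<le> N n H"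
  shows "t0 \<le> D"
proof -
  interpret pd: operator_space fscale predual "dual_norm A N" by (rule operator_space_predual)
  define g where "g i j x = (P $$ (i, j)) (evaluation x)" for i j x
  obtain p q W where
    ineq: "\<And>k \<alpha> \<beta> K. 0 < k \<Longrightarrow> K \<in> mats k A \<Longrightarrow> N k K \<le> 1 \<Longrightarrow>
      Re (\<Sum>i<n. \<Sum>j<n. \<Sum>x\<in>F. W i j x * (\<Sum>l<k. \<Sum>r<k. \<alpha> i l * \<beta> r j * (K $$ (l, r)) x)) \<le>
      Re (\<Sum>i<n. \<Sum>j<n. p i j * (\<Sum>l<k. \<alpha> i l * cnj (\<alpha> j l))) +
      Re (\<Sum>i<n. \<Sum>j<n. q i j * (\<Sum>l<k. \<beta> l i * cnj (\<beta> l j)))"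
    and trace: "Re (\<Sum>i<n. p i i) + Re (\<Sum>i<n. q i i) \<le> 1"
    and big: "t0 \<le> Re (\<Sum>i<n. \<Sum>j<n. \<Sum>x\<in>F. W i j x * g i j x)"
  proof (rule separating_functional[OF F n, of g t0])
    show "t0 \<le> N n H" if "H \<in> mats n A"
      "\<And>i j x. i < n \<Longrightarrow> j < n \<Longrightarrow> x \<in> F \<Longrightarrow> (H $$ (i, j)) x = g i j x" for H
      using that unfolding g_def by (rule t0)
  qed (rule that; assumption)
  \<comment> \<open>K = 0 makes the left side of \<open>ineq\<close> vanish. With one of \<alpha>,
    \<beta> zero and the other a single vector, what remains says that one of the forms is
    nonnegative.\<close>
  have zero: "(\<Sum>i<n. \<Sum>j<n. \<Sum>x\<in>F. W i j x * (\<Sum>l<1. \<Sum>r<1. \<alpha> i l * \<beta> r j * (0\<^sub>m 1 1 $$ (l, r)) x)) = 0"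
    for \<alpha> \<beta> :: "nat \<Rightarrow> nat \<Rightarrow> complex"
    by (intro sum.neutral ballI) simp
  have p_nonneg: "0 \<le> Re (\<Sum>i<n. \<Sum>j<n. p i j * (v i * cnj (v j)))" for v
    using ineq[of 1 "0\<^sub>m 1 1" "\<lambda>i l. v i" "\<lambda>_ _. 0"] zero_mats[of 1] norm_zero[of 1]
    unfolding zero by (simp del: times_complex.sel)
  have q_nonneg: "0 \<le> Re (\<Sum>i<n. \<Sum>j<n. q i j * (v i * cnj (v j)))" for v
    using ineq[of 1 "0\<^sub>m 1 1" "\<lambda>_ _. 0" "\<lambda>l i. v i"] zero_mats[of 1] norm_zero[of 1]
    unfolding zero by (simp del: times_complex.sel)
  \<comment> \<open>Each of the two perturbations adds n \<epsilon> to a trace.\<close>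
  have main: "t0 \<le> D * (1 + 2 * real n * \<epsilon>)" if \<epsilon>: "0 < \<epsilon>" for \<epsilon>
  proof -
    obtain s r where sr: "\<And>i j. i < n \<Longrightarrow> j < n \<Longrightarrow> (\<Sum>l<n. s i l * r l j) = (if i = j then 1 else 0)"
      and rs: "\<And>i j. i < n \<Longrightarrow> j < n \<Longrightarrow> (\<Sum>l<n. r i l * s l j) = (if i = j then 1 else 0)"
      and s: "\<And>v. (\<Sum>l<n. (cmod (\<Sum>i<n. v i * s l i))\<^sup>2) =
        Re (\<Sum>i<n. \<Sum>j<n. p i j * (v i * cnj (v j))) + \<epsilon> * (\<Sum>i<n. (cmod (v i))\<^sup>2)"
      by (rule positive_form_factor[OF p_nonneg \<epsilon>]) (rule that; assumption)
    obtain s' r' where sr': "\<And>i j. i < n \<Longrightarrow> j < n \<Longrightarrow> (\<Sum>l<n. s' i l * r' l j) = (if i = j then 1 else 0)"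
      and rs': "\<And>i j. i < n \<Longrightarrow> j < n \<Longrightarrow> (\<Sum>l<n. r' i l * s' l j) = (if i = j then 1 else 0)"
      and s': "\<And>v. (\<Sum>l<n. (cmod (\<Sum>i<n. v i * s' l i))\<^sup>2) =
        Re (\<Sum>i<n. \<Sum>j<n. q i j * (v i * cnj (v j))) + \<epsilon> * (\<Sum>i<n. (cmod (v i))\<^sup>2)"
      by (rule positive_form_factor[OF q_nonneg \<epsilon>]) (rule that; assumption)
    have p_le: "Re (\<Sum>i<n. \<Sum>j<n. p i j * (v i * cnj (v j))) \<le> (\<Sum>a<n. (cmod (\<Sum>i<n. v i * s a i))\<^sup>2)" for v
      unfolding s using \<epsilon> by (simp add: sum_nonneg del: Re_sum)
    have q_le: "Re (\<Sum>i<n. \<Sum>j<n. q i j * (v i * cnj (v j))) \<le> (\<Sum>a<n. (cmod (\<Sum>i<n. v i * s' a i))\<^sup>2)" for v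
      unfolding s' using \<epsilon> by (simp add: sum_nonneg del: Re_sum)
    \<comment> \<open>\<open>W\<close> in coordinates that are orthonormal for the two perturbed forms\<close>
    define w where "w = mat n n (\<lambda>(a, b). fscale (1 / 2)
      (\<Sum>i<n. \<Sum>j<n. fscale (r i a * r' j b) (\<Sum>x\<in>F. fscale (W i j x) (evaluation x))))"
    have w: "w \<in> mats n predual"
      unfolding w_def using evaluation_predual
      by (intro matsI) (auto intro!: fun_space.subspace_scale[OF predual_subspace]
        fun_space.subspace_sum[OF predual_subspace])
    have w_apply: "(w $$ (a, b)) f = 1 / 2 * (\<Sum>i<n. \<Sum>j<n. r i a * r' j b * (\<Sum>x\<in>F. W i j x * f x))"
      if "a < n" "b < n" "f \<in> A" for a b f
      using that by (simp add: w_def sum_fun_apply evaluation_def)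
    \<comment> \<open>The factor 1/2 in w matches \<open>bil_bound_squares\<close>: twice its form
      at \<xi>, \<eta> is the pairing of W with \<alpha> K \<beta>, which \<open>ineq\<close> bounds
      by the two forms.\<close>
    have amp_le: "amp_bound n k w K 1" if k: "0 < k" and K: "K \<in> mats k A" "N k K \<le> 1" for k K
      unfolding amp_bound_def
    proof (rule bil_bound_squares)
      fix \<xi> \<eta> :: "nat \<times> nat \<Rightarrow> complex"
      \<comment> \<open>Since r and r' invert s and s', the perturbed forms at \<alpha> and \<beta>
        become the squared lengths of \<xi> and \<eta>.\<close>
      define \<alpha> where "\<alpha> i l = (\<Sum>a<n. r i a * \<xi> (a, l))" for i l
      define \<beta> where "\<beta> t j = (\<Sum>b<n. r' j b * \<eta> (b, t))" for t j
      let ?w = "\<lambda>i j l t. \<Sum>x\<in>F. W i j x * (K $$ (l, t)) x"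
      have K_in: "K $$ (l, t) \<in> A" if "l < k" "t < k" for l t
        using matsD(2)[OF K(1)] that by blast
      have "2 * (\<Sum>p\<in>{..<n} \<times> {..<k}. \<Sum>q\<in>{..<n} \<times> {..<k}.
          \<xi> p * (w $$ (fst p, fst q)) (K $$ (snd p, snd q)) * \<eta> q) =
        (\<Sum>a<n. \<Sum>l<k. \<Sum>b<n. \<Sum>t<k. \<xi> (a, l) *
           (\<Sum>i<n. \<Sum>j<n. r i a * r' j b * ?w i j l t) * \<eta> (b, t))"
        unfolding sum_pairs sum_distrib_left[of 2]
        by (intro sum.cong refl) (simp add: w_apply K_in)
      also have "\<dots> = (\<Sum>i<n. \<Sum>j<n. \<Sum>l<k. \<Sum>t<k. \<alpha> i l * \<beta> t j * ?w i j l t)"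
        unfolding \<alpha>_def \<beta>_def by (rule twisted_form)
      also have "\<dots> = (\<Sum>i<n. \<Sum>j<n. \<Sum>x\<in>F. W i j x * (\<Sum>l<k. \<Sum>t<k. \<alpha> i l * \<beta> t j * (K $$ (l, t)) x))"
      proof (intro sum.cong refl)
        fix i j
        show "(\<Sum>l<k. \<Sum>t<k. \<alpha> i l * \<beta> t j * ?w i j l t) =
            (\<Sum>x\<in>F. W i j x * (\<Sum>l<k. \<Sum>t<k. \<alpha> i l * \<beta> t j * (K $$ (l, t)) x))"
          unfolding sum_pull_out by (simp add: sum_distrib_left mult_ac)
      qed
      finally have "2 * (\<Sum>p\<in>{..<n} \<times> {..<k}. \<Sum>q\<in>{..<n} \<times> {..<k}.
          \<xi> p * (w $$ (fst p, fst q)) (K $$ (snd p, snd q)) * \<eta> q) =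
        (\<Sum>i<n. \<Sum>j<n. \<Sum>x\<in>F. W i j x * (\<Sum>l<k. \<Sum>t<k. \<alpha> i l * \<beta> t j * (K $$ (l, t)) x))"
        (is "2 * ?lhs = ?rhs") .
      then have "2 * Re ?lhs = Re ?rhs" by (simp only: Re_double[symmetric])
      also have "\<dots> \<le> Re (\<Sum>i<n. \<Sum>j<n. p i j * (\<Sum>l<k. \<alpha> i l * cnj (\<alpha> j l))) +
          Re (\<Sum>i<n. \<Sum>j<n. q i j * (\<Sum>l<k. \<beta> l i * cnj (\<beta> l j)))"
        using k K by (rule ineq)
      also have "\<dots> = (\<Sum>l<k. Re (\<Sum>i<n. \<Sum>j<n. p i j * (\<alpha> i l * cnj (\<alpha> j l)))) +
          (\<Sum>l<k. Re (\<Sum>i<n. \<Sum>j<n. q i j * (\<beta> l i * cnj (\<beta> l j))))"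
        unfolding sum_pull_out Re_sum ..
      also have "\<dots> \<le> (\<Sum>l<k. \<Sum>a<n. (cmod (\<Sum>i<n. \<alpha> i l * s a i))\<^sup>2) +
          (\<Sum>l<k. \<Sum>a<n. (cmod (\<Sum>i<n. \<beta> l i * s' a i))\<^sup>2)"
        by (intro add_mono sum_mono p_le q_le)
      also have "(\<Sum>l<k. \<Sum>a<n. (cmod (\<Sum>i<n. \<alpha> i l * s a i))\<^sup>2) = (\<Sum>l<k. \<Sum>a<n. (cmod (\<xi> (a, l)))\<^sup>2)"
        unfolding \<alpha>_def by (intro sum.cong refl) (simp add: sum_inverse_apply[OF sr])
      also have "\<dots> = (l2 \<xi> ({..<n} \<times> {..<k}))\<^sup>2"
        unfolding l2_power2 sum_pairs by (rule sum.swap)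
      also have "(\<Sum>l<k. \<Sum>a<n. (cmod (\<Sum>i<n. \<beta> l i * s' a i))\<^sup>2) = (\<Sum>l<k. \<Sum>a<n. (cmod (\<eta> (a, l)))\<^sup>2)"
        unfolding \<beta>_def by (intro sum.cong refl) (simp add: sum_inverse_apply[OF sr'])
      also have "\<dots> = (l2 \<eta> ({..<n} \<times> {..<k}))\<^sup>2"
        unfolding l2_power2 sum_pairs by (rule sum.swap)
      finally show "2 * Re ?lhs \<le> 1 * ((l2 \<xi> ({..<n} \<times> {..<k}))\<^sup>2 + (l2 \<eta> ({..<n} \<times> {..<k}))\<^sup>2)"
        by (simp only: mult_1)
    qed auto
    have "dual_norm A N n w \<le> 1"
      using dual_norm_le_iff[OF n mats_predual_dual[OF w], of 1] amp_le by simp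
    from bound[OF w this] have bil: "bil_bound ({..<n} \<times> {..<n}) ({..<n} \<times> {..<n})
        (\<lambda>p q. (P $$ (snd p, snd q)) (w $$ (fst p, fst q))) D"
      unfolding amp_bound_swap .
    have P_w: "(P $$ (l, t)) (w $$ (a, b)) = 1 / 2 * (\<Sum>i<n. \<Sum>j<n. r i a * r' j b * (\<Sum>x\<in>F. W i j x * g l t x))"
      if "l < n" "t < n" "a < n" "b < n" for l t a b
    proof -
      have Q: "P $$ (l, t) \<in> dual_space fscale predual (dual_norm A N)"
        using matsD(2)[OF P] that by blast
      note in_predual = fun_space.subspace_scale[OF predual_subspace] fun_space.subspace_sum[OF predual_subspace] evaluation_predual
      show ?thesis
        using that
        by (simp add: w_def g_def dual_spaceD(2)[OF Q] pd.dual_space_sum[OF Q] in_predual)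
    qed
    \<comment> \<open>The factors themselves serve as test vectors: contracted with r and r' they
      become Kronecker deltas, and the form of P at w collapses to half the pairing of W with
      g.\<close>
    define \<xi> where "\<xi> p = s (fst p) (snd p)" for p
    define \<eta> where "\<eta> p = s' (fst p) (snd p)" for p
    have "2 * (\<Sum>p\<in>{..<n} \<times> {..<n}. \<Sum>q\<in>{..<n} \<times> {..<n}. \<xi> p * (P $$ (snd p, snd q)) (w $$ (fst p, fst q)) * \<eta> q) =
        (\<Sum>a<n. \<Sum>l<n. \<Sum>b<n. \<Sum>t<n. \<xi> (a, l) *
           (\<Sum>i<n. \<Sum>j<n. r i a * r' j b * (\<Sum>x\<in>F. W i j x * g l t x)) * \<eta> (b, t))"
      unfolding sum_pairs sum_distrib_left[of 2]
      by (intro sum.cong refl) (simp add: P_w)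
    also have "\<dots> = (\<Sum>i<n. \<Sum>j<n. \<Sum>l<n. \<Sum>t<n. (\<Sum>a<n. r i a * \<xi> (a, l)) * (\<Sum>b<n. r' j b * \<eta> (b, t)) *
        (\<Sum>x\<in>F. W i j x * g l t x))"
      by (rule twisted_form)
    also have "\<dots> = (\<Sum>i<n. \<Sum>j<n. \<Sum>x\<in>F. W i j x * g i j x)"
    proof (intro sum.cong refl)
      fix i j assume ij: "i \<in> {..<n}" "j \<in> {..<n}"
      let ?G = "\<lambda>l t. \<Sum>x\<in>F. W i j x * g l t x"
      have "(\<Sum>l<n. \<Sum>t<n. (\<Sum>a<n. r i a * \<xi> (a, l)) * (\<Sum>b<n. r' j b * \<eta> (b, t)) * ?G l t) =
          (\<Sum>l<n. if l = i then \<Sum>t<n. if t = j then ?G l t else 0 else 0)"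
        unfolding \<xi>_def \<eta>_def fst_conv snd_conv
        using ij rs rs' by (intro sum.cong refl) (simp add: if_distrib[of "\<lambda>x. x * _"] cong: if_cong)
      then show "(\<Sum>l<n. \<Sum>t<n. (\<Sum>a<n. r i a * \<xi> (a, l)) * (\<Sum>b<n. r' j b * \<eta> (b, t)) * ?G l t) = ?G i j"
        using ij by simp
    qed
    finally have eq: "(\<Sum>i<n. \<Sum>j<n. \<Sum>x\<in>F. W i j x * g i j x) =
      2 * (\<Sum>p\<in>{..<n} \<times> {..<n}. \<Sum>q\<in>{..<n} \<times> {..<n}. \<xi> p * (P $$ (snd p, snd q)) (w $$ (fst p, fst q)) * \<eta> q)"
      by (rule sym)
    \<comment> \<open>The squared Hilbert-Schmidt norm of a factor is the trace of its form, seen by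
      evaluating the form at the unit vectors.\<close>
    have trace_sq: "(l2 (\<lambda>p. z (fst p) (snd p)) ({..<n} \<times> {..<n}))\<^sup>2 = Re (\<Sum>i<n. o' i i) + \<epsilon> * real n"
      if z: "\<And>v. (\<Sum>l<n. (cmod (\<Sum>i<n. v i * z l i))\<^sup>2) =
        Re (\<Sum>i<n. \<Sum>j<n. o' i j * (v i * cnj (v j))) + \<epsilon> * (\<Sum>i<n. (cmod (v i))\<^sup>2)"
      for z o' :: "nat \<Rightarrow> nat \<Rightarrow> complex"
    proof -
      have "(\<Sum>l<n. (cmod (z l m))\<^sup>2) = Re (o' m m) + \<epsilon>" if m: "m < n" for m
      proof -
        let ?v = "\<lambda>i. if i = m then 1 else 0 :: complex"
        have 1: "(\<Sum>i<n. ?v i * z l i) = z l m" for l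
          using m sum_mult_delta[of "{..<n}" m ?v "z l"] by (simp add: mult.commute)
        have "(\<Sum>j<n. o' i j * (?v i * cnj (?v j))) = o' i m * ?v i" for i
          unfolding mult.assoc[symmetric] using m by (intro sum_mult_delta) auto
        then have 2: "(\<Sum>i<n. \<Sum>j<n. o' i j * (?v i * cnj (?v j))) = o' m m"
          using m sum_mult_delta[of "{..<n}" m ?v "\<lambda>i. o' i m"] by simp
        have "(\<Sum>i<n. (cmod (?v i))\<^sup>2) = (\<Sum>i<n. if i = m then 1 else 0)"
          by (intro sum.cong) auto
        then have 3: "(\<Sum>i<n. (cmod (?v i))\<^sup>2) = 1" using m by simp
        show ?thesis using z[of ?v] unfolding 1 2 3 by simp
      qed
      then have "(\<Sum>m<n. \<Sum>l<n. (cmod (z l m))\<^sup>2) = (\<Sum>m<n. Re (o' m m) + \<epsilon>)" by simp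
      moreover have "(\<Sum>m<n. \<Sum>l<n. (cmod (z l m))\<^sup>2) = (\<Sum>l<n. \<Sum>m<n. (cmod (z l m))\<^sup>2)" by (rule sum.swap)
      ultimately show ?thesis
        unfolding l2_power2 sum_pairs by (simp add: sum.distrib)
    qed
    have "t0 \<le> 2 * cmod (\<Sum>p\<in>{..<n} \<times> {..<n}. \<Sum>q\<in>{..<n} \<times> {..<n}. \<xi> p * (P $$ (snd p, snd q)) (w $$ (fst p, fst q)) * \<eta> q)"
      (is "_ \<le> 2 * cmod ?Z")
      using big complex_Re_le_cmod[of ?Z] unfolding eq Re_double by linarith
    also have "\<dots> \<le> 2 * (D * l2 \<xi> ({..<n} \<times> {..<n}) * l2 \<eta> ({..<n} \<times> {..<n}))"
      using bil_boundD[OF bil, of \<xi> \<eta>] by simp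
    also have "\<dots> \<le> D * ((l2 \<xi> ({..<n} \<times> {..<n}))\<^sup>2 + (l2 \<eta> ({..<n} \<times> {..<n}))\<^sup>2)"
      using mult_left_mono[OF sum_squares_bound[of "l2 \<xi> ({..<n} \<times> {..<n})" "l2 \<eta> ({..<n} \<times> {..<n})"] D]
      by (simp add: mult_ac)
    also have "\<dots> \<le> D * (1 + 2 * real n * \<epsilon>)"
      unfolding \<xi>_def \<eta>_def trace_sq[OF s] trace_sq[OF s'] using trace D
      by (intro mult_left_mono) (auto simp: algebra_simps)
    finally show ?thesis .
  qed
  show ?thesis
  proof (rule field_le_epsilon)
    fix e :: real assume e: "0 < e"
    \<comment> \<open>Small enough that the error 2 n D \<epsilon> is at most e; the 1 keeps the
      denominator positive when D = 0.\<close>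
    define \<epsilon> where "\<epsilon> = e / (2 * real n * D + 1)"
    have pos: "0 < 2 * real n * D + 1" using D by (simp add: add_nonneg_pos)
    then have "0 < \<epsilon>" using e by (simp add: \<epsilon>_def)
    have "(2 * real n * D + 1) * \<epsilon> = e" using pos by (simp add: \<epsilon>_def)
    then have "D * (1 + 2 * real n * \<epsilon>) \<le> D + e"
      using \<open>0 < \<epsilon>\<close> by (simp add: algebra_simps)
    then show "t0 \<le> D + e" using main[OF \<open>0 < \<epsilon>\<close>] by linarith
  qed
qed

end

section \<open>The algebra as the dual of the span of evaluations\<close>

context function_operator_algebra
begin

interpretation fun_space: vector_space
  "fscale :: complex \<Rightarrow> (('x \<Rightarrow> complex) \<Rightarrow> complex) \<Rightarrow> ('x \<Rightarrow> complex) \<Rightarrow> complex"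
  by (rule vector_space_fscale)

interpretation pd: operator_space fscale predual "dual_norm A N"
  by (rule operator_space_predual)

text \<open>The canonical map into the bidual of A, with the functionals restricted to
  \<open>predual\<close> and extended by 0 as \<open>dual_space\<close> prescribes.\<close>

definition canonical_embedding :: "('x \<Rightarrow> complex) \<Rightarrow> (('x \<Rightarrow> complex) \<Rightarrow> complex) \<Rightarrow> complex" where
  "canonical_embedding f = (\<lambda>v. if v \<in> predual then v f else 0)"

lemma canonical_embedding_dual:
  assumes f: "f \<in> A"
  shows "canonical_embedding f \<in> dual_space fscale predual (dual_norm A N)"
proof -
  have "cmod (v f) \<le> norm1 N f * norm1 (dual_norm A N) v" if v: "v \<in> predual" for v
  proof -
    have "amp_bound 1 1 (mat 1 1 (\<lambda>_. v)) (mat 1 1 (\<lambda>_. f))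
        (norm1 (dual_norm A N) v * norm1 N f)"
      unfolding norm1_def
      by (intro dual_norm_amp_bound mats_predual_dual pd.singleton_mats singleton_mats v f) auto
    from bil_bound_entry[OF this[unfolded amp_bound_def], of "(0, 0)" "(0, 0)"]
    show ?thesis by (simp add: mult.commute)
  qed
  then show ?thesis
    unfolding dual_space_def
    by (intro CollectI conjI exI[of _ "norm1 N f"])
      (auto simp: canonical_embedding_def fun_space.subspace_add[OF predual_subspace]
        fun_space.subspace_scale[OF predual_subspace])
qed

lemma mats_canonical_embedding:
  "G \<in> mats n A \<Longrightarrow> map_mat canonical_embedding G \<in> mats n (dual_space fscale predual (dual_norm A N))"
  using canonical_embedding_dual by (auto simp: mats_iff)

text \<open>Up to the shuffle, amplifying the image of G at w is amplifying w at G, and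
  \<open>predual\<close> carries the norm by which w acts on A.\<close>

lemma dual_norm_canonical_embedding_le:
  assumes n: "0 < n" and G: "G \<in> mats n A"
  shows "dual_norm predual (dual_norm A N) n (map_mat canonical_embedding G) \<le> N n G"
proof (subst pd.dual_norm_le_iff[OF n mats_canonical_embedding[OF G] norm_nonneg[OF n G]], intro allI impI)
  fix m w assume m: "0 < m" and w: "w \<in> mats m predual" and le: "dual_norm A N m w \<le> 1"
  have "amp_bound m n w G (dual_norm A N m w * N n G)"
    by (rule dual_norm_amp_bound[OF m mats_predual_dual[OF w] n G])
  moreover have "dual_norm A N m w * N n G \<le> N n G"
    using mult_right_mono[OF le norm_nonneg[OF n G]] by simp
  ultimately have "bil_bound ({..<n} \<times> {..<m}) ({..<n} \<times> {..<m})
      (\<lambda>p q. (w $$ (snd p, snd q)) (G $$ (fst p, fst q))) (N n G)"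
    unfolding amp_bound_swap by (rule bil_bound_mono)
  then show "amp_bound n m (map_mat canonical_embedding G) w (N n G)"
    unfolding amp_bound_def using G matsD(2)[OF w]
    by (subst bil_bound_cong) (auto simp: canonical_embedding_def)
qed

text \<open>An interpolant H of the image of G on F differs from G by a matrix over the vanishing
  ideal. The quotient norm is thus a lower bound for the norms of interpolants, and locality takes
  the supremum over F.\<close>

lemma dual_norm_canonical_embedding_ge:
  assumes "local_algebra A N" and n: "0 < n" and G: "G \<in> mats n A"
  shows "N n G \<le> dual_norm predual (dual_norm A N) n (map_mat canonical_embedding G)" (is "_ \<le> ?D")
proof -
  let ?P = "map_mat canonical_embedding G"
  have P: "?P \<in> mats n (dual_space fscale predual (dual_norm A N))"
    using G by (rule mats_canonical_embedding)
  have D: "0 \<le> ?D" using n P by (rule pd.dual_norm_nonneg)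
  have "quotient_norm A N F n G \<le> ?D" if F: "finite F" for F
  proof (rule interpolation_norm_le[OF F n D P])
    show "amp_bound n n ?P w ?D" if "w \<in> mats n predual" "dual_norm A N n w \<le> 1" for w
      using pd.dual_norm_le_iff[OF n P D] n that by blast
    fix H assume H: "H \<in> mats n A"
      and eq: "\<And>i j x. i < n \<Longrightarrow> j < n \<Longrightarrow> x \<in> F \<Longrightarrow> (H $$ (i, j)) x = (?P $$ (i, j)) (evaluation x)"
    have P_evaluation: "(?P $$ (i, j)) (evaluation x) = (G $$ (i, j)) x" if "i < n" "j < n" for i j x
      using that G matsD(2)[OF G that] evaluation_predual by (simp add: canonical_embedding_def evaluation_def)
    have K: "H - G \<in> mats n (vanishing_ideal A F)"
      using matsD[OF H] matsD[OF G] subspace_diff[OF carrier_subspace] eq P_evaluation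
      by (intro matsI) (auto simp: vanishing_ideal_def)
    have "bdd_below ((\<lambda>K. N n (G + K)) ` mats n (vanishing_ideal A F))"
    proof (rule bdd_belowI2)
      fix K assume "K \<in> mats n (vanishing_ideal A F)"
      then have "K \<in> mats n A" by (auto simp: mats_iff vanishing_ideal_def)
      then show "0 \<le> N n (G + K)" by (intro norm_nonneg n add_mats G)
    qed
    then have "quotient_norm A N F n G \<le> N n (G + (H - G))"
      unfolding quotient_norm_def using K by (rule cINF_lower)
    also have "G + (H - G) = H" using H G by (intro eq_matI) auto
    finally show "quotient_norm A N F n G \<le> N n H" .
  qed
  moreover have "N n G = (SUP F \<in> {F. finite F}. quotient_norm A N F n G)"
    using assms by (simp add: local_algebra_def)
  ultimately show ?thesis by (simp only:) (rule cSUP_least, auto)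
qed

text \<open>Interpolants of uniformly bounded norm exist on every finite F. Directed by F, they
  agree with f at each given point from some stage on, hence converge pointwise to f.\<close>

lemma dual_functional_in_algebra:
  assumes complete: "BPW_complete A N" and p: "p \<in> dual_space fscale predual (dual_norm A N)"
  shows "(\<lambda>x. p (evaluation x)) \<in> A"
proof -
  define f where "f x = p (evaluation x)" for x
  define P where "P = mat 1 1 (\<lambda>_. p)"
  have P: "P \<in> mats 1 (dual_space fscale predual (dual_norm A N))"
    unfolding P_def using p by (intro matsI) auto
  obtain c where c: "0 \<le> c"
    "\<And>m w. 0 < m \<Longrightarrow> w \<in> mats m predual \<Longrightarrow> dual_norm A N m w \<le> 1 \<Longrightarrow> amp_bound 1 m P w c"
    using pd.dual_norm_bounded[OF P] by auto
  \<comment> \<open>Norm c itself is only known to be approached; any constant larger than c would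
    do.\<close>
  define B where "B F = {h \<in> A. norm1 N h \<le> c + 1 \<and> (\<forall>x\<in>F. h x = f x)}" for F
  have nonempty: "B F \<noteq> {}" if F: "finite F" for F
  proof
    assume empty: "B F = {}"
    \<comment> \<open>If B F were empty, every interpolant on F would have norm above c + 1, making
      this a lower bound.\<close>
    have "c + 1 \<le> c"
    proof (rule interpolation_norm_le[OF F _ c(1) P])
      fix H assume H: "H \<in> mats 1 A"
        and eq: "\<And>i j x. i < 1 \<Longrightarrow> j < 1 \<Longrightarrow> x \<in> F \<Longrightarrow> (H $$ (i, j)) x = (P $$ (i, j)) (evaluation x)"
      have "mat 1 1 (\<lambda>_. H $$ (0, 0)) = H" using H by (intro eq_matI) auto
      then have "norm1 N (H $$ (0, 0)) = N 1 H" by (simp add: norm1_def)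
      moreover have "H $$ (0, 0) \<in> A" using matsD(2)[OF H] by simp
      moreover have "\<forall>x\<in>F. (H $$ (0, 0)) x = f x" using eq[of 0 0] by (simp add: P_def f_def)
      ultimately have "H $$ (0, 0) \<in> B F" if "N 1 H \<le> c + 1"
        using that unfolding B_def by simp
      then show "c + 1 \<le> N 1 H" using empty by fastforce
    qed (use c(2) in auto)
    then show False by simp
  qed
  define \<Phi> where "\<Phi> = (INF F\<in>{F. finite F}. principal (B F))"
  have ev: "eventually Q \<Phi> \<longleftrightarrow> (\<exists>F. finite F \<and> (\<forall>h\<in>B F. Q h))" for Q
  proof -
    have "eventually Q \<Phi> \<longleftrightarrow> (\<exists>F\<in>{F. finite F}. eventually Q (principal (B F)))"
      unfolding \<Phi>_def
    proof (rule eventually_INF_base)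
      fix F F' :: "'x set" assume "F \<in> {F. finite F}" "F' \<in> {F. finite F}"
      then show "\<exists>G\<in>{F. finite F}. principal (B G) \<le> inf (principal (B F)) (principal (B F'))"
        by (intro bexI[of _ "F \<union> F'"]) (auto simp: B_def)
    qed auto
    then show ?thesis by (simp add: eventually_principal)
  qed
  have "\<Phi> \<noteq> bot" using nonempty by (auto simp: trivial_limit_def ev)
  moreover have "\<forall>\<^sub>F h in \<Phi>. h \<in> A \<and> norm1 N h \<le> c + 1"
    unfolding ev by (rule exI[of _ "{}"]) (simp add: B_def)
  moreover have "((\<lambda>h. h x) \<longlongrightarrow> f x) \<Phi>" for x
    by (rule tendsto_eventually, unfold ev, rule exI[of _ "{x}"]) (simp add: B_def)
  ultimately have "f \<in> A" using complete unfolding BPW_complete_def by blast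
  then show ?thesis by (simp add: f_def[abs_def])
qed

lemma canonical_embedding_bij:
  assumes "BPW_complete A N"
  shows "bij_betw canonical_embedding A (dual_space fscale predual (dual_norm A N))"
proof (rule bij_betwI')
  fix f g assume fg: "f \<in> A" "g \<in> A"
  have "f x = g x" if eq: "canonical_embedding f = canonical_embedding g" for x
    using fun_cong[OF eq, of "evaluation x"] fg evaluation_predual
    by (simp add: canonical_embedding_def evaluation_def)
  then show "canonical_embedding f = canonical_embedding g \<longleftrightarrow> f = g" by auto
next
  show "canonical_embedding f \<in> dual_space fscale predual (dual_norm A N)" if "f \<in> A" for f
    using that by (rule canonical_embedding_dual)
next
  fix p assume p: "p \<in> dual_space fscale predual (dual_norm A N)"
  define f where "f x = p (evaluation x)" for x
  have f: "f \<in> A" using dual_functional_in_algebra[OF assms p] by (simp add: f_def[abs_def])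
  \<comment> \<open>The functionals v at which p and evaluation at f agree form a subspace, which
    contains every point evaluation by the choice of f.\<close>
  have "predual \<subseteq> {v \<in> predual. p v = v f}"
    unfolding predual_def
  proof (rule fun_space.span_minimal)
    show "range evaluation \<subseteq> {v \<in> fun_space.span (range evaluation). p v = v f}"
      using f by (auto simp: evaluation_def f_def intro: fun_space.span_base)
    show "fun_space.subspace {v \<in> fun_space.span (range evaluation). p v = v f}"
      unfolding predual_def[symmetric]
      by (rule fun_space.subspaceI)
        (auto simp: dual_spaceD(1,2)[OF p] pd.dual_space_zero[OF p] fun_space.subspace_0[OF predual_subspace]
          fun_space.subspace_add[OF predual_subspace] fun_space.subspace_scale[OF predual_subspace])
  qed
  then have "p = canonical_embedding f"
    using dual_spaceD(4)[OF p] by (auto simp: canonical_embedding_def fun_eq_iff)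
  then show "\<exists>f\<in>A. p = canonical_embedding f" using f by blast
qed

lemma dual_operator_algebra_if_local_BPW_complete:
  assumes "local_algebra A N" and "BPW_complete A N"
  shows "dual_operator_algebra fscale A N"
proof -
  have additive: "canonical_embedding (f + g) = canonical_embedding f + canonical_embedding g"
    if "f \<in> A" "g \<in> A" for f g
    using dual_spaceD(1) predual_dual that by (fastforce simp: canonical_embedding_def fun_eq_iff)
  have homogeneous: "canonical_embedding (fscale c f) = fscale c (canonical_embedding f)" if "f \<in> A" for c f
    using dual_spaceD(2) predual_dual that by (fastforce simp: canonical_embedding_def fun_eq_iff)
  have "complete_isometric_iso fscale A N fscale (dual_space fscale predual (dual_norm A N))
      (dual_norm predual (dual_norm A N)) canonical_embedding"
    unfolding complete_isometric_iso_def
    using canonical_embedding_bij[OF assms(2)] additive homogeneous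
      dual_norm_canonical_embedding_le dual_norm_canonical_embedding_ge[OF assms(1)]
    by (auto intro: antisym)
  then show ?thesis
    unfolding dual_operator_algebra_def
    using operator_algebra_axioms operator_space_predual by blast
qed

end

theorem corollary2p5:
  fixes A :: "('x \<Rightarrow> complex) set" and N :: "nat \<Rightarrow> ('x \<Rightarrow> complex) mat \<Rightarrow> real"
  assumes "function_operator_algebra A N"
    and "local_algebra A N"
    and "BPW_complete A N"
  shows "dual_operator_algebra fscale A N"
  using assms by (rule function_operator_algebra.dual_operator_algebra_if_local_BPW_complete)

end
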